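(* Let $D_1,D_2$ be open balls in $\mathbb R^3$, and let $u^j_f$ denote the weak solution of the sound-soft initial boundary value problem with obstacle $D=D_j$ and $f=\chi_B$. Assume $[\overline B\cup\overline{B'}]\cap\overline{D_j}=\emptyset$ for $j=1,2$, fix $0<s<\eta'$, and assume that for $D=D_1$ and $D=D_2$, $$T>\sup_{\omega\in S^2}\min_{x\in\partial D}\phi(x;p,p'+s\omega)-(\eta+\eta'-s).$$ If $u^1_f=u^2_f$ on $B'\times(0,T)$, then $D_1=D_2$.
   Context: For an obstacle $D$ (bounded open set with $C^2$ boundary and connected exterior) and $f\in L^2(\mathbb R^3)$ with $\mathrm{supp}\,f\cap\overline D=\emptyset$, the sound-soft problem is $\partial_t^2u-\Delta u=0$ in $(\mathbb R^3\setminus\overline D)\times(0,T)$, $u(\cdot,0)=0$, $\partial_tu(\cdot,0)=f$ in $\mathbb R^3\setminus\overline D$, $u=0$ on $\partial D\times(0,T)$, with $0<T<\infty$. $B,B'$ are open balls with centers $p,p'$ and radii $\eta,\eta'$; $\chi_B$ is the characteristic function of $B$. $\phi(x;y,y')=|y-x|+|x-y'|$; $[F]$ denotes the convex hull; $S^2$ the unit sphere. *)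

theory Defs
  imports "HOL-Analysis.Analysis"
begin

definition C1_fun :: "((real^3) \<times> real \<Rightarrow> real) \<Rightarrow> bool" where
  "C1_fun g \<longleftrightarrow> (\<exists>g'. (\<forall>z. (g has_derivative blinfun_apply (g' z)) (at z)) \<and> continuous_on UNIV g')"

definition tsupp :: "((real^3) \<times> real \<Rightarrow> real) \<Rightarrow> ((real^3) \<times> real) set" where
  "tsupp g = closure {z. g z \<noteq> 0}"

definition st_grad :: "((real^3) \<times> real \<Rightarrow> real) \<Rightarrow> (real^3) \<times> real \<Rightarrow> (real^3) \<times> real" where
  "st_grad g z = ((\<chi> i. frechet_derivative g (at z) (axis i 1, 0)), frechet_derivative g (at z) (0, 1))"

text \<open>Weak (generalized, energy class) solution of the sound-soft problem
  u_tt - Laplace u = 0 in (R^3 - closure D) x (0,T), u(.,0) = 0, u_t(.,0) = f, u = 0 on the boundary.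
  u is extended by 0 to negative times (this encodes the initial condition u(.,0)=0),
  lies in the H^1-closure (on Omega x (-inf,T)) of C^1 functions with compact support in
  (R^3 - closure D) x R (this encodes u in H^1 with zero boundary values), with weak gradient G,
  and satisfies the weak formulation against C^1 test functions compactly supported in
  (R^3 - closure D) x (-inf,T).\<close>
definition weak_solution ::
  "(real^3) set \<Rightarrow> ((real^3) \<Rightarrow> real) \<Rightarrow> real \<Rightarrow> ((real^3) \<times> real \<Rightarrow> real) \<Rightarrow> bool" where
  "weak_solution D f T u \<longleftrightarrow>
     (\<exists>G :: (real^3) \<times> real \<Rightarrow> (real^3) \<times> real.
        u \<in> borel_measurable lborel \<and> G \<in> borel_measurable lborel \<and>
        (\<forall>x t. t < 0 \<longrightarrow> u (x, t) = 0) \<and>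
        (\<exists>\<phi> :: nat \<Rightarrow> (real^3) \<times> real \<Rightarrow> real.
           (\<forall>n. C1_fun (\<phi> n) \<and> compact (tsupp (\<phi> n)) \<and> tsupp (\<phi> n) \<subseteq> (- closure D) \<times> UNIV) \<and>
           (\<lambda>n. \<integral>\<^sup>+ z \<in> (- closure D) \<times> {..<T}.
                  ennreal ((\<phi> n z - u z)\<^sup>2 + (norm (st_grad (\<phi> n) z - G z))\<^sup>2) \<partial>lborel)
             \<longlonglongrightarrow> 0) \<and>
        (\<forall>\<eta>. C1_fun \<eta> \<and> compact (tsupp \<eta>) \<and> tsupp \<eta> \<subseteq> (- closure D) \<times> {..<T} \<longrightarrow>
           (LINT z : (- closure D) \<times> {0<..<T} | lborel.
               snd (G z) * snd (st_grad \<eta> z) - fst (G z) \<bullet> fst (st_grad \<eta> z))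
           + (LINT x : (- closure D) | lborel. f x * \<eta> (x, 0)) = 0))"

definition phi :: "real^3 \<Rightarrow> real^3 \<Rightarrow> real^3 \<Rightarrow> real" where
  "phi x y y' = dist y x + dist x y'"

end

theory Submission
  imports Defs "HOL-Real_Asymp.Real_Asymp"
begin

text \<open>The enclosure method, with barriers in place of asymptotic expansions. Multiply the solution by
  \<open>exp (- \<tau> t)\<close> and integrate over time: up to an error of order \<open>exp (- \<tau> T)\<close> the result \<open>w\<close> solves
  \<open>- \<Delta> w + \<tau>\<^sup>2 w = \<chi>\<^sub>B\<close> outside the obstacle with zero boundary values. Let \<open>v\<close> be the free-space solution, an explicit
  radial function. By the weak maximum principle \<open>v - w\<close> is bounded below by the field of any point source in the
  obstacle that is dominated by \<open>v\<close>, and above by a finite sum of such fields that dominates \<open>v\<close> on the boundary.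
  Consequently \<open>v - w\<close> decays near \<open>y\<close> like \<open>exp (- \<tau> (m y - \<eta>))\<close>, where \<open>m y\<close> is the minimum of \<open>phi x p y\<close> over the
  obstacle. Letting \<open>\<tau>\<close> tend to infinity, equal data on \<open>B'\<close> force equal \<open>m\<close> wherever \<open>m y < T + \<eta>\<close>; the hypothesis on
  \<open>T\<close> turns this into equality of \<open>m\<close> on the sphere of radius \<open>s\<close> about \<open>p'\<close>.

  From there on the argument is geometric. On that sphere \<open>m\<close> attains its minimum in the direction of the
  reflection point \<open>x\<close> belonging to \<open>p'\<close>, so both balls share \<open>x\<close> and, by the law of reflection, the normal at \<open>x\<close>.
  If their radii differed they would be nested, and only receivers on a single ray could see equal \<open>m\<close>.\<close>


section \<open>The potential of a ball for the modified Helmholtz operator\<close>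

text \<open>A weak solution is only an energy limit of C^1 functions, so the transform
  \<open>w\<close> is never formed. All estimates are made for the transform of the
  \<open>n\<close>-th approximant, which is C^1 and vanishes near the obstacle; \<open>n\<close>
  tends to infinity while \<open>\<tau>\<close> is fixed. The errors are controlled in the square
  mean, hence the two obstacles are compared on average over a small ball about the receiver.

  A true point source is singular. The potential of a ball inside the obstacle replaces it: it is
  C^1 everywhere, equals \<open>exp (- \<tau> r) / r\<close> off that ball, and test functions
  supported outside the obstacle do not see its source. The incident field belongs to the same
  family; its normalising constant, at least of order
  \<open>exp (\<tau> \<eta>) / \<tau> ^ 3\<close>, is what shortens arrival times by
  \<open>\<eta>\<close>.

  On the sphere of radius \<open>s\<close> the hypothesis on \<open>T\<close> only gives
  \<open>m y < T + \<eta> + (\<eta>' - s)\<close>. The gap is closed by moving the receiver inside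
  \<open>B'\<close> toward the reflection point, by less than \<open>\<eta>' - s\<close>: the
  shortest path shrinks by exactly this distance, and the triangle inequality carries the comparison
  back.\<close>

text \<open>\<open>shc q\<close> is \<open>sinh (sqrt q) / sqrt q\<close>, written as an entire function of \<open>q\<close>: composed with the
  squared distance it yields a radial function that is smooth at the centre.\<close>

definition shc_coeff :: "nat \<Rightarrow> real" where
  "shc_coeff n = 1 / fact (2 * n + 1)"

definition shc :: "real \<Rightarrow> real" where
  "shc q = (\<Sum>n. shc_coeff n * q ^ n)"

definition shc' :: "real \<Rightarrow> real" where
  "shc' q = (\<Sum>n. diffs shc_coeff n * q ^ n)"

definition shc'' :: "real \<Rightarrow> real" where
  "shc'' q = (\<Sum>n. diffs (diffs shc_coeff) n * q ^ n)"

lemma summable_shc: "summable (\<lambda>n. shc_coeff n * y ^ n)"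
proof (rule summable_comparison_test'[OF summable_norm_exp[of y], of 0])
  fix n :: nat
  have "(fact n :: real) \<le> fact (2 * n + 1)" by (intro fact_mono) auto
  then have "1 / fact (2 * n + 1) \<le> 1 / (fact n :: real)"
    by (intro divide_left_mono) auto
  then have "shc_coeff n * \<bar>y\<bar> ^ n \<le> 1 / fact n * \<bar>y\<bar> ^ n"
    unfolding shc_coeff_def by (intro mult_right_mono) auto
  then show "norm (shc_coeff n * y ^ n) \<le> norm (y ^ n /\<^sub>R fact n)"
    by (simp add: abs_mult power_abs shc_coeff_def divide_simps)
qed

lemma summable_shc': "summable (\<lambda>n. diffs shc_coeff n * y ^ n)"
  by (rule termdiff_converges_all[OF summable_shc])

lemma summable_shc'': "summable (\<lambda>n. diffs (diffs shc_coeff) n * y ^ n)"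
  by (rule termdiff_converges_all[OF summable_shc'])

lemma DERIV_shc: "(shc has_real_derivative shc' q) (at q)"
  unfolding shc_def[abs_def] shc'_def
  by (rule termdiffs_strong_converges_everywhere[OF summable_shc])

lemma DERIV_shc': "(shc' has_real_derivative shc'' q) (at q)"
  unfolding shc'_def[abs_def] shc''_def
  by (rule termdiffs_strong_converges_everywhere[OF summable_shc'])

lemma isCont_shc'': "isCont shc'' q"
  unfolding shc''_def[abs_def]
  using termdiffs_strong_converges_everywhere[OF summable_shc'', of q] DERIV_isCont by blast

lemma diffs_shc_coeff_pos: "diffs shc_coeff n > 0"
  by (simp add: diffs_def shc_coeff_def)

text \<open>For a radial function \<open>Y (|x|\<^sup>2)\<close> the Laplacian in dimension 3 is
  \<open>4 q Y'' + 6 Y'\<close> at \<open>q = |x|\<^sup>2\<close>, so \<open>shc\<close> yields a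
  solution of Delta h = h that is regular at the origin. Comparing coefficients leaves
  \<open>(4 n + 6) (n + 1) = (2 n + 3) (2 n + 2)\<close>.\<close>

lemma shc_ode: "4 * q * shc'' q + 6 * shc' q = shc q"
proof -
  have a: "(\<lambda>n. of_nat n * diffs shc_coeff n * q ^ n) sums (q * shc'' q)"
  proof -
    have "(\<lambda>n. q * (diffs (diffs shc_coeff) n * q ^ n)) sums (q * shc'' q)"
      unfolding shc''_def by (intro sums_mult summable_sums summable_shc'')
    then have "(\<lambda>n. of_nat (Suc n) * diffs shc_coeff (Suc n) * q ^ Suc n) sums (q * shc'' q)"
      by (simp add: diffs_def mult_ac)
    from sums_Suc[OF this] show ?thesis by simp
  qed
  have b: "(\<lambda>n. diffs shc_coeff n * q ^ n) sums shc' q"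
    unfolding shc'_def by (intro summable_sums summable_shc')
  have "(\<lambda>n. 4 * (of_nat n * diffs shc_coeff n * q ^ n) + 6 * (diffs shc_coeff n * q ^ n))
          sums (4 * (q * shc'' q) + 6 * shc' q)"
    by (intro sums_add sums_mult a b)
  moreover have "4 * (of_nat n * diffs shc_coeff n * q ^ n) + 6 * (diffs shc_coeff n * q ^ n)
      = shc_coeff n * q ^ n" for n
  proof -
    have f: "fact (2 * Suc n + 1) = (2 * real n + 3) * (2 * real n + 2) * fact (2 * n + 1)"
    proof -
      have e: "2 * Suc n + 1 = Suc (Suc (2 * n + 1))" by simp
      show ?thesis unfolding e fact_Suc by (simp add: algebra_simps)
    qed
    have "(4 * real n + 6) * diffs shc_coeff n = shc_coeff n"
      unfolding diffs_def shc_coeff_def f by (simp add: divide_simps) (simp add: algebra_simps)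
    then have "((4 * real n + 6) * diffs shc_coeff n) * q ^ n = shc_coeff n * q ^ n" by simp
    then show ?thesis by (simp add: algebra_simps)
  qed
  ultimately have "(\<lambda>n. shc_coeff n * q ^ n) sums (4 * (q * shc'' q) + 6 * shc' q)" by simp
  then show ?thesis by (simp add: shc_def sums_iff)
qed

lemma shc_square: "s * shc (s\<^sup>2) = sinh s"
proof -
  have *: "(\<lambda>n. s * (shc_coeff n * (s\<^sup>2) ^ n)) sums (s * shc (s\<^sup>2))"
    unfolding shc_def by (intro sums_mult summable_sums summable_shc)
  have "(\<lambda>n. if even n then 0 else s ^ n /\<^sub>R fact n) sums sinh s"
    by (rule sinh_converges)
  then have "(\<lambda>n. (if even (2*n+1) then 0 else s ^ (2*n+1) /\<^sub>R fact (2*n+1))) sums sinh s"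
  proof (subst sums_mono_reindex[of "\<lambda>n. 2 * n + 1"])
    show "strict_mono (\<lambda>n::nat. 2 * n + 1)" by (auto simp: strict_mono_def)
    show "(if even n then 0 else s ^ n /\<^sub>R fact n) = 0" if "n \<notin> range (\<lambda>n::nat. 2 * n + 1)" for n
      using that by (auto elim!: oddE)
  qed
  moreover have "(\<lambda>n. (if even (2*n+1) then 0 else s ^ (2*n+1) /\<^sub>R fact (2*n+1))) =
      (\<lambda>n. s * (shc_coeff n * (s\<^sup>2) ^ n))"
    by (rule ext) (simp add: shc_coeff_def power_mult divide_inverse)
  ultimately have "(\<lambda>n. s * (shc_coeff n * (s\<^sup>2) ^ n)) sums sinh s"
    by simp
  with * show ?thesis by (rule sums_unique2)
qed

text \<open>Obtained by differentiating \<open>shc_square\<close>. The right-hand side is the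
  numerator of \<open>bp_mass\<close>, which thereby becomes a value of a power series with positive
  coefficients.\<close>

lemma shc'_square:
  assumes "s > 0"
  shows "2 * s ^ 3 * shc' (s\<^sup>2) = s * cosh s - sinh s"
proof -
  have "((\<lambda>s. s * shc (s\<^sup>2)) has_real_derivative shc (s\<^sup>2) + s * (shc' (s\<^sup>2) * (2 * s))) (at s)"
    by (auto intro!: derivative_eq_intros DERIV_chain2[OF DERIV_shc])
  moreover have "((\<lambda>s. s * shc (s\<^sup>2)) has_real_derivative cosh s) (at s)"
    unfolding shc_square by (auto intro!: derivative_eq_intros)
  ultimately have "shc (s\<^sup>2) + s * (shc' (s\<^sup>2) * (2 * s)) = cosh s"
    by (rule DERIV_unique)
  then have "s * (shc (s\<^sup>2) + s * (shc' (s\<^sup>2) * (2 * s))) = s * cosh s" by simp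
  then show ?thesis using shc_square[of s] by (simp add: algebra_simps power3_eq_cube)
qed

lemma shc'_pos: "q \<ge> 0 \<Longrightarrow> shc' q > 0"
proof -
  assume q: "q \<ge> 0"
  have "(\<Sum>n\<in>{0::nat}. diffs shc_coeff n * q ^ n) \<le> shc' q"
    unfolding shc'_def
    by (rule sum_le_suminf[OF summable_shc']) (use q in \<open>auto intro!: mult_nonneg_nonneg less_imp_le[OF diffs_shc_coeff_pos]\<close>)
  moreover have "(\<Sum>n\<in>{0::nat}. diffs shc_coeff n * q ^ n) > 0"
    using diffs_shc_coeff_pos by simp
  ultimately show ?thesis by linarith
qed

lemma shc_mono: "0 \<le> q \<Longrightarrow> q \<le> r \<Longrightarrow> shc q \<le> shc r"
  by (rule DERIV_nonneg_imp_nondecreasing[of q r shc])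
    (auto intro!: exI[where x = "shc' _"] DERIV_shc less_imp_le[OF shc'_pos])



section \<open>C^1 functions with an explicit gradient, and integration by parts over the whole
  space\<close>

definition C1_with :: "('a::euclidean_space \<Rightarrow> real) \<Rightarrow> ('a \<Rightarrow> 'a) \<Rightarrow> bool" where
  "C1_with f g \<longleftrightarrow> (\<forall>x. (f has_derivative (\<lambda>v. g x \<bullet> v)) (at x)) \<and> continuous_on UNIV g"

lemma C1_withD:
  assumes "C1_with f g"
  shows "(f has_derivative (\<lambda>v. g x \<bullet> v)) (at x)" "continuous_on UNIV g" "continuous_on UNIV f"
  using assms unfolding C1_with_def
  by (auto intro!: continuous_at_imp_continuous_on has_derivative_continuous)

text \<open>By translation invariance the integrals of the difference quotients vanish; the Lipschitz bound dominates them.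
  Exceptional null sets are needed because the ball potential is only \<open>C\<^sup>1\<close> across the sphere.\<close>

lemma integral_directional_derivative_eq_0:
  fixes F F' :: "'a::euclidean_space \<Rightarrow> real" and e :: 'a
  assumes lip: "L-lipschitz_on (cball 0 (R + norm e)) F"
    and supp: "\<And>x. x \<notin> cball 0 R \<Longrightarrow> F x = 0"
    and cont: "continuous_on UNIV F"
    and S: "S \<in> null_sets lborel"
    and deriv: "\<And>x. x \<notin> S \<Longrightarrow> ((\<lambda>t. F (x + t *\<^sub>R e)) has_real_derivative F' x) (at 0)"
    and meas: "F' \<in> borel_measurable borel"
  shows "integrable lborel F'" "(LINT x|lborel. F' x) = 0"
proof -
  define h where "h n = 1 / real (Suc n)" for n
  have h: "0 < h n" "h n \<le> 1" for n by (auto simp: h_def divide_simps)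
  define Q where "Q n x = (F (x + h n *\<^sub>R e) - F x) / h n" for n x
  define w where "w x = L * norm e * indicat_real (cball 0 (R + norm e)) x" for x :: 'a
  have L0: "L \<ge> 0" using lip lipschitz_on_nonneg by blast
  have Fm: "F \<in> borel_measurable borel"
    using cont by (rule borel_measurable_continuous_onI)
  have iF: "integrable lborel F"
  proof -
    have "integrable lborel (\<lambda>x. indicator (cball 0 R) x *\<^sub>R F x)"
      by (rule borel_integrable_compact) (auto intro: continuous_on_subset[OF cont])
    also have "(\<lambda>x. indicator (cball 0 R) x *\<^sub>R F x) = F"
      using supp by (intro ext) (auto simp: indicator_def)
    finally show ?thesis .
  qed
  have shift: "integrable lborel (\<lambda>x. F (x + c))" "(LINT x|lborel. F (x + c)) = (LINT x|lborel. F x)" for c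
  proof -
    have "integrable (distr lborel borel ((+) c)) F" using iF by (simp add: lborel_distr_plus)
    then show "integrable lborel (\<lambda>x. F (x + c))"
      using Fm by (simp add: integrable_distr_eq add.commute)
    have "(LINT x|lborel. F x) = (LINT x|distr lborel borel ((+) c). F x)" by (simp add: lborel_distr_plus)
    also have "\<dots> = (LINT x|lborel. F (x + c))"
      using Fm by (simp add: integral_distr add.commute)
    finally show "(LINT x|lborel. F (x + c)) = (LINT x|lborel. F x)" by simp
  qed
  have Q0: "(LINT x|lborel. Q n x) = 0" for n
    unfolding Q_def using iF shift[of "h n *\<^sub>R e"] by simp
  have bound: "norm (Q n x) \<le> w x" for n x
  proof -
    have ne: "norm (h n *\<^sub>R e) \<le> norm e" using h[of n] by (simp add: mult_left_le_one_le)
    show ?thesis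
    proof (cases "x \<in> cball 0 (R + norm e) \<and> x + h n *\<^sub>R e \<in> cball 0 (R + norm e)")
      case True
      then have "dist (F (x + h n *\<^sub>R e)) (F x) \<le> L * dist (x + h n *\<^sub>R e) x"
        using lipschitz_onD[OF lip] by blast
      then have "\<bar>F (x + h n *\<^sub>R e) - F x\<bar> \<le> L * norm e * h n"
        using h[of n] by (simp add: dist_norm mult_ac)
      then show ?thesis using True h[of n]
        by (simp add: Q_def w_def divide_simps)
    next
      \<comment> \<open>The radius is enlarged by \<open>norm e\<close> so that, as soon as one of
        the two points leaves the large ball, both lie outside the support and the quotient is
        0.\<close>
      case False
      have "norm x \<le> norm (x + h n *\<^sub>R e) + norm e"
        using norm_triangle_ineq4[of "x + h n *\<^sub>R e" "h n *\<^sub>R e"] ne by simp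
      moreover have "norm (x + h n *\<^sub>R e) \<le> norm x + norm e"
        using norm_triangle_ineq[of x "h n *\<^sub>R e"] ne by simp
      ultimately have "x \<notin> cball 0 R" "x + h n *\<^sub>R e \<notin> cball 0 R"
        using False norm_ge_zero[of e] by (auto simp del: norm_ge_zero)
      then have "Q n x = 0" by (simp add: Q_def supp)
      then show ?thesis using L0 by (simp add: w_def)
    qed
  qed
  have conv: "(\<lambda>n. Q n x) \<longlonglongrightarrow> F' x" if "x \<notin> S" for x
  proof -
    have "((\<lambda>t. (F (x + t *\<^sub>R e) - F x) / t) \<longlongrightarrow> F' x) (at 0)"
      using deriv[OF that] by (simp add: DERIV_def)
    moreover have "filterlim h (at 0) sequentially"
      unfolding filterlim_at h_def using h LIMSEQ_inverse_real_of_nat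
      by (auto simp: inverse_eq_divide)
    ultimately show ?thesis
      unfolding Q_def by (rule filterlim_compose)
  qed
  have wi: "integrable lborel w" unfolding w_def
    by (intro integrable_mult_right integrable_real_indicator emeasure_bounded_finite) auto
  have AEc: "AE x in lborel. (\<lambda>n. Q n x) \<longlonglongrightarrow> F' x"
    using conv by (intro AE_I'[OF S]) auto
  have Qm: "Q n \<in> borel_measurable lborel" for n
    unfolding Q_def using Fm by simp
  have F'm: "F' \<in> borel_measurable lborel" using meas by simp
  show "integrable lborel F'"
    by (rule integrable_dominated_convergence[OF F'm Qm wi AEc]) (use bound in auto)
  have "(\<lambda>n. LINT x|lborel. Q n x) \<longlonglongrightarrow> (LINT x|lborel. F' x)"
    by (rule integral_dominated_convergence[OF F'm Qm wi AEc]) (use bound in auto)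
  then show "(LINT x|lborel. F' x) = 0" using Q0 by (simp add: LIMSEQ_const_iff)
qed

lemma lipschitz_on_compact_mult:
  fixes f g :: "'a::metric_space \<Rightarrow> real"
  assumes "compact X" "\<exists>L. L-lipschitz_on X f" "\<exists>L. L-lipschitz_on X g"
  shows "\<exists>L. L-lipschitz_on X (\<lambda>x. f x * g x)"
proof -
  obtain L M where L: "L-lipschitz_on X f" and M: "M-lipschitz_on X g" using assms by auto
  have "bounded (f ` X)" "bounded (g ` X)"
    using assms(1) lipschitz_on_continuous_on[OF L] lipschitz_on_continuous_on[OF M]
    by (auto intro!: compact_imp_bounded compact_continuous_image)
  then obtain A B where AB: "\<And>x. x \<in> X \<Longrightarrow> \<bar>f x\<bar> \<le> A" "\<And>x. x \<in> X \<Longrightarrow> \<bar>g x\<bar> \<le> B" "A > 0" "B > 0"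
    unfolding bounded_pos by auto
  have L0: "L \<ge> 0" "M \<ge> 0" using L M lipschitz_on_nonneg by blast+
  have "(A * M + B * L)-lipschitz_on X (\<lambda>x. f x * g x)"
  proof (rule lipschitz_onI)
    fix x y assume xy: "x \<in> X" "y \<in> X"
    have 1: "\<bar>f x - f y\<bar> \<le> L * dist x y" "\<bar>g x - g y\<bar> \<le> M * dist x y"
      using lipschitz_onD[OF L xy] lipschitz_onD[OF M xy] by (auto simp: dist_real_def)
    have "f x * g x - f y * g y = f x * (g x - g y) + g y * (f x - f y)" by (simp add: algebra_simps)
    then have "\<bar>f x * g x - f y * g y\<bar> \<le> \<bar>f x\<bar> * \<bar>g x - g y\<bar> + \<bar>g y\<bar> * \<bar>f x - f y\<bar>"
      by (metis abs_mult abs_triangle_ineq)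
    also have "\<dots> \<le> A * (M * dist x y) + B * (L * dist x y)"
      using 1 AB xy L0 by (intro add_mono mult_mono) auto
    finally show "dist (f x * g x) (f y * g y) \<le> (A * M + B * L) * dist x y"
      by (simp add: dist_real_def algebra_simps)
  qed (use AB L0 in auto)
  then show ?thesis by blast
qed

lemma C1_with_lipschitz_on_cball:
  assumes "C1_with f g"
  shows "\<exists>L. L-lipschitz_on (cball 0 R) f"
proof -
  have "bounded (g ` cball 0 R)"
    using C1_withD(2)[OF assms] by (auto intro!: compact_imp_bounded compact_continuous_image intro: continuous_on_subset)
  then obtain B where B: "\<And>x. x \<in> cball 0 R \<Longrightarrow> norm (g x) \<le> B" "B > 0"
    unfolding bounded_pos by (metis imageI)
  have "B-lipschitz_on (cball 0 R) f"
  proof (rule bounded_derivative_imp_lipschitz)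
    show "(f has_derivative (\<lambda>v. g x \<bullet> v)) (at x within cball 0 R)" for x
      using C1_withD(1)[OF assms] by (rule has_derivative_at_withinI)
    show "onorm (\<lambda>v. g x \<bullet> v) \<le> B" if "x \<in> cball 0 R" for x
    proof (rule onorm_le)
      fix v
      have "norm (g x \<bullet> v) \<le> norm (g x) * norm v" using Cauchy_Schwarz_ineq2[of "g x" v] by simp
      also have "\<dots> \<le> B * norm v" using B(1)[OF that] by (intro mult_right_mono) auto
      finally show "norm (g x \<bullet> v) \<le> B * norm v" .
    qed
  qed (use B in auto)
  then show ?thesis by blast
qed

lemma C1_with_radial:
  fixes z :: "'a::euclidean_space"
  assumes "\<And>q. (Y has_real_derivative Y' q) (at q)" "continuous_on UNIV Y'"
  shows "C1_with (\<lambda>x. Y ((x - z) \<bullet> (x - z))) (\<lambda>x. (2 * Y' ((x - z) \<bullet> (x - z))) *\<^sub>R (x - z))"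
  unfolding C1_with_def
proof (intro conjI allI)
  fix x :: 'a
  have "((\<lambda>x. (x - z) \<bullet> (x - z)) has_derivative (\<lambda>v. 2 * ((x - z) \<bullet> v))) (at x)"
    by (auto intro!: derivative_eq_intros simp: inner_commute)
  from DERIV_compose_FDERIV[OF assms(1) this]
  show "((\<lambda>x. Y ((x - z) \<bullet> (x - z))) has_derivative
      (\<lambda>v. (2 * Y' ((x - z) \<bullet> (x - z))) *\<^sub>R (x - z) \<bullet> v)) (at x)"
    by (simp add: mult_ac)
next
  show "continuous_on UNIV (\<lambda>x. (2 * Y' ((x - z) \<bullet> (x - z))) *\<^sub>R (x - z))"
    by (intro continuous_intros continuous_on_compose2[OF assms(2)]) auto
qed

lemma C1_with_zero_grad:
  assumes "C1_with f g" "open U" "\<And>x. x \<in> U \<Longrightarrow> f x = 0" "x \<in> U"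
  shows "g x = 0"
proof -
  have "((\<lambda>_. 0) has_derivative (\<lambda>v. g x \<bullet> v)) (at x)"
    by (rule has_derivative_transform_within_open[OF C1_withD(1)[OF assms(1)] assms(2,4)]) (rule assms(3))
  moreover have "((\<lambda>_. 0) has_derivative (\<lambda>v. 0)) (at x)" by simp
  ultimately have "(\<lambda>v. g x \<bullet> v) = (\<lambda>v. 0)" by (rule has_derivative_unique)
  then have "g x \<bullet> g x = 0" by meson
  then show ?thesis by simp
qed

text \<open>The integrand is the divergence of \<open>\<psi>\<close> times the gradient of the
  radial function with profile derivative \<open>Y'\<close>, so it integrates to 0 coordinate by
  coordinate; \<open>4 q Y'' + 2 n Y'\<close> is the Laplacian in dimension \<open>n\<close>.
  \<open>Y'\<close> may have a corner at \<open>\<rho>\<^sup>2\<close>: the corresponding sphere is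
  a null set, and the Lipschitz bounds suffice for domination.\<close>

lemma radial_weak_eq:
  fixes z :: "'a::euclidean_space" and \<psi> q :: "'a \<Rightarrow> real" and Y' Y'' :: "real \<Rightarrow> real"
  assumes Y': "continuous_on UNIV Y'" "\<And>Q. \<exists>L. L-lipschitz_on {0..Q} Y'"
    and Y'': "\<And>q. q \<noteq> \<rho>\<^sup>2 \<Longrightarrow> (Y' has_real_derivative Y'' q) (at q)" "Y'' \<in> borel_measurable borel"
    and \<rho>: "\<rho> > 0"
    and \<psi>: "C1_with \<psi> g\<psi>" "\<And>x. x \<notin> cball 0 R \<Longrightarrow> \<psi> x = 0"
  defines "q \<equiv> \<lambda>x. (x - z) \<bullet> (x - z)"
  shows "integrable lborel (\<lambda>x. (2 * Y' (q x)) *\<^sub>R (x - z) \<bullet> g\<psi> x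
            + (4 * q x * Y'' (q x) + 2 * DIM('a) * Y' (q x)) * \<psi> x)" (is ?A)
    and "(LINT x|lborel. (2 * Y' (q x)) *\<^sub>R (x - z) \<bullet> g\<psi> x
            + (4 * q x * Y'' (q x) + 2 * DIM('a) * Y' (q x)) * \<psi> x) = 0" (is ?B)
proof -
  define F where "F i x = \<psi> x * (2 * Y' (q x)) * ((x - z) \<bullet> i)" for i x
  define F' where "F' i x = (g\<psi> x \<bullet> i) * (2 * Y' (q x)) * ((x - z) \<bullet> i)
      + \<psi> x * (2 * Y'' (q x) * (2 * ((x - z) \<bullet> i))) * ((x - z) \<bullet> i) + \<psi> x * (2 * Y' (q x))" for i x
  have [measurable]: "\<psi> \<in> borel_measurable borel" "g\<psi> \<in> borel_measurable borel"
     "Y' \<in> borel_measurable borel" "Y'' \<in> borel_measurable borel"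
    using C1_withD(2,3)[OF \<psi>(1)] Y'(1) Y''(2) by (auto intro: borel_measurable_continuous_onI)
  have [measurable]: "q \<in> borel_measurable borel" unfolding q_def by measurable
  have cq: "continuous_on X q" for X unfolding q_def by (intro continuous_intros)
  have C1q: "C1_with q (\<lambda>x. (2 * 1) *\<^sub>R (x - z))"
    unfolding q_def by (rule C1_with_radial[of "\<lambda>q. q" "\<lambda>_. 1"]) auto
  have key: "integrable lborel (F' i) \<and> (LINT x|lborel. F' i x) = 0" if i: "i \<in> Basis" for i
  proof -
    have "\<exists>L. L-lipschitz_on (cball 0 (R + norm i)) (F i)"
    proof -
      obtain Q where Q: "\<And>x. x \<in> cball 0 (R + norm i) \<Longrightarrow> norm (q x) \<le> Q"
      proof -
        have "bounded (q ` cball 0 (R + norm i))"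
          using cq by (auto intro!: compact_imp_bounded compact_continuous_image)
        then show ?thesis using that unfolding bounded_iff by (metis imageI)
      qed
      obtain L1 where L1: "L1-lipschitz_on {0..Q} Y'" using Y'(2) by blast
      obtain L2 where L2: "L2-lipschitz_on (cball 0 (R + norm i)) q"
        using C1_with_lipschitz_on_cball[OF C1q] by blast
      have "q ` cball 0 (R + norm i) \<subseteq> {0..Q}"
        using Q by (fastforce simp: q_def)
      then have "(L1 * L2)-lipschitz_on (cball 0 (R + norm i)) (\<lambda>x. Y' (q x))"
        by (intro lipschitz_on_compose2[OF L2]) (rule lipschitz_on_subset[OF L1])
      then have a: "\<exists>L. L-lipschitz_on (cball 0 (R + norm i)) (\<lambda>x. 2 * Y' (q x))"
        using lipschitz_on_cmult_real by blast
      have C: "C1_with (\<lambda>x. (x - z) \<bullet> i) (\<lambda>x. i)"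
        unfolding C1_with_def by (auto intro!: derivative_eq_intros simp: inner_commute)
      show ?thesis unfolding F_def
        by (intro lipschitz_on_compact_mult a C1_with_lipschitz_on_cball[OF C] C1_with_lipschitz_on_cball[OF \<psi>(1)]) auto
    qed
    then obtain L where L: "L-lipschitz_on (cball 0 (R + norm i)) (F i)" by blast
    have null: "sphere z \<rho> \<in> null_sets lborel"
      using negligible_sphere[of z \<rho>] by (simp add: negligible_iff_null_sets null_sets_completion_iff)
    have supp: "F i x = 0" if "x \<notin> cball 0 R" for x using \<psi>(2)[OF that] by (simp add: F_def)
    have cont: "continuous_on UNIV (F i)"
      unfolding F_def using C1_withD(3)[OF \<psi>(1)] cq
      by (intro continuous_intros continuous_on_compose2[OF Y'(1)]) auto
    have d: "((\<lambda>t. F i (x + t *\<^sub>R i)) has_real_derivative F' i x) (at 0)" if x: "x \<notin> sphere z \<rho>" for x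
    proof -
      have qx: "q x \<noteq> \<rho>\<^sup>2"
        using x \<rho> unfolding q_def by (auto simp: dist_norm norm_minus_commute simp flip: power2_norm_eq_inner)
      have d1: "((\<lambda>t. \<psi> (x + t *\<^sub>R i)) has_real_derivative g\<psi> x \<bullet> i) (at 0)"
      proof -
        have "((\<lambda>t. x + t *\<^sub>R i) has_derivative (\<lambda>t. t *\<^sub>R i)) (at 0)"
          by (auto intro!: derivative_eq_intros)
        then have "((\<lambda>t. \<psi> (x + t *\<^sub>R i)) has_derivative (\<lambda>t. g\<psi> x \<bullet> (t *\<^sub>R i))) (at 0)"
          by (rule has_derivative_compose) (use C1_withD(1)[OF \<psi>(1), of x] in simp)
        then show ?thesis
          by (rule has_derivative_imp_has_field_derivative) (simp add: mult.commute)
      qed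
      have d2: "((\<lambda>t. q (x + t *\<^sub>R i)) has_real_derivative 2 * ((x - z) \<bullet> i)) (at 0)"
      proof -
        have "q (x + t *\<^sub>R i) = q x + 2 * t * ((x - z) \<bullet> i) + t\<^sup>2 * (i \<bullet> i)" for t
          unfolding q_def by (simp add: algebra_simps inner_simps power2_eq_square inner_commute)
        then show ?thesis by (auto intro!: derivative_eq_intros)
      qed
      have d3: "((\<lambda>t. Y' (q (x + t *\<^sub>R i))) has_real_derivative Y'' (q x) * (2 * ((x - z) \<bullet> i))) (at 0)"
        by (rule DERIV_chain2[OF _ d2]) (simp add: Y''(1)[OF qx])
      have d4: "((\<lambda>t. (x + t *\<^sub>R i - z) \<bullet> i) has_real_derivative 1) (at 0)"
      proof -
        have "(\<lambda>t. (x + t *\<^sub>R i - z) \<bullet> i) = (\<lambda>t. (x - z) \<bullet> i + t)"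
          using i by (auto simp: inner_simps)
        then show ?thesis by (auto intro!: derivative_eq_intros)
      qed
      show ?thesis
        unfolding F_def
        by (rule derivative_eq_intros d1 d3 d4 refl)+ (simp add: F'_def algebra_simps)
    qed
    have F'm: "F' i \<in> borel_measurable borel" unfolding F'_def by measurable
    show ?thesis
      using integral_directional_derivative_eq_0[OF L supp cont null d F'm] by auto
  qed
  have eq: "(\<Sum>i\<in>Basis. F' i x) = (2 * Y' (q x)) *\<^sub>R (x - z) \<bullet> g\<psi> x
            + (4 * q x * Y'' (q x) + 2 * DIM('a) * Y' (q x)) * \<psi> x" for x
  proof -
    have a: "(\<Sum>i\<in>Basis. (g\<psi> x \<bullet> i) * (2 * Y' (q x)) * ((x - z) \<bullet> i)) = (2 * Y' (q x)) *\<^sub>R (x - z) \<bullet> g\<psi> x"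
      by (subst euclidean_inner[of _ "g\<psi> x"]) (auto intro!: sum.cong simp: algebra_simps)
    have b: "(\<Sum>i\<in>Basis. \<psi> x * (2 * Y'' (q x) * (2 * ((x - z) \<bullet> i))) * ((x - z) \<bullet> i)) = 4 * q x * Y'' (q x) * \<psi> x"
      unfolding q_def by (subst (4) euclidean_inner) (simp add: sum_distrib_left sum_distrib_right mult_ac)
    show ?thesis
      unfolding F'_def sum.distrib a b by (simp add: algebra_simps)
  qed
  show ?A unfolding eq[symmetric] using key by simp
  show ?B unfolding eq[symmetric] using key by (subst Bochner_Integration.integral_sum) auto
qed



text \<open>\<open>ball_potential \<tau> \<rho> z\<close> is the \<open>C\<^sup>1\<close> solution \<open>b\<close> of \<open>- \<Delta> b + \<tau>\<^sup>2 b = 1 / bp_mass \<tau> \<rho>\<close> on the ball, \<open>= 0\<close> off it.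
  The normalisation is chosen such that \<open>b\<close> coincides with the kernel \<open>exp (- \<tau> r) / r\<close> outside the ball;
  the profile is expressed in the variable \<open>q = r\<^sup>2\<close>.\<close>

definition bp_mass :: "real \<Rightarrow> real \<Rightarrow> real" where
  "bp_mass \<tau> \<rho> = (\<tau> * \<rho> * cosh (\<tau> * \<rho>) - sinh (\<tau> * \<rho>)) / \<tau> ^ 3"

text \<open>Inside the ball: a constant particular solution minus a multiple of the homogeneous
  solution \<open>shc (\<tau>\<^sup>2 * q)\<close>. The factor
  \<open>(1 + \<tau> * \<rho>) * exp (- (\<tau> * \<rho>))\<close> and \<open>bp_mass\<close> are
  forced by matching value and slope with \<open>exp (- \<tau> r) / r\<close> at
  \<open>r = \<rho>\<close>.\<close>

definition bp_profile :: "real \<Rightarrow> real \<Rightarrow> real \<Rightarrow> real" where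
  "bp_profile \<tau> \<rho> q = (if q \<le> \<rho>\<^sup>2
     then (1 - (1 + \<tau> * \<rho>) * exp (- (\<tau> * \<rho>)) * shc (\<tau>\<^sup>2 * q)) / (\<tau>\<^sup>2 * bp_mass \<tau> \<rho>)
     else exp (- (\<tau> * sqrt q)) / sqrt q)"

definition bp_profile' :: "real \<Rightarrow> real \<Rightarrow> real \<Rightarrow> real" where
  "bp_profile' \<tau> \<rho> q = (if q \<le> \<rho>\<^sup>2
     then - ((1 + \<tau> * \<rho>) * exp (- (\<tau> * \<rho>)) * shc' (\<tau>\<^sup>2 * q)) / bp_mass \<tau> \<rho>
     else - ((\<tau> * sqrt q + 1) * exp (- (\<tau> * sqrt q)) / (2 * q * sqrt q)))"

definition bp_profile'' :: "real \<Rightarrow> real \<Rightarrow> real \<Rightarrow> real" where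
  "bp_profile'' \<tau> \<rho> q = (if q \<le> \<rho>\<^sup>2
     then - ((1 + \<tau> * \<rho>) * exp (- (\<tau> * \<rho>)) * (\<tau>\<^sup>2 * shc'' (\<tau>\<^sup>2 * q))) / bp_mass \<tau> \<rho>
     else (\<tau>\<^sup>2 * q + 3 * \<tau> * sqrt q + 3) * exp (- (\<tau> * sqrt q)) / (4 * q\<^sup>2 * sqrt q))"

definition ball_potential :: "real \<Rightarrow> real \<Rightarrow> real^3 \<Rightarrow> real^3 \<Rightarrow> real" where
  "ball_potential \<tau> \<rho> z x = bp_profile \<tau> \<rho> ((x - z) \<bullet> (x - z))"

definition ball_potential_grad :: "real \<Rightarrow> real \<Rightarrow> real^3 \<Rightarrow> real^3 \<Rightarrow> real^3" where
  "ball_potential_grad \<tau> \<rho> z x = (2 * bp_profile' \<tau> \<rho> ((x - z) \<bullet> (x - z))) *\<^sub>R (x - z)"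

lemma C1_real_lipschitz:
  fixes f f' :: "real \<Rightarrow> real"
  assumes "\<And>x. x \<in> {a..b} \<Longrightarrow> (f has_real_derivative f' x) (at x within {a..b})" "continuous_on {a..b} f'"
  shows "\<exists>L. L-lipschitz_on {a..b} f"
proof -
  have "bounded (f' ` {a..b})"
    using assms(2) by (auto intro!: compact_imp_bounded compact_continuous_image)
  then obtain B where B: "\<And>x. x \<in> {a..b} \<Longrightarrow> norm (f' x) \<le> B" "B > 0"
    unfolding bounded_pos by (metis imageI)
  have "B-lipschitz_on {a..b} f"
  proof (rule bounded_derivative_imp_lipschitz)
    show "(f has_derivative (*) (f' x)) (at x within {a..b})" if "x \<in> {a..b}" for x
      using assms(1)[OF that] by (simp add: has_field_derivative_def)
    show "onorm ((*) (f' x)) \<le> B" if "x \<in> {a..b}" for x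
      using B(1)[OF that] by (intro onorm_le) (simp add: abs_mult mult_right_mono)
  qed (use B in auto)
  then show ?thesis by blast
qed

context
  fixes \<tau> \<rho> :: real
  assumes pos: "\<tau> > 0" "\<rho> > 0"
begin

text \<open>\<open>bp_mass\<close> is the integral of \<open>r sinh (\<tau> r) / \<tau>\<close> over
  \<open>0 < r < \<rho>\<close>: from outside, a ball of density 1 acts like \<open>bp_mass\<close>
  times the kernel \<open>exp (- \<tau> r) / r\<close>. In the present form its positivity is
  evident.\<close>

lemma bp_mass_eq: "bp_mass \<tau> \<rho> = 2 * \<rho> ^ 3 * shc' (\<tau>\<^sup>2 * \<rho>\<^sup>2)"
  using shc'_square[of "\<tau> * \<rho>"] pos by (simp add: bp_mass_def power_mult_distrib field_simps)

lemma bp_mass_pos: "bp_mass \<tau> \<rho> > 0"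
  unfolding bp_mass_eq using pos shc'_pos[of "\<tau>\<^sup>2 * \<rho>\<^sup>2"] by simp

lemma bp_profile_match:
  "(1 - (1 + \<tau> * \<rho>) * exp (- (\<tau> * \<rho>)) * shc (\<tau>\<^sup>2 * \<rho>\<^sup>2)) / (\<tau>\<^sup>2 * bp_mass \<tau> \<rho>)
    = exp (- (\<tau> * \<rho>)) / \<rho>"
proof -
  define s where "s = \<tau> * \<rho>"
  have s: "s > 0" using pos by (simp add: s_def)
  have sh: "shc (\<tau>\<^sup>2 * \<rho>\<^sup>2) = sinh s / s"
    using shc_square[of s] s unfolding s_def power_mult_distrib by (auto simp: eq_divide_eq mult.commute)
  have m: "\<tau>\<^sup>2 * bp_mass \<tau> \<rho> = (s * cosh s - sinh s) * \<rho> / s"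
    using pos by (simp add: bp_mass_def s_def power2_eq_square power3_eq_cube field_simps)
  have p: "s * cosh s - sinh s > 0"
    using bp_mass_pos pos by (simp add: bp_mass_def s_def zero_less_divide_iff)
  have "1 = exp (-s) * (cosh s + sinh s)"
    by (simp add: cosh_plus_sinh flip: exp_add)
  then have "s = s * (exp (-s) * (cosh s + sinh s))" by simp
  then have "s - (1 + s) * exp (- s) * sinh s = exp (- s) * (s * cosh s - sinh s)"
    by (simp add: algebra_simps)
  then have "1 - (1 + s) * exp (- s) * (sinh s / s) = exp (- s) * (s * cosh s - sinh s) / s"
    using s by (simp add: field_simps)
  then show ?thesis unfolding m sh s_def[symmetric] using p s pos by simp
qed

lemma bp_profile'_match:
  "- ((1 + \<tau> * \<rho>) * exp (- (\<tau> * \<rho>)) * shc' (\<tau>\<^sup>2 * \<rho>\<^sup>2)) / bp_mass \<tau> \<rho>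
    = - ((\<tau> * \<rho> + 1) * exp (- (\<tau> * \<rho>)) / (2 * \<rho>\<^sup>2 * \<rho>))"
  unfolding bp_mass_eq using pos shc'_pos[of "\<tau>\<^sup>2 * \<rho>\<^sup>2"]
  by (simp add: field_simps power2_eq_square power3_eq_cube)

lemma bp_inner_deriv:
  "((\<lambda>q. (1 - (1 + \<tau> * \<rho>) * exp (- (\<tau> * \<rho>)) * shc (\<tau>\<^sup>2 * q)) / (\<tau>\<^sup>2 * bp_mass \<tau> \<rho>))
     has_real_derivative - ((1 + \<tau> * \<rho>) * exp (- (\<tau> * \<rho>)) * shc' (\<tau>\<^sup>2 * q)) / bp_mass \<tau> \<rho>) (at q within X)"
  using bp_mass_pos pos
  by (auto intro!: derivative_eq_intros DERIV_chain2[OF DERIV_shc] simp: field_simps)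

lemma bp_inner_deriv':
  "((\<lambda>q. - ((1 + \<tau> * \<rho>) * exp (- (\<tau> * \<rho>)) * shc' (\<tau>\<^sup>2 * q)) / bp_mass \<tau> \<rho>)
     has_real_derivative - ((1 + \<tau> * \<rho>) * exp (- (\<tau> * \<rho>)) * (\<tau>\<^sup>2 * shc'' (\<tau>\<^sup>2 * q))) / bp_mass \<tau> \<rho>) (at q within X)"
  using bp_mass_pos pos
  by (auto intro!: derivative_eq_intros DERIV_chain2[OF DERIV_shc'] simp: field_simps)

lemma bp_outer_deriv:
  assumes "q > 0"
  shows "((\<lambda>q. exp (- (\<tau> * sqrt q)) / sqrt q) has_real_derivative
     - ((\<tau> * sqrt q + 1) * exp (- (\<tau> * sqrt q)) / (2 * q * sqrt q))) (at q within X)"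
proof -
  define r where "r = sqrt q"
  have r: "r > 0" "q = r\<^sup>2" using assms by (auto simp: r_def)
  show ?thesis using assms
    apply (auto intro!: derivative_eq_intros)
    unfolding r_def[symmetric] using r by (simp add: field_simps power2_eq_square)
qed

lemma bp_outer_deriv':
  assumes "q > 0"
  shows "((\<lambda>q. - ((\<tau> * sqrt q + 1) * exp (- (\<tau> * sqrt q)) / (2 * q * sqrt q))) has_real_derivative
     (\<tau>\<^sup>2 * q + 3 * \<tau> * sqrt q + 3) * exp (- (\<tau> * sqrt q)) / (4 * q\<^sup>2 * sqrt q)) (at q within X)"
proof -
  define r where "r = sqrt q"
  have r: "r > 0" "q = r\<^sup>2" using assms by (auto simp: r_def)
  show ?thesis using assms
    apply (auto intro!: derivative_eq_intros)
    unfolding r_def[symmetric] using r by (simp add: field_simps power2_eq_square power4_eq_xxxx)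
qed

lemma bp_profile_deriv: "(bp_profile \<tau> \<rho> has_real_derivative bp_profile' \<tau> \<rho> q) (at q)"
proof -
  let ?f = "\<lambda>q. (1 - (1 + \<tau> * \<rho>) * exp (- (\<tau> * \<rho>)) * shc (\<tau>\<^sup>2 * q)) / (\<tau>\<^sup>2 * bp_mass \<tau> \<rho>)"
  let ?f' = "\<lambda>q. - ((1 + \<tau> * \<rho>) * exp (- (\<tau> * \<rho>)) * shc' (\<tau>\<^sup>2 * q)) / bp_mass \<tau> \<rho>"
  let ?g = "\<lambda>q. exp (- (\<tau> * sqrt q)) / sqrt q"
  let ?g' = "\<lambda>q. - ((\<tau> * sqrt q + 1) * exp (- (\<tau> * sqrt q)) / (2 * q * sqrt q))"
  have c: "closure {..\<rho>\<^sup>2} = {..\<rho>\<^sup>2}" "closure {\<rho>\<^sup>2<..} = {\<rho>\<^sup>2..}" by auto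
  have r2: "\<rho>\<^sup>2 > 0" using pos by simp
  have "((\<lambda>q. if q \<in> {..\<rho>\<^sup>2} then ?f q else ?g q) has_vector_derivative
     (if q \<in> {..\<rho>\<^sup>2} then ?f' q else ?g' q)) (at q within UNIV)"
  proof (rule has_vector_derivative_If_within_closures[where T = "{\<rho>\<^sup>2<..}" and f = ?f and g = ?g and f' = ?f' and g' = ?g'])
    assume "q \<in> {\<rho>\<^sup>2<..} \<union> (closure {..\<rho>\<^sup>2} \<inter> closure {\<rho>\<^sup>2<..})"
    then have "\<rho>\<^sup>2 \<le> q" by (auto simp: c)
    with r2 have "q > 0" by linarith
    then show "(?g has_vector_derivative ?g' q)
       (at q within {\<rho>\<^sup>2<..} \<union> (closure {..\<rho>\<^sup>2} \<inter> closure {\<rho>\<^sup>2<..}))"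
      by (intro bp_outer_deriv[unfolded has_real_derivative_iff_has_vector_derivative])
  next
    assume "q \<in> closure {..\<rho>\<^sup>2}" "q \<in> closure {\<rho>\<^sup>2<..}"
    then have q: "q = \<rho>\<^sup>2" by (simp add: c)
    show "?f q = ?g q" "?f' q = ?g' q"
      unfolding q using pos bp_profile_match bp_profile'_match by auto
  qed ((rule bp_inner_deriv[unfolded has_real_derivative_iff_has_vector_derivative] | force)+)
  then show ?thesis
    unfolding has_real_derivative_iff_has_vector_derivative
    by (simp add: bp_profile_def[abs_def] bp_profile'_def)
qed

lemma bp_profile'_deriv:
  assumes "q \<noteq> \<rho>\<^sup>2"
  shows "(bp_profile' \<tau> \<rho> has_real_derivative bp_profile'' \<tau> \<rho> q) (at q)"
proof (cases "q < \<rho>\<^sup>2")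
  case True
  have "((\<lambda>q. - ((1 + \<tau> * \<rho>) * exp (- (\<tau> * \<rho>)) * shc' (\<tau>\<^sup>2 * q)) / bp_mass \<tau> \<rho>)
     has_real_derivative bp_profile'' \<tau> \<rho> q) (at q)"
    using bp_inner_deriv'[of q UNIV] True by (simp add: bp_profile''_def)
  then show ?thesis
    by (rule has_field_derivative_transform_within_open[of _ _ _ "{..<\<rho>\<^sup>2}"])
      (use True in \<open>auto simp: bp_profile'_def\<close>)
next
  case False
  then have q: "q > \<rho>\<^sup>2" using assms by simp
  moreover have "\<rho>\<^sup>2 > 0" using pos by simp
  ultimately have "q > 0" by linarith
  have "((\<lambda>q. - ((\<tau> * sqrt q + 1) * exp (- (\<tau> * sqrt q)) / (2 * q * sqrt q)))
     has_real_derivative bp_profile'' \<tau> \<rho> q) (at q)"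
    using bp_outer_deriv'[of q UNIV] q \<open>q > 0\<close> by (simp add: bp_profile''_def)
  then show ?thesis
    by (rule has_field_derivative_transform_within_open[of _ _ _ "{\<rho>\<^sup>2<..}"])
      (use q in \<open>auto simp: bp_profile'_def\<close>)
qed

lemma bp_profile'_lipschitz: "\<exists>L. L-lipschitz_on {0..Q} (bp_profile' \<tau> \<rho>)"
proof -
  \<comment> \<open>Whatever \<open>Q\<close> is, the joint \<open>\<rho>\<^sup>2\<close> now lies
    in the interval, so the two Lipschitz pieces can be concatenated there.\<close>
  define Q' where "Q' = max Q (\<rho>\<^sup>2)"
  have c: "continuous_on X shc''" for X using isCont_shc'' by (simp add: continuous_at_imp_continuous_on)
  have r2: "\<rho>\<^sup>2 > 0" using pos by simp
  have "\<exists>L. L-lipschitz_on {0..\<rho>\<^sup>2} (\<lambda>q. - ((1 + \<tau> * \<rho>) * exp (- (\<tau> * \<rho>)) * shc' (\<tau>\<^sup>2 * q)) / bp_mass \<tau> \<rho>)"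
    by (rule C1_real_lipschitz[OF bp_inner_deriv'])
       (use bp_mass_pos in \<open>auto intro!: continuous_intros continuous_on_compose2[OF c[of UNIV]]\<close>)
  then obtain L1 where L1: "L1-lipschitz_on {0..\<rho>\<^sup>2} (\<lambda>q. - ((1 + \<tau> * \<rho>) * exp (- (\<tau> * \<rho>)) * shc' (\<tau>\<^sup>2 * q)) / bp_mass \<tau> \<rho>)" ..
  have "\<exists>L. L-lipschitz_on {\<rho>\<^sup>2..Q'} (\<lambda>q. - ((\<tau> * sqrt q + 1) * exp (- (\<tau> * sqrt q)) / (2 * q * sqrt q)))"
  proof (rule C1_real_lipschitz[OF bp_outer_deriv'])
    show p: "0 < x" if "x \<in> {\<rho>\<^sup>2..Q'}" for x
      using that r2 unfolding atLeastAtMost_iff by linarith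
    show "continuous_on {\<rho>\<^sup>2..Q'} (\<lambda>x. (\<tau>\<^sup>2 * x + 3 * \<tau> * sqrt x + 3) * exp (- (\<tau> * sqrt x)) / (4 * x\<^sup>2 * sqrt x))"
      using p by (intro continuous_intros) force
  qed
  then obtain L2 where L2: "L2-lipschitz_on {\<rho>\<^sup>2..Q'} (\<lambda>q. - ((\<tau> * sqrt q + 1) * exp (- (\<tau> * sqrt q)) / (2 * q * sqrt q)))" ..
  have "(max L1 L2)-lipschitz_on {0..Q'} (bp_profile' \<tau> \<rho>)"
    unfolding bp_profile'_def[abs_def]
    by (rule lipschitz_on_concat_max[OF L1 L2]) (use pos bp_profile'_match in auto)
  then show ?thesis
    by (intro exI) (rule lipschitz_on_subset, auto simp: Q'_def)
qed

text \<open>This is Delta b = \<open>\<tau>\<^sup>2\<close> b minus the source, in the variable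
  \<open>q = r\<^sup>2\<close>: inside the ball by \<open>shc_ode\<close> at
  \<open>\<tau>\<^sup>2 * q\<close>, outside by direct computation.\<close>

lemma bp_profile_ode:
  assumes "q \<ge> 0"
  shows "4 * q * bp_profile'' \<tau> \<rho> q + 6 * bp_profile' \<tau> \<rho> q
    = \<tau>\<^sup>2 * bp_profile \<tau> \<rho> q - (if q \<le> \<rho>\<^sup>2 then 1 / bp_mass \<tau> \<rho> else 0)"
proof (cases "q \<le> \<rho>\<^sup>2")
  case True
  define A where "A = (1 + \<tau> * \<rho>) * exp (- (\<tau> * \<rho>))"
  have "4 * q * (A * (\<tau>\<^sup>2 * shc'' (\<tau>\<^sup>2 * q))) + 6 * (A * shc' (\<tau>\<^sup>2 * q)) = A * shc (\<tau>\<^sup>2 * q)"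
    using shc_ode[of "\<tau>\<^sup>2 * q"] by (metis (no_types, opaque_lifting) distrib_left mult.assoc mult.left_commute)
  then have "4 * q * (- (A * (\<tau>\<^sup>2 * shc'' (\<tau>\<^sup>2 * q))) / bp_mass \<tau> \<rho>) + 6 * (- (A * shc' (\<tau>\<^sup>2 * q)) / bp_mass \<tau> \<rho>)
      = - (A * shc (\<tau>\<^sup>2 * q)) / bp_mass \<tau> \<rho>"
    using bp_mass_pos by (simp add: divide_simps)
  then show ?thesis using True bp_mass_pos pos
    unfolding bp_profile_def bp_profile'_def bp_profile''_def A_def[symmetric]
    by (simp add: diff_divide_distrib right_diff_distrib)
next
  case False
  moreover have "\<rho>\<^sup>2 > 0" using pos by simp
  ultimately have q: "q > 0" "\<not> q \<le> \<rho>\<^sup>2" by linarith+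
  define r where "r = sqrt q"
  have r: "r > 0" "q = r\<^sup>2" using q by (auto simp: r_def)
  show ?thesis using q r(1)
    unfolding bp_profile_def bp_profile'_def bp_profile''_def r_def[symmetric]
    unfolding r(2) by (simp add: field_simps power2_eq_square)
qed

lemma bp_profile'_continuous: "continuous_on UNIV (bp_profile' \<tau> \<rho>)"
proof (intro continuous_at_imp_continuous_on ballI)
  fix q :: real
  show "isCont (bp_profile' \<tau> \<rho>) q"
  proof (cases "q = \<rho>\<^sup>2")
    case True
    have "q > 0" using pos True by simp
    obtain L where "L-lipschitz_on {0..q+1} (bp_profile' \<tau> \<rho>)" using bp_profile'_lipschitz by blast
    then have "continuous_on {0..q+1} (bp_profile' \<tau> \<rho>)" by (rule lipschitz_on_continuous_on)
    then have "continuous_on {0<..<q+1} (bp_profile' \<tau> \<rho>)" by (rule continuous_on_subset) auto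
    then show ?thesis using \<open>q > 0\<close> by (simp add: continuous_on_eq_continuous_at)
  next
    case False
    then show ?thesis using bp_profile'_deriv DERIV_isCont by blast
  qed
qed

lemma ball_potential_C1: "C1_with (ball_potential \<tau> \<rho> z) (ball_potential_grad \<tau> \<rho> z)"
  unfolding ball_potential_def[abs_def] ball_potential_grad_def[abs_def]
  by (intro C1_with_radial bp_profile_deriv bp_profile'_continuous)

lemma ball_potential_outside:
  assumes "dist x z \<ge> \<rho>"
  shows "ball_potential \<tau> \<rho> z x = exp (- (\<tau> * dist x z)) / dist x z"
proof -
  have s: "sqrt ((x - z) \<bullet> (x - z)) = dist x z"
    by (simp add: dist_norm norm_eq_sqrt_inner)
  have q: "(x - z) \<bullet> (x - z) = (dist x z)\<^sup>2" by (simp add: dist_norm power2_norm_eq_inner)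
  show ?thesis
  proof (cases "dist x z = \<rho>")
    case True
    then show ?thesis unfolding ball_potential_def bp_profile_def q using bp_profile_match by simp
  next
    case False
    then have "dist x z > \<rho>" using assms by simp
    then have "\<not> (dist x z)\<^sup>2 \<le> \<rho>\<^sup>2" using pos by (simp add: power_mono_iff)
    then show ?thesis unfolding ball_potential_def bp_profile_def q by simp
  qed
qed

text \<open>Inside the ball the potential decreases with the distance from the centre because
  \<open>shc\<close> increases, so its value on the sphere is a lower bound. It serves to keep the
  incident field above a barrier within the source ball.\<close>

lemma ball_potential_inside:
  assumes "dist x z \<le> \<rho>"
  shows "ball_potential \<tau> \<rho> z x \<ge> exp (- (\<tau> * \<rho>)) / \<rho>"
proof -
  have q: "(x - z) \<bullet> (x - z) = (dist x z)\<^sup>2" by (simp add: dist_norm power2_norm_eq_inner)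
  have le: "(dist x z)\<^sup>2 \<le> \<rho>\<^sup>2" using assms by (simp add: power_mono)
  have "shc (\<tau>\<^sup>2 * (dist x z)\<^sup>2) \<le> shc (\<tau>\<^sup>2 * \<rho>\<^sup>2)"
    using le pos by (intro shc_mono mult_left_mono) auto
  then show ?thesis
    unfolding bp_profile_match[symmetric] ball_potential_def bp_profile_def q using le pos bp_mass_pos
    by (auto intro!: divide_right_mono mult_left_mono)
qed

lemma ball_potential_weak_eq:
  assumes "C1_with \<psi> g\<psi>" "\<And>x. x \<notin> cball 0 R \<Longrightarrow> \<psi> x = 0"
  shows "integrable lborel (\<lambda>x. ball_potential_grad \<tau> \<rho> z x \<bullet> g\<psi> x + \<tau>\<^sup>2 * ball_potential \<tau> \<rho> z x * \<psi> x)"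
    and "(LINT x|lborel. ball_potential_grad \<tau> \<rho> z x \<bullet> g\<psi> x + \<tau>\<^sup>2 * ball_potential \<tau> \<rho> z x * \<psi> x)
      = (LINT x|lborel. indicator (cball z \<rho>) x * \<psi> x) / bp_mass \<tau> \<rho>"
proof -
  have cont: "continuous_on UNIV \<psi>" using assms C1_withD by blast
  have m: "bp_profile'' \<tau> \<rho> \<in> borel_measurable borel"
  proof -
    have [measurable]: "shc'' \<in> borel_measurable borel"
      using isCont_shc'' by (intro borel_measurable_continuous_onI continuous_at_imp_continuous_on) auto
    show ?thesis unfolding bp_profile''_def[abs_def] by measurable
  qed
  note * = radial_weak_eq[OF bp_profile'_continuous bp_profile'_lipschitz bp_profile'_deriv m pos(2) assms, where z = z]
  have eq: "(2 * bp_profile' \<tau> \<rho> ((x - z) \<bullet> (x - z))) *\<^sub>R (x - z) \<bullet> g\<psi> x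
            + (4 * ((x - z) \<bullet> (x - z)) * bp_profile'' \<tau> \<rho> ((x - z) \<bullet> (x - z)) +
            real (2 * DIM(real^3)) * bp_profile' \<tau> \<rho> ((x - z) \<bullet> (x - z))) * \<psi> x
     = (ball_potential_grad \<tau> \<rho> z x \<bullet> g\<psi> x + \<tau>\<^sup>2 * ball_potential \<tau> \<rho> z x * \<psi> x)
        - indicator (cball z \<rho>) x * \<psi> x / bp_mass \<tau> \<rho>" for x
  proof -
    have q: "(x - z) \<bullet> (x - z) = (dist z x)\<^sup>2" by (simp add: dist_norm power2_norm_eq_inner norm_minus_commute)
    have "(dist z x)\<^sup>2 \<le> \<rho>\<^sup>2 \<longleftrightarrow> dist z x \<le> \<rho>" using pos by (simp add: power_mono_iff)
    then show ?thesis
      unfolding ball_potential_grad_def ball_potential_def q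
      using bp_profile_ode[of "(dist z x)\<^sup>2"] by (simp add: indicator_def) (simp add: algebra_simps)
  qed
  have i2: "integrable lborel (\<lambda>x. indicator (cball z \<rho>) x * \<psi> x)"
    using borel_integrable_compact[of "cball z \<rho>" \<psi>] continuous_on_subset[OF cont] by auto
  from Bochner_Integration.integrable_add[OF *(1)[unfolded eq] integrable_divide[OF i2, of "bp_mass \<tau> \<rho>"]]
  show i: "integrable lborel (\<lambda>x. ball_potential_grad \<tau> \<rho> z x \<bullet> g\<psi> x + \<tau>\<^sup>2 * ball_potential \<tau> \<rho> z x * \<psi> x)"
    by simp
  show "(LINT x|lborel. ball_potential_grad \<tau> \<rho> z x \<bullet> g\<psi> x + \<tau>\<^sup>2 * ball_potential \<tau> \<rho> z x * \<psi> x)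
      = (LINT x|lborel. indicator (cball z \<rho>) x * \<psi> x) / bp_mass \<tau> \<rho>"
    using *(2)[unfolded eq] i i2 by simp
qed

end



section \<open>Weak solutions and their time-averaged approximants\<close>

lemma C1_with_imp_st_grad:
  fixes g :: "(real^3) \<times> real \<Rightarrow> real"
  assumes "C1_with g G"
  shows "st_grad g = G"
proof
  fix z
  have "frechet_derivative g (at z) = (\<lambda>v. G z \<bullet> v)"
    using frechet_derivative_at[OF C1_withD(1)[OF assms, of z]] by simp
  then show "st_grad g z = G z"
    unfolding st_grad_def by (cases "G z") (simp add: inner_prod_def inner_axis vec_eq_iff)
qed

lemma C1_with_imp_C1_fun:
  fixes g :: "(real^3) \<times> real \<Rightarrow> real"
  assumes "C1_with g G"
  shows "C1_fun g"
  unfolding C1_fun_def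
proof (intro exI conjI allI)
  show "(g has_derivative blinfun_apply (blinfun_inner_right (G z))) (at z)" for z
    using C1_withD(1)[OF assms, of z] by simp
  show "continuous_on UNIV (\<lambda>z. blinfun_inner_right (G z))"
    by (rule bounded_linear.continuous_on[OF bounded_linear_blinfun_inner_right C1_withD(2)[OF assms]])
qed

lemma C1_fun_imp_C1_with:
  assumes "C1_fun g"
  shows "C1_with g (st_grad g)"
proof -
  obtain g' where g': "\<And>z. (g has_derivative blinfun_apply (g' z)) (at z)" "continuous_on UNIV g'"
    using assms unfolding C1_fun_def by blast
  define G where "G z = (\<Sum>b\<in>Basis. blinfun_apply (g' z) b *\<^sub>R b)" for z
  have "blinfun_apply (g' z) v = G z \<bullet> v" for z v
  proof -
    have "blinfun_apply (g' z) v = blinfun_apply (g' z) (\<Sum>b\<in>Basis. (v \<bullet> b) *\<^sub>R b)"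
      by (simp add: euclidean_representation)
    also have "\<dots> = (\<Sum>b\<in>Basis. (v \<bullet> b) * blinfun_apply (g' z) b)"
      by (simp add: blinfun.sum_right blinfun.scaleR_right)
    also have "\<dots> = G z \<bullet> v"
      by (simp add: G_def inner_sum_left inner_commute[of v] mult.commute)
    finally show ?thesis .
  qed
  then have "blinfun_apply (g' z) = (\<lambda>v. G z \<bullet> v)" for z by (intro ext)
  then have "C1_with g G"
    unfolding C1_with_def using g'
    by (auto simp: G_def intro!: continuous_intros)
  then show ?thesis using C1_with_imp_st_grad by metis
qed

lemma C1_with_prod:
  fixes \<psi> :: "'a::euclidean_space \<Rightarrow> real"
  assumes "C1_with \<psi> g\<psi>" "\<And>t. (\<sigma> has_real_derivative \<sigma>' t) (at t)" "continuous_on UNIV \<sigma>'"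
  shows "C1_with (\<lambda>z. \<psi> (fst z) * \<sigma> (snd z)) (\<lambda>z. (\<sigma> (snd z) *\<^sub>R g\<psi> (fst z), \<psi> (fst z) * \<sigma>' (snd z)))"
  unfolding C1_with_def
proof (intro conjI allI)
  fix z :: "'a \<times> real"
  have 1: "((\<lambda>z. \<psi> (fst z)) has_derivative (\<lambda>v. g\<psi> (fst z) \<bullet> fst v)) (at z)"
    by (rule has_derivative_compose[of fst fst z UNIV \<psi>]) (auto intro!: derivative_eq_intros C1_withD(1)[OF assms(1)])
  have 2: "((\<lambda>z. \<sigma> (snd z)) has_derivative (\<lambda>v. \<sigma>' (snd z) * snd v)) (at z)"
    by (rule has_derivative_compose[of snd snd z UNIV \<sigma>])
      (auto intro!: derivative_eq_intros assms(2)[unfolded has_field_derivative_def])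
  from has_derivative_mult[OF 1 2]
  show "((\<lambda>z. \<psi> (fst z) * \<sigma> (snd z)) has_derivative
      (\<lambda>v. (\<sigma> (snd z) *\<^sub>R g\<psi> (fst z), \<psi> (fst z) * \<sigma>' (snd z)) \<bullet> v)) (at z)"
    by (rule has_derivative_eq_rhs) (auto simp: inner_prod_def algebra_simps)
next
  have c: "continuous_on UNIV \<sigma>"
    using assms(2) by (meson DERIV_isCont continuous_at_imp_continuous_on)
  have f: "continuous_on UNIV (fst :: 'a \<times> real \<Rightarrow> 'a)" "continuous_on UNIV (snd :: 'a \<times> real \<Rightarrow> real)"
    by (intro continuous_intros)+
  show "continuous_on UNIV (\<lambda>z::'a \<times> real. (\<sigma> (snd z) *\<^sub>R g\<psi> (fst z), \<psi> (fst z) * \<sigma>' (snd z)))"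
    by (intro continuous_on_Pair continuous_on_scaleR continuous_on_mult
        continuous_on_compose2[OF c f(2)] continuous_on_compose2[OF assms(3) f(2)]
        continuous_on_compose2[OF C1_withD(2)[OF assms(1)] f(1)]
        continuous_on_compose2[OF C1_withD(3)[OF assms(1)] f(1)]) auto
qed

lemma C1_with_mult:
  assumes "C1_with f F" "C1_with g G"
  shows "C1_with (\<lambda>z. f z * g z) (\<lambda>z. g z *\<^sub>R F z + f z *\<^sub>R G z)"
  unfolding C1_with_def
proof (intro conjI allI)
  fix z
  from has_derivative_mult[OF C1_withD(1)[OF assms(1), of z] C1_withD(1)[OF assms(2), of z]]
  show "((\<lambda>z. f z * g z) has_derivative (\<lambda>v. (g z *\<^sub>R F z + f z *\<^sub>R G z) \<bullet> v)) (at z)"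
    by (rule has_derivative_eq_rhs) (auto simp: inner_simps)
next
  show "continuous_on UNIV (\<lambda>z. g z *\<^sub>R F z + f z *\<^sub>R G z)"
    by (intro continuous_intros C1_withD[OF assms(1)] C1_withD[OF assms(2)])
qed

lemma tsupp_prod:
  assumes "compact K" "\<And>x. x \<notin> K \<Longrightarrow> \<psi> x = 0" "\<And>t. t \<notin> {l..h} \<Longrightarrow> \<sigma> t = 0"
  shows "compact (tsupp (\<lambda>z. \<psi> (fst z) * \<sigma> (snd z)))" "tsupp (\<lambda>z. \<psi> (fst z) * \<sigma> (snd z)) \<subseteq> K \<times> {l..h}"
proof -
  have c: "compact (K \<times> {l..h})" using assms(1) by (simp add: compact_Times)
  have "{z. \<psi> (fst z) * \<sigma> (snd z) \<noteq> 0} \<subseteq> K \<times> {l..h}"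
    using assms(2,3) by fastforce
  then show s: "tsupp (\<lambda>z. \<psi> (fst z) * \<sigma> (snd z)) \<subseteq> K \<times> {l..h}"
    unfolding tsupp_def by (rule closure_minimal) (use c compact_imp_closed in blast)
  have "tsupp (\<lambda>z. \<psi> (fst z) * \<sigma> (snd z)) = K \<times> {l..h} \<inter> tsupp (\<lambda>z. \<psi> (fst z) * \<sigma> (snd z))"
    using s by blast
  moreover have "compact (K \<times> {l..h} \<inter> tsupp (\<lambda>z. \<psi> (fst z) * \<sigma> (snd z)))"
    using c by (intro compact_Int_closed) (auto simp: tsupp_def)
  ultimately show "compact (tsupp (\<lambda>z. \<psi> (fst z) * \<sigma> (snd z)))" by simp
qed

text \<open>Differentiation under the time integral, with the derivative viewed as a
  \<open>blinfun\<close> and pulled back to a vector afterwards. The transform of an approximant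
  thus becomes a C^1 function of space, ready for composition with \<open>soft_pos\<close>.\<close>

lemma C1_with_time_average:
  fixes \<phi> :: "(real^3) \<times> real \<Rightarrow> real"
  assumes \<phi>: "C1_with \<phi> G" and \<sigma>: "continuous_on UNIV \<sigma>"
  shows "C1_with (\<lambda>x. integral {0..T} (\<lambda>t. \<sigma> t * \<phi> (x, t))) (\<lambda>x. integral {0..T} (\<lambda>t. \<sigma> t *\<^sub>R fst (G (x, t))))"
proof -
  have c1: "continuous_on (UNIV \<times> X) (\<lambda>(x, t). \<sigma> t *\<^sub>R fst (G (x, t)))" for X
    unfolding split_beta
    by (intro continuous_intros continuous_on_compose2[OF \<sigma>] continuous_on_compose2[OF C1_withD(2)[OF \<phi>]]) auto
  have c2: "continuous_on X (\<lambda>t. \<sigma> t * \<phi> (x, t))" for x X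
    by (intro continuous_intros continuous_on_compose2[OF \<sigma>] continuous_on_compose2[OF C1_withD(3)[OF \<phi>]]) auto
  have c3: "continuous_on X (\<lambda>t. \<sigma> t *\<^sub>R fst (G (x, t)))" for x X
    by (intro continuous_intros continuous_on_compose2[OF \<sigma>] continuous_on_compose2[OF C1_withD(2)[OF \<phi>]]) auto
  have d: "((\<lambda>x. \<sigma> t * \<phi> (x, t)) has_derivative blinfun_apply (blinfun_inner_right (\<sigma> t *\<^sub>R fst (G (x, t))))) (at x within UNIV)" for x t
  proof -
    have "((\<lambda>x. (x, t)) has_derivative (\<lambda>v. (v, 0))) (at x)" by (auto intro!: derivative_eq_intros)
    from has_derivative_compose[OF this C1_withD(1)[OF \<phi>]]
    have "((\<lambda>x. \<phi> (x, t)) has_derivative (\<lambda>v. G (x, t) \<bullet> (v, 0))) (at x)" .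
    from has_derivative_mult_right[OF this, of "\<sigma> t"] show ?thesis
      by (rule has_derivative_eq_rhs) (auto simp: inner_prod_def)
  qed
  show ?thesis
    unfolding C1_with_def
  proof (intro conjI allI)
    fix x
    have "((\<lambda>x. integral (cbox 0 T) (\<lambda>t. \<sigma> t * \<phi> (x, t))) has_derivative
      blinfun_apply (integral (cbox 0 T) (\<lambda>t. blinfun_inner_right (\<sigma> t *\<^sub>R fst (G (x, t)))))) (at x within UNIV)"
    proof (rule leibniz_rule)
      show "continuous_on (UNIV \<times> cbox 0 T) (\<lambda>(x, t). blinfun_inner_right (\<sigma> t *\<^sub>R fst (G (x, t))))"
        using bounded_linear.continuous_on[OF bounded_linear_blinfun_inner_right c1[of "cbox 0 T"]]
        by (simp add: split_beta)
    qed (use d in \<open>auto intro!: integrable_continuous_real c2\<close>)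
    moreover have "integral (cbox 0 T) (\<lambda>t. blinfun_inner_right (\<sigma> t *\<^sub>R fst (G (x, t))))
       = blinfun_inner_right (integral (cbox 0 T) (\<lambda>t. \<sigma> t *\<^sub>R fst (G (x, t))))"
      using integral_linear[OF integrable_continuous[OF c3[of "cbox 0 T" x]] bounded_linear_blinfun_inner_right]
      by (simp add: o_def)
    ultimately show "((\<lambda>x. integral {0..T} (\<lambda>t. \<sigma> t * \<phi> (x, t))) has_derivative
       (\<lambda>v. integral {0..T} (\<lambda>t. \<sigma> t *\<^sub>R fst (G (x, t))) \<bullet> v)) (at x)"
      by simp
  next
    have "continuous_on UNIV (\<lambda>x. integral (cbox 0 T) (\<lambda>t. \<sigma> t *\<^sub>R fst (G (x, t))))"
      by (rule integral_continuous_on_param) (use c1 in simp)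
    then show "continuous_on UNIV (\<lambda>x. integral {0..T} (\<lambda>t. \<sigma> t *\<^sub>R fst (G (x, t))))" by simp
  qed
qed

text \<open>Vanishing in time is asked for on \<open>J\<close> only. For \<open>J = {0<..<T}\<close>
  the choice \<open>l = 0\<close>, \<open>h = T\<close> makes this void; for \<open>{..<T}\<close>
  it comes from a time cutoff.\<close>

lemma integrable_restrict_cylinder:
  fixes g :: "'a::euclidean_space \<times> real \<Rightarrow> real"
  assumes "continuous_on UNIV g" "compact K" "\<And>x t. x \<notin> K \<Longrightarrow> g (x, t) = 0"
    and "\<And>x t. t \<in> J \<Longrightarrow> t \<notin> {l..h} \<Longrightarrow> g (x, t) = 0" "open U" "J \<in> sets borel"
  shows "integrable (restrict_space lborel (U \<times> J)) g"
proof -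
  have UJ: "U \<times> J \<in> sets lborel" using assms(5,6) by (simp add: borel_prod[symmetric] open_Times)
  have K: "compact (K \<times> {l..h})" using assms(2) by (simp add: compact_Times)
  have "set_integrable lborel (K \<times> {l..h}) g"
    unfolding set_integrable_def
    by (rule borel_integrable_compact[OF K continuous_on_subset[OF assms(1)]]) auto
  then have "set_integrable lborel (K \<times> {l..h} \<inter> U \<times> J) g"
    by (rule set_integrable_subset) (use K UJ in \<open>auto intro!: sets.Int simp: borel_compact\<close>)
  moreover have "(\<lambda>z. indicator (K \<times> {l..h} \<inter> U \<times> J) z *\<^sub>R g z) = (\<lambda>z. indicator (U \<times> J) z *\<^sub>R g z)"
  proof
    fix z show "indicator (K \<times> {l..h} \<inter> U \<times> J) z *\<^sub>R g z = indicator (U \<times> J) z *\<^sub>R g z"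
      using assms(3)[of "fst z" "snd z"] assms(4)[of "snd z" "fst z"]
      by (cases z) (auto simp: indicator_def)
  qed
  ultimately have "set_integrable lborel (U \<times> J) g"
    unfolding set_integrable_def by (simp only:)
  then show ?thesis
    using UJ by (simp add: integrable_restrict_space set_integrable_def)
qed

text \<open>Fubini, with the inner Lebesgue integral turned into a gauge integral over
  \<open>{0..T}\<close>. The support \<open>K\<close> may stick out of \<open>U\<close>, as happens
  when \<open>U\<close> is the small ball around a receiver.\<close>

lemma integral_restrict_cylinder_indicator:
  fixes g :: "(real^3) \<times> real \<Rightarrow> real"
  assumes "continuous_on UNIV g" "compact K" "\<And>x t. x \<notin> K \<Longrightarrow> g (x, t) = 0" "open U"
  shows "integrable lborel (\<lambda>x. indicator U x * integral {0..T} (\<lambda>t. g (x, t)))"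
    and "(LINT z|restrict_space lborel (U \<times> {0<..<T}). g z)
      = (LINT x|lborel. indicator U x * integral {0..T} (\<lambda>t. g (x, t)))"
proof -
  have UJ: "U \<times> {0<..<T} \<in> sets lborel" using assms(4) by (simp add: borel_prod[symmetric] open_Times)
  let ?f = "\<lambda>z. indicator (U \<times> {0<..<T}) z * g z"
  have i: "integrable lborel ?f"
    using integrable_restrict_cylinder[OF assms(1-3), of "{0<..<T}" 0 T U] assms(4) UJ
    by (auto simp: integrable_restrict_space)
  have inner: "(LINT t|lborel. ?f (x, t)) = indicator U x * integral {0..T} (\<lambda>t. g (x, t))" for x
  proof -
    have c: "continuous_on X (\<lambda>t. g (x, t))" for X
      by (rule continuous_on_compose2[OF assms(1)]) (auto intro!: continuous_intros)
    have e: "?f (x, t) = indicator U x * (indicator {0<..<T} t * g (x, t))" for t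
      by (auto simp: indicator_def)
    have si: "set_integrable lborel {0<..<T} (\<lambda>t. g (x, t))"
      by (rule set_integrable_subset[OF borel_integrable_atLeastAtMost'[OF c[of "{0..T}"]]]) auto
    have "(LINT t|lborel. ?f (x, t)) = indicator U x * (LINT t:{0<..<T}|lborel. g (x, t))"
      unfolding e set_lebesgue_integral_def by simp
    also have "(LINT t:{0<..<T}|lborel. g (x, t)) = integral {0<..<T} (\<lambda>t. g (x, t))"
      using set_borel_integral_eq_integral(2)[OF si] by simp
    also have "\<dots> = integral {0..T} (\<lambda>t. g (x, t))"
      using integral_open_interval_real by metis
    finally show ?thesis .
  qed
  have i': "integrable (lborel \<Otimes>\<^sub>M lborel) ?f" using i by (simp add: lborel_prod)
  show "integrable lborel (\<lambda>x. indicator U x * integral {0..T} (\<lambda>t. g (x, t)))"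
    using lborel_pair.integrable_fst'[OF i'] inner by simp
  have "(LINT z|restrict_space lborel (U \<times> {0<..<T}). g z) = (LINT z|lborel. ?f z)"
    using UJ by (subst integral_restrict_space) auto
  also have "\<dots> = (LINT x|lborel. LINT t|lborel. ?f (x, t))"
    using lborel_pair.integral_fst'[OF i'] by (simp add: lborel_prod)
  finally show "(LINT z|restrict_space lborel (U \<times> {0<..<T}). g z)
      = (LINT x|lborel. indicator U x * integral {0..T} (\<lambda>t. g (x, t)))"
    using inner by simp
qed

lemma integral_restrict_cylinder:
  fixes g :: "(real^3) \<times> real \<Rightarrow> real"
  assumes "continuous_on UNIV g" "compact K" "\<And>x t. x \<notin> K \<Longrightarrow> g (x, t) = 0" "K \<subseteq> U" "open U"
  shows "integrable lborel (\<lambda>x. integral {0..T} (\<lambda>t. g (x, t)))"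
    and "(LINT z|restrict_space lborel (U \<times> {0<..<T}). g z) = (LINT x|lborel. integral {0..T} (\<lambda>t. g (x, t)))"
proof -
  have "indicator U x * integral {0..T} (\<lambda>t. g (x, t)) = integral {0..T} (\<lambda>t. g (x, t))" for x
    using assms(3)[of x] assms(4) by (cases "x \<in> K") (auto simp: indicator_def)
  note eq = ext[OF this]
  show "integrable lborel (\<lambda>x. integral {0..T} (\<lambda>t. g (x, t)))"
    "(LINT z|restrict_space lborel (U \<times> {0<..<T}). g z) = (LINT x|lborel. integral {0..T} (\<lambda>t. g (x, t)))"
    using integral_restrict_cylinder_indicator[OF assms(1,2,3,5), of T] unfolding eq by blast+
qed



section \<open>C^2 step functions built from powers of the positive part\<close>

lemma DERIV_pos_part_power:
  "((\<lambda>s::real. max 0 s ^ Suc (Suc n)) has_real_derivative real (Suc (Suc n)) * max 0 s ^ Suc n) (at s)"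
proof -
  consider "s < 0" | "s > 0" | "s = 0" by linarith
  then show ?thesis
  proof cases
    case 1
    have "((\<lambda>_. 0) has_real_derivative real (Suc (Suc n)) * max 0 s ^ Suc n) (at s)" using 1 by simp
    then show ?thesis
      by (rule has_field_derivative_transform_within_open[of _ _ _ "{..<0}"]) (use 1 in auto)
  next
    case 2
    have "((\<lambda>s. s ^ Suc (Suc n)) has_real_derivative real (Suc (Suc n)) * max 0 s ^ Suc n) (at s)"
      using 2 by (auto intro!: derivative_eq_intros simp del: power_Suc)
    then show ?thesis
      by (rule has_field_derivative_transform_within_open[of _ _ _ "{0<..}"]) (use 2 in \<open>auto simp: max_def\<close>)
  next
    case 3
    have "((\<lambda>h::real. max 0 h ^ Suc (Suc n) / h) \<longlongrightarrow> 0) (at 0)"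
    proof (rule Lim_null_comparison)
      have "norm (max 0 h ^ Suc (Suc n) / h) \<le> \<bar>h\<bar> ^ Suc n" for h :: real
      proof (cases "h > 0")
        case False
        then have "max 0 h ^ Suc (Suc n) / h = 0" by simp
        then show ?thesis by (metis norm_zero zero_le_power abs_ge_zero)
      qed (simp add: abs_mult)
      then show "\<forall>\<^sub>F h in at 0. norm (max 0 h ^ Suc (Suc n) / h) \<le> \<bar>h::real\<bar> ^ Suc n" by simp
      have "((\<lambda>h::real. \<bar>h\<bar> ^ Suc n) \<longlongrightarrow> \<bar>0\<bar> ^ Suc n) (at 0)" by (intro tendsto_intros)
      then show "((\<lambda>h::real. \<bar>h\<bar> ^ Suc n) \<longlongrightarrow> 0) (at 0)" by simp
    qed
    then show ?thesis using 3 by (simp add: DERIV_def)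
  qed
qed

text \<open>Equal to 1 for \<open>s \<le> 0\<close> and to 0 for \<open>s \<ge> 1\<close>. The cubes
  make it C^2 at both ends, since time cutoffs will be differentiated twice.\<close>

definition step_down :: "real \<Rightarrow> real" where
  "step_down s = max 0 (1 - max 0 s ^ 3) ^ 3"

definition step_down' :: "real \<Rightarrow> real" where
  "step_down' s = - 9 * max 0 (1 - max 0 s ^ 3) ^ 2 * max 0 s ^ 2"

definition step_down'' :: "real \<Rightarrow> real" where
  "step_down'' s = 54 * max 0 (1 - max 0 s ^ 3) * max 0 s ^ 4 - 18 * max 0 (1 - max 0 s ^ 3) ^ 2 * max 0 s"

lemma DERIV_pos_part_cube [derivative_intros]:
  "(f has_real_derivative f') (at x) \<Longrightarrow>
   ((\<lambda>x. max 0 (f x) ^ 3) has_real_derivative 3 * max 0 (f x) ^ 2 * f') (at x)"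
  using DERIV_chain2[of "\<lambda>s. max 0 s ^ Suc (Suc 1)" _ f x f' UNIV, OF DERIV_pos_part_power]
  by (simp add: numeral_3_eq_3 numeral_2_eq_2)

lemma DERIV_pos_part_square [derivative_intros]:
  "(f has_real_derivative f') (at x) \<Longrightarrow>
   ((\<lambda>x. max 0 (f x) ^ 2) has_real_derivative 2 * max 0 (f x) * f') (at x)"
  using DERIV_chain2[of "\<lambda>s. max 0 s ^ Suc (Suc 0)" _ f x f' UNIV, OF DERIV_pos_part_power]
  by (simp add: numeral_2_eq_2)

lemma DERIV_step_down: "(step_down has_real_derivative step_down' s) (at s)"
  unfolding step_down_def[abs_def] step_down'_def
  by (auto intro!: derivative_eq_intros)

lemma DERIV_step_down': "(step_down' has_real_derivative step_down'' s) (at s)"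
  unfolding step_down'_def[abs_def] step_down''_def
  by (rule derivative_eq_intros refl)+ (simp add: algebra_simps power2_eq_square power4_eq_xxxx)

lemma step_down_bounds: "0 \<le> step_down s" "step_down s \<le> 1"
  by (auto simp: step_down_def max_def intro!: power_le_one)

lemma step_down_left: "s \<le> 0 \<Longrightarrow> step_down s = 1" "s \<le> 0 \<Longrightarrow> step_down' s = 0" "s \<le> 0 \<Longrightarrow> step_down'' s = 0"
  by (auto simp: step_down_def step_down'_def step_down''_def)

lemma step_down_right: "s \<ge> 1 \<Longrightarrow> step_down s = 0" "s \<ge> 1 \<Longrightarrow> step_down' s = 0"
proof -
  assume "s \<ge> 1"
  then have "1 \<le> max 0 s ^ 3" by (intro one_le_power) simp
  then have "max 0 (1 - max 0 s ^ 3) = 0" by linarith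
  then show "step_down s = 0" "step_down' s = 0" by (auto simp: step_down_def step_down'_def)
qed

lemma continuous_step_down: "continuous_on X step_down" "continuous_on X step_down'" "continuous_on X step_down''"
  unfolding step_down_def[abs_def] step_down'_def[abs_def] step_down''_def[abs_def] by (intro continuous_intros)+

lemma integrable_mult_L2:
  fixes a b :: "'a \<Rightarrow> real"
  assumes "a \<in> borel_measurable N" "b \<in> borel_measurable N"
    and "integrable N (\<lambda>z. (a z)\<^sup>2)" "integrable N (\<lambda>z. (b z)\<^sup>2)"
  shows "integrable N (\<lambda>z. a z * b z)"
proof (rule Bochner_Integration.integrable_bound[OF Bochner_Integration.integrable_add[OF assms(3,4)]])
  show "(\<lambda>z. a z * b z) \<in> borel_measurable N" using assms by measurable
  have "\<bar>a z * b z\<bar> \<le> (a z)\<^sup>2 + (b z)\<^sup>2" for z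
  proof -
    have "2 * (\<bar>a z\<bar> * \<bar>b z\<bar>) \<le> (a z)\<^sup>2 + (b z)\<^sup>2"
      using sum_squares_bound[of "\<bar>a z\<bar>" "\<bar>b z\<bar>"] by (simp add: mult.assoc)
    moreover have "0 \<le> \<bar>a z\<bar> * \<bar>b z\<bar>" by simp
    ultimately show ?thesis unfolding abs_mult by linarith
  qed
  then show "AE z in N. norm (a z * b z) \<le> norm ((a z)\<^sup>2 + (b z)\<^sup>2)" by simp
qed

lemma weighted_am_gm:
  fixes a b l :: real
  assumes "l > 0"
  shows "\<bar>a * b\<bar> \<le> a\<^sup>2 / l + l * b\<^sup>2 / 4"
proof -
  have "0 \<le> (\<bar>a\<bar> - l * \<bar>b\<bar> / 2)\<^sup>2" by simp
  also have "\<dots> = a\<^sup>2 - l * \<bar>a * b\<bar> + l\<^sup>2 * b\<^sup>2 / 4"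
    by (simp add: power2_eq_square algebra_simps abs_mult)
  finally have "l * \<bar>a * b\<bar> \<le> a\<^sup>2 + l\<^sup>2 * b\<^sup>2 / 4" by simp
  then show ?thesis using assms by (simp add: field_simps power2_eq_square)
qed

text \<open>One solution with its gradient \<open>G\<close> and its approximants, the squared energy
  distance being bounded by a real null sequence \<open>e\<close>. The wave equation is kept as a
  separate hypothesis, \<open>weak_wave_eq\<close>.\<close>

locale weak_data =
  fixes D :: "(real^3) set" and T :: real and u :: "(real^3) \<times> real \<Rightarrow> real"
    and G :: "(real^3) \<times> real \<Rightarrow> (real^3) \<times> real" and \<phi> :: "nat \<Rightarrow> (real^3) \<times> real \<Rightarrow> real" and e :: "nat \<Rightarrow> real"
  assumes T: "T > 0"
    and u_meas [measurable]: "u \<in> borel_measurable borel" and G_meas [measurable]: "G \<in> borel_measurable borel"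
    and u_neg: "\<And>x t. t < 0 \<Longrightarrow> u (x, t) = 0"
    and \<phi>_C1: "\<And>n. C1_fun (\<phi> n)" and \<phi>_cpt: "\<And>n. compact (tsupp (\<phi> n))"
    and \<phi>_supp: "\<And>n. tsupp (\<phi> n) \<subseteq> (- closure D) \<times> UNIV"
    and approx: "\<And>n. (\<integral>\<^sup>+ z \<in> (- closure D) \<times> {..<T}.
                  ennreal ((\<phi> n z - u z)\<^sup>2 + (norm (st_grad (\<phi> n) z - G z))\<^sup>2) \<partial>lborel) \<le> ennreal (e n)"
    and e_nonneg: "\<And>n. e n \<ge> 0" and e_lim: "e \<longlonglongrightarrow> 0"
begin

definition Om :: "(real^3) set" where "Om = - closure D"

definition err :: "nat \<Rightarrow> (real^3) \<times> real \<Rightarrow> real" where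
  "err n z = (\<phi> n z - u z)\<^sup>2 + (norm (st_grad (\<phi> n) z - G z))\<^sup>2"

lemma Om_open: "open Om" by (simp add: Om_def open_Compl)

lemma \<phi>_C1_with: "C1_with (\<phi> n) (st_grad (\<phi> n))"
  using \<phi>_C1 C1_fun_imp_C1_with by blast

lemma \<phi>_meas [measurable]: "\<phi> n \<in> borel_measurable borel" "st_grad (\<phi> n) \<in> borel_measurable borel"
  using C1_withD(2,3)[OF \<phi>_C1_with] by (auto intro: borel_measurable_continuous_onI)

lemma err_meas [measurable]: "err n \<in> borel_measurable borel"
  unfolding err_def by measurable

lemma cyl_sets:
  fixes J :: "real set"
  assumes "J \<in> sets borel"
  shows "Om \<times> J \<in> sets borel"
proof -
  have "Om \<times> J \<in> sets (borel \<Otimes>\<^sub>M borel)"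
    by (rule pair_measureI[OF borel_open[OF Om_open] assms])
  then show ?thesis unfolding borel_prod .
qed

lemma restrict_meas: "f \<in> borel_measurable borel \<Longrightarrow> f \<in> borel_measurable (restrict_space lborel X)"
  by (rule measurable_restrict_space1) simp

lemma err_int_subset:
  assumes "S \<subseteq> Om \<times> {..<T}" "S \<in> sets borel"
  shows "integrable (restrict_space lborel S) (err n)"
    "(LINT z|restrict_space lborel S. err n z) \<le> e n"
proof -
  let ?N = "restrict_space lborel S"
  have "(\<integral>\<^sup>+z. ennreal (err n z) \<partial>?N) = (\<integral>\<^sup>+z. ennreal (err n z) * indicator S z \<partial>lborel)"
    using assms(2) by (subst nn_integral_restrict_space) auto
  also have "\<dots> \<le> (\<integral>\<^sup>+z. ennreal (err n z) * indicator (Om \<times> {..<T}) z \<partial>lborel)"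
    using assms(1) by (intro nn_integral_mono) (auto simp: indicator_def)
  also have "\<dots> \<le> ennreal (e n)" using approx[of n] by (simp add: err_def Om_def)
  finally have *: "(\<integral>\<^sup>+z. ennreal (err n z) \<partial>?N) \<le> ennreal (e n)" .
  have nn: "err n z \<ge> 0" for z by (simp add: err_def)
  show i: "integrable ?N (err n)"
    by (rule integrableI_nonneg) (use nn * in \<open>auto intro!: restrict_meas simp: less_top[symmetric] top_unique\<close>)
  have "ennreal (LINT z|?N. err n z) \<le> ennreal (e n)"
    using * nn_integral_eq_integral[OF i] nn by simp
  then show "(LINT z|?N. err n z) \<le> e n" using e_nonneg by (simp add: ennreal_le_iff)
qed

lemma err_int:
  assumes "J \<subseteq> {..<T}" "J \<in> sets borel"
  shows "integrable (restrict_space lborel (Om \<times> J)) (err n)"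
    "(LINT z|restrict_space lborel (Om \<times> J). err n z) \<le> e n"
  using assms by (intro err_int_subset cyl_sets; auto)+

lemma err_products:
  assumes J: "J \<subseteq> {..<T}" "J \<in> sets borel"
    and b: "b \<in> borel_measurable borel" "integrable (restrict_space lborel (Om \<times> J)) (\<lambda>z. (norm (b z))\<^sup>2)"
    and c: "c \<in> borel_measurable borel" "integrable (restrict_space lborel (Om \<times> J)) (\<lambda>z. (c z)\<^sup>2)"
  shows "integrable (restrict_space lborel (Om \<times> J)) (\<lambda>z. (\<phi> n z - u z) * c z)"
    "integrable (restrict_space lborel (Om \<times> J)) (\<lambda>z. snd (st_grad (\<phi> n) z - G z) * c z)"
    "integrable (restrict_space lborel (Om \<times> J)) (\<lambda>z. fst (st_grad (\<phi> n) z - G z) \<bullet> b z)"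
proof -
  let ?N = "restrict_space lborel (Om \<times> J)"
  have sn: "(snd w)\<^sup>2 \<le> (norm w)\<^sup>2" "(norm (fst w))\<^sup>2 \<le> (norm w)\<^sup>2" for w :: "(real^3) \<times> real"
    by (auto simp: norm_prod_def)
  have m[measurable]: "st_grad (\<phi> n) \<in> borel_measurable (borel \<Otimes>\<^sub>M borel)" "G \<in> borel_measurable (borel \<Otimes>\<^sub>M borel)"
    by (auto simp: borel_prod)
  have "fst \<in> borel_measurable (borel :: ((real^3) \<times> real) measure)" "snd \<in> borel_measurable (borel :: ((real^3) \<times> real) measure)"
    by (auto intro!: borel_measurable_continuous_onI continuous_intros)
  note [measurable] = this
  have M1: "(\<lambda>z. fst (st_grad (\<phi> n) z - G z)) \<in> borel_measurable borel"
    and M2: "(\<lambda>z. snd (st_grad (\<phi> n) z - G z)) \<in> borel_measurable borel"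
    by measurable
  note i = err_int(1)[OF J, of n]
  have i1: "integrable ?N (\<lambda>z. (\<phi> n z - u z)\<^sup>2)"
    by (rule Bochner_Integration.integrable_bound[OF i]) (auto simp: err_def intro!: restrict_meas)
  have i2: "integrable ?N (\<lambda>z. (snd (st_grad (\<phi> n) z - G z))\<^sup>2)"
  proof (rule Bochner_Integration.integrable_bound[OF i])
    show "(\<lambda>z. (snd (st_grad (\<phi> n) z - G z))\<^sup>2) \<in> borel_measurable ?N"
      using M2 by (intro restrict_meas) measurable
    show "AE z in ?N. norm ((snd (st_grad (\<phi> n) z - G z))\<^sup>2) \<le> norm (err n z)"
      by (intro AE_I2) (simp add: err_def add_increasing sn del: snd_diff)
  qed
  have i3: "integrable ?N (\<lambda>z. (norm (fst (st_grad (\<phi> n) z - G z)))\<^sup>2)"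
  proof (rule Bochner_Integration.integrable_bound[OF i])
    show "(\<lambda>z. (norm (fst (st_grad (\<phi> n) z - G z)))\<^sup>2) \<in> borel_measurable ?N"
      using M1 by (intro restrict_meas) measurable
    show "AE z in ?N. norm ((norm (fst (st_grad (\<phi> n) z - G z)))\<^sup>2) \<le> norm (err n z)"
      by (intro AE_I2) (simp add: err_def add_increasing sn del: fst_diff)
  qed
  show "integrable ?N (\<lambda>z. (\<phi> n z - u z) * c z)"
    by (rule integrable_mult_L2[OF _ _ i1 c(2)]) (use c(1) in \<open>auto intro!: restrict_meas\<close>)
  show "integrable ?N (\<lambda>z. snd (st_grad (\<phi> n) z - G z) * c z)"
    by (rule integrable_mult_L2[OF _ _ i2 c(2)]) (use c(1) M2 in \<open>auto intro!: restrict_meas simp del: snd_diff\<close>)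
  have i4: "integrable ?N (\<lambda>z. norm (fst (st_grad (\<phi> n) z - G z)) * norm (b z))"
    by (rule integrable_mult_L2[OF _ _ i3 b(2)]) (use b(1) M1 in \<open>auto intro!: restrict_meas simp del: fst_diff\<close>)
  show "integrable ?N (\<lambda>z. fst (st_grad (\<phi> n) z - G z) \<bullet> b z)"
  proof (rule Bochner_Integration.integrable_bound[OF i4])
    show "(\<lambda>z. fst (st_grad (\<phi> n) z - G z) \<bullet> b z) \<in> borel_measurable ?N"
      using M1 b(1) by (intro restrict_meas) measurable
    show "AE z in ?N. norm (fst (st_grad (\<phi> n) z - G z) \<bullet> b z) \<le> norm (norm (fst (st_grad (\<phi> n) z - G z)) * norm (b z))"
      using Cauchy_Schwarz_ineq2 by (intro AE_I2) (simp add: abs_mult)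
  qed
qed


text \<open>The time component of \<open>G\<close> is the weak time derivative of \<open>u\<close>.
  For an approximant this is an exact integration by parts, since \<open>\<sigma>\<close> vanishes
  outside \<open>{l..h}\<close> with \<open>h < T\<close> and \<open>K\<close> lies in
  \<open>Om\<close>; energy convergence carries it over to \<open>u\<close>.\<close>

lemma time_derivative_full:
  assumes \<psi>: "C1_with \<psi> g\<psi>" "compact K" "K \<subseteq> Om" "\<And>x. x \<notin> K \<Longrightarrow> \<psi> x = 0"
    and \<sigma>: "\<And>t. (\<sigma> has_real_derivative \<sigma>' t) (at t)" "continuous_on UNIV \<sigma>'"
      "\<And>t. t \<notin> {l..h} \<Longrightarrow> \<sigma> t = 0" "\<And>t. t \<notin> {l..h} \<Longrightarrow> \<sigma>' t = 0" "h < T"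
  defines "N \<equiv> restrict_space lborel (Om \<times> {..<T})"
  shows "integrable N (\<lambda>z. snd (G z) * (\<psi> (fst z) * \<sigma> (snd z)))"
    "integrable N (\<lambda>z. u z * (\<psi> (fst z) * \<sigma>' (snd z)))"
    "(LINT z|N. snd (G z) * (\<psi> (fst z) * \<sigma> (snd z))) = - (LINT z|N. u z * (\<psi> (fst z) * \<sigma>' (snd z)))"
proof -
  let ?\<zeta> = "\<lambda>z. \<psi> (fst z) * \<sigma> (snd z)" and ?\<zeta>' = "\<lambda>z. \<psi> (fst z) * \<sigma>' (snd z)"
  note \<zeta> = C1_with_prod[OF \<psi>(1) \<sigma>(1,2)]
  have c\<zeta>: "continuous_on UNIV ?\<zeta>" using \<zeta> by (rule C1_withD(3))
  have c\<zeta>': "continuous_on UNIV ?\<zeta>'"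
    using continuous_on_snd[OF C1_withD(2)[OF \<zeta>]] by simp
  have [measurable]: "?\<zeta> \<in> borel_measurable borel" "?\<zeta>' \<in> borel_measurable borel"
    using c\<zeta> c\<zeta>' by (auto intro: borel_measurable_continuous_onI)
  have cyl: "integrable N g" if "continuous_on UNIV g" "\<And>x t. x \<notin> K \<Longrightarrow> g (x, t) = 0" "\<And>x t. t \<notin> {l..h} \<Longrightarrow> g (x, t) = 0"
    for g :: "(real^3) \<times> real \<Rightarrow> real"
    unfolding N_def by (rule integrable_restrict_cylinder[OF that(1) \<psi>(2) that(2), where l = l and h = h])
      (use that Om_open in auto)
  have sq: "integrable N (\<lambda>z. (?\<zeta> z)\<^sup>2)" "integrable N (\<lambda>z. (?\<zeta>' z)\<^sup>2)"
    by (rule cyl; use \<psi>(4) \<sigma>(3,4) c\<zeta> c\<zeta>' in \<open>auto intro!: continuous_intros\<close>)+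
  have sq0: "integrable N (\<lambda>z. (norm (0 :: real^3))\<^sup>2)" by simp
  have J: "{..<T} \<subseteq> {..<T}" "{..<T} \<in> sets borel" by auto
  have z0: "(\<lambda>z::(real^3) \<times> real. 0 :: real^3) \<in> borel_measurable borel" by simp
  have cG: "continuous_on UNIV (\<lambda>z. snd (st_grad (\<phi> n) z))" for n
    using continuous_on_snd[OF C1_withD(2)[OF \<phi>_C1_with]] by simp
  have p1: "integrable N (\<lambda>z. snd (st_grad (\<phi> n) z) * ?\<zeta> z)" for n
    by (rule cyl) (use \<psi>(4) \<sigma>(3,4) c\<zeta> cG in \<open>auto intro!: continuous_on_mult\<close>)
  have p2: "integrable N (\<lambda>z. \<phi> n z * ?\<zeta>' z)" for n
    by (rule cyl) (use \<psi>(4) \<sigma>(3,4) c\<zeta>' C1_withD(3)[OF \<phi>_C1_with] in \<open>auto intro!: continuous_on_mult\<close>)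
  have q1: "integrable N (\<lambda>z. snd (st_grad (\<phi> n) z - G z) * ?\<zeta> z)" for n
    using err_products(2)[OF J z0 sq0[unfolded N_def] _ sq(1)[unfolded N_def]] unfolding N_def by simp
  have q2: "integrable N (\<lambda>z. (\<phi> n z - u z) * ?\<zeta>' z)" for n
    using err_products(1)[OF J z0 sq0[unfolded N_def] _ sq(2)[unfolded N_def]] unfolding N_def by simp
  show iG: "integrable N (\<lambda>z. snd (G z) * ?\<zeta> z)"
    using Bochner_Integration.integrable_diff[OF p1[of 0] q1[of 0]] by (simp add: algebra_simps)
  show iu: "integrable N (\<lambda>z. u z * ?\<zeta>' z)"
    using Bochner_Integration.integrable_diff[OF p2[of 0] q2[of 0]] by (simp add: algebra_simps)
  have ibp: "(LINT z|N. snd (st_grad (\<phi> n) z) * ?\<zeta> z + \<phi> n z * ?\<zeta>' z) = 0" for n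
  proof -
    define F where "F z = \<phi> n z * ?\<zeta> z" for z
    define F' where "F' z = snd (st_grad (\<phi> n) z) * ?\<zeta> z + \<phi> n z * ?\<zeta>' z" for z
    note FC = C1_with_mult[OF \<phi>_C1_with[of n] \<zeta>]
    have FC1: "C1_with F (\<lambda>z. ?\<zeta> z *\<^sub>R st_grad (\<phi> n) z + \<phi> n z *\<^sub>R (\<sigma> (snd z) *\<^sub>R g\<psi> (fst z), ?\<zeta>' z))"
      using FC unfolding F_def[abs_def] .
    have "bounded (K \<times> {l..h})" using \<psi>(2) by (intro bounded_Times compact_imp_bounded) auto
    then obtain R where "\<forall>z\<in>K \<times> {l..h}. norm z \<le> R" unfolding bounded_iff by blast
    then have R: "K \<times> {l..h} \<subseteq> cball 0 R" by auto
    have supp: "F z = 0" if "z \<notin> cball 0 R" for z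
    proof -
      have "z \<notin> K \<times> {l..h}" using R that by blast
      then show ?thesis using \<psi>(4) \<sigma>(3) by (cases z) (auto simp: F_def)
    qed
    obtain L where L: "L-lipschitz_on (cball 0 (R + norm ((0, 1) :: (real^3) \<times> real))) F"
      using C1_with_lipschitz_on_cball[OF FC1] by blast
    have der: "((\<lambda>t. F (z + t *\<^sub>R (0, 1))) has_real_derivative F' z) (at 0)" for z
    proof -
      have "((\<lambda>t. z + t *\<^sub>R (0, 1)) has_derivative (\<lambda>t. t *\<^sub>R (0, 1))) (at 0)"
        by (auto intro!: derivative_eq_intros)
      then have "((\<lambda>t. F (z + t *\<^sub>R (0, 1))) has_derivative
          (\<lambda>t. (?\<zeta> z *\<^sub>R st_grad (\<phi> n) z + \<phi> n z *\<^sub>R (\<sigma> (snd z) *\<^sub>R g\<psi> (fst z), ?\<zeta>' z)) \<bullet> (t *\<^sub>R (0, 1)))) (at 0)"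
        by (rule has_derivative_compose) (use C1_withD(1)[OF FC1, of z] in \<open>simp add: zero_prod_def[symmetric]\<close>)
      then show ?thesis
        by (rule has_derivative_imp_has_field_derivative) (simp add: F'_def inner_prod_def algebra_simps)
    qed
    have F'm: "F' \<in> borel_measurable borel"
      unfolding F'_def
      by (intro borel_measurable_continuous_onI continuous_on_add
          continuous_on_mult[OF cG c\<zeta>] continuous_on_mult[OF C1_withD(3)[OF \<phi>_C1_with] c\<zeta>'])
    have "(LINT z|lborel. F' z) = 0"
      by (rule integral_directional_derivative_eq_0(2)[OF L supp C1_withD(3)[OF FC1] _ der F'm, of "{}"]) auto
    moreover have "(LINT z|N. F' z) = (LINT z|lborel. indicator (Om \<times> {..<T}) z *\<^sub>R F' z)"
      unfolding N_def using cyl_sets[of "{..<T}"] by (subst integral_restrict_space) auto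
    moreover have "indicator (Om \<times> {..<T}) z *\<^sub>R F' z = F' z" for z
    proof (cases "z \<in> K \<times> {l..h}")
      case True
      then have "z \<in> Om \<times> {..<T}" using \<psi>(3) \<sigma>(5) by auto
      then show ?thesis by simp
    next
      case False
      then have "F' z = 0" using \<psi>(4) \<sigma>(3,4) by (cases z) (auto simp: F'_def)
      then show ?thesis by simp
    qed
    ultimately have "(LINT z|N. F' z) = 0" by (simp only:)
    then show ?thesis unfolding F'_def .
  qed
  define A where "A = (LINT z|N. snd (G z) * ?\<zeta> z) + (LINT z|N. u z * ?\<zeta>' z)"
  define C where "C = (LINT z|N. (?\<zeta> z)\<^sup>2 + (?\<zeta>' z)\<^sup>2)"
  \<comment> \<open>Young's inequality with weight \<open>s\<close> trades the error
    \<open>e n\<close> against the fixed norm \<open>C\<close> of the test function. First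
    \<open>n\<close> tends to infinity, then \<open>s\<close> to 0.\<close>
  have bound: "\<bar>A\<bar> \<le> e n / s + s * C" if "s > 0" for n s
  proof -
    have "A = - (LINT z|N. snd (st_grad (\<phi> n) z - G z) * ?\<zeta> z + (\<phi> n z - u z) * ?\<zeta>' z)"
    proof -
      have "A = (LINT z|N. snd (G z) * ?\<zeta> z + u z * ?\<zeta>' z)"
        unfolding A_def using iG iu by simp
      also have "\<dots> = (LINT z|N. (snd (st_grad (\<phi> n) z) * ?\<zeta> z + \<phi> n z * ?\<zeta>' z)
           - (snd (st_grad (\<phi> n) z - G z) * ?\<zeta> z + (\<phi> n z - u z) * ?\<zeta>' z))"
        by (rule Bochner_Integration.integral_cong) (auto simp: algebra_simps)
      also have "\<dots> = (LINT z|N. (snd (st_grad (\<phi> n) z) * ?\<zeta> z + \<phi> n z * ?\<zeta>' z))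
           - (LINT z|N. snd (st_grad (\<phi> n) z - G z) * ?\<zeta> z + (\<phi> n z - u z) * ?\<zeta>' z)"
        by (rule Bochner_Integration.integral_diff)
          (use p1 p2 q1 q2 in \<open>auto intro!: Bochner_Integration.integrable_add simp del: snd_diff\<close>)
      finally show ?thesis using ibp[of n] by simp
    qed
    then have "\<bar>A\<bar> \<le> (LINT z|N. \<bar>snd (st_grad (\<phi> n) z - G z) * ?\<zeta> z + (\<phi> n z - u z) * ?\<zeta>' z\<bar>)"
      by simp
    also have "\<dots> \<le> (LINT z|N. err n z / s + s * ((?\<zeta> z)\<^sup>2 + (?\<zeta>' z)\<^sup>2))"
    proof (rule Bochner_Integration.integral_mono)
      show "integrable N (\<lambda>z. \<bar>snd (st_grad (\<phi> n) z - G z) * ?\<zeta> z + (\<phi> n z - u z) * ?\<zeta>' z\<bar>)"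
        using q1 q2 by (intro integrable_abs Bochner_Integration.integrable_add)
      show "integrable N (\<lambda>z. err n z / s + s * ((?\<zeta> z)\<^sup>2 + (?\<zeta>' z)\<^sup>2))"
        using err_int(1)[OF J] sq unfolding N_def
        by (intro Bochner_Integration.integrable_add integrable_mult_right integrable_divide)
      fix z
      have 1: "\<bar>snd (st_grad (\<phi> n) z - G z) * ?\<zeta> z\<bar> \<le> (snd (st_grad (\<phi> n) z - G z))\<^sup>2 / s + s * (?\<zeta> z)\<^sup>2 / 4"
        by (rule weighted_am_gm[OF that])
      have 2: "\<bar>(\<phi> n z - u z) * ?\<zeta>' z\<bar> \<le> (\<phi> n z - u z)\<^sup>2 / s + s * (?\<zeta>' z)\<^sup>2 / 4"
        by (rule weighted_am_gm[OF that])
      have 3: "(snd (st_grad (\<phi> n) z - G z))\<^sup>2 / s + (\<phi> n z - u z)\<^sup>2 / s \<le> err n z / s"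
        unfolding err_def add_divide_distrib[symmetric] using that
        by (intro divide_right_mono) (auto simp: norm_prod_def)
      have 4: "s * (?\<zeta> z)\<^sup>2 / 4 + s * (?\<zeta>' z)\<^sup>2 / 4 \<le> s * ((?\<zeta> z)\<^sup>2 + (?\<zeta>' z)\<^sup>2)"
      proof -
        have "0 \<le> s * (?\<zeta> z)\<^sup>2" "0 \<le> s * (?\<zeta>' z)\<^sup>2" using that by auto
        then show ?thesis unfolding distrib_left by linarith
      qed
      show "\<bar>snd (st_grad (\<phi> n) z - G z) * ?\<zeta> z + (\<phi> n z - u z) * ?\<zeta>' z\<bar>
        \<le> err n z / s + s * ((?\<zeta> z)\<^sup>2 + (?\<zeta>' z)\<^sup>2)"
        using 1 2 3 4 by linarith
    qed
    also have "\<dots> = (LINT z|N. err n z) / s + s * C"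
      unfolding C_def using err_int(1)[OF J] sq unfolding N_def by simp
    also have "\<dots> \<le> e n / s + s * C"
      using err_int(2)[OF J, of n] that unfolding N_def by (simp add: divide_right_mono)
    finally show ?thesis .
  qed
  have "\<bar>A\<bar> \<le> s * C" if "s > 0" for s
  proof (rule LIMSEQ_le_const)
    have "(\<lambda>n. e n / s + s * C) \<longlonglongrightarrow> 0 / s + s * C"
      using e_lim that by (intro tendsto_intros) auto
    then show "(\<lambda>n. e n / s + s * C) \<longlonglongrightarrow> s * C" by simp
  qed (use bound[OF that] in auto)
  moreover have "C \<ge> 0" unfolding C_def by simp
  ultimately have "\<bar>A\<bar> \<le> 0"
  proof -
    assume *: "\<And>s. s > 0 \<Longrightarrow> \<bar>A\<bar> \<le> s * C" "C \<ge> 0"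
    show ?thesis
    proof (rule field_le_epsilon)
      fix d :: real assume "d > 0"
      then have "\<bar>A\<bar> \<le> (d / (C + 1)) * C" using * by (intro *(1)) auto
      also have "\<dots> \<le> d" using \<open>d > 0\<close> *(2) by (simp add: field_simps)
      finally show "\<bar>A\<bar> \<le> 0 + d" by simp
    qed
  qed
  then show "(LINT z|N. snd (G z) * ?\<zeta> z) = - (LINT z|N. u z * ?\<zeta>' z)"
    unfolding A_def by simp
qed

end



text \<open>A \<open>C\<^sup>1\<close> substitute for the positive part. Composed with a \<open>C\<^sup>1\<close> approximant it is an admissible test
  function, so that the maximum principle needs no chain rule for Sobolev functions.\<close>

definition soft_pos :: "real \<Rightarrow> real \<Rightarrow> real" where
  "soft_pos \<epsilon> s = (max 0 s)\<^sup>2 / (\<epsilon> + max 0 s)"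

definition soft_pos' :: "real \<Rightarrow> real \<Rightarrow> real" where
  "soft_pos' \<epsilon> s = ((max 0 s)\<^sup>2 + 2 * \<epsilon> * max 0 s) / (\<epsilon> + max 0 s)\<^sup>2"

context
  fixes \<epsilon> :: real
  assumes eps: "\<epsilon> > 0"
begin

lemma DERIV_soft_pos: "(soft_pos \<epsilon> has_real_derivative soft_pos' \<epsilon> s) (at s)"
proof -
  consider "s < 0" | "s > 0" | "s = 0" by linarith
  then show ?thesis
  proof cases
    case 1
    have "((\<lambda>_. 0) has_real_derivative soft_pos' \<epsilon> s) (at s)" using 1 by (simp add: soft_pos'_def)
    then show ?thesis
      by (rule has_field_derivative_transform_within_open[of _ _ _ "{..<0}"]) (use 1 in \<open>auto simp: soft_pos_def\<close>)
  next
    case 2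
    have "((\<lambda>s. s\<^sup>2 / (\<epsilon> + s)) has_real_derivative soft_pos' \<epsilon> s) (at s)"
      using 2 eps by (auto intro!: derivative_eq_intros simp: soft_pos'_def field_simps power2_eq_square)
    then show ?thesis
      by (rule has_field_derivative_transform_within_open[of _ _ _ "{0<..}"]) (use 2 in \<open>auto simp: soft_pos_def\<close>)
  next
    case 3
    have "((\<lambda>h. soft_pos \<epsilon> h / h) \<longlongrightarrow> 0) (at 0)"
    proof (rule Lim_null_comparison)
      have "norm (soft_pos \<epsilon> h / h) \<le> \<bar>h\<bar> / \<epsilon>" for h :: real
      proof (cases "h > 0")
        case True
        have "h / (\<epsilon> + h) \<le> h / \<epsilon>" using True eps by (intro divide_left_mono) auto
        then show ?thesis using True eps by (simp add: soft_pos_def power2_eq_square)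
      next
        case False
        then have "soft_pos \<epsilon> h = 0" by (simp add: soft_pos_def)
        then show ?thesis using eps by simp
      qed
      then show "\<forall>\<^sub>F h in at 0. norm (soft_pos \<epsilon> h / h) \<le> \<bar>h\<bar> / \<epsilon>" by simp
      have "((\<lambda>h::real. \<bar>h\<bar> / \<epsilon>) \<longlongrightarrow> \<bar>0\<bar> / \<epsilon>) (at 0)" using eps by (intro tendsto_intros) auto
      then show "((\<lambda>h::real. \<bar>h\<bar> / \<epsilon>) \<longlongrightarrow> 0) (at 0)" by simp
    qed
    then show ?thesis using 3 by (simp add: DERIV_def soft_pos_def soft_pos'_def)
  qed
qed

lemma continuous_soft_pos': "continuous_on UNIV (soft_pos' \<epsilon>)"
proof -
  have "(\<epsilon> + max 0 s)\<^sup>2 \<noteq> 0" for s using eps by (simp add: max_def)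
  then show ?thesis unfolding soft_pos'_def[abs_def] by (intro continuous_intros) auto
qed

lemma soft_pos_nonpos: "s \<le> 0 \<Longrightarrow> soft_pos \<epsilon> s = 0" "s \<le> 0 \<Longrightarrow> soft_pos' \<epsilon> s = 0"
  by (auto simp: soft_pos_def soft_pos'_def)

lemma soft_pos_nonneg: "0 \<le> soft_pos \<epsilon> s"
  using eps by (simp add: soft_pos_def)

lemma soft_pos'_bounds: "0 \<le> soft_pos' \<epsilon> s" "soft_pos' \<epsilon> s \<le> 1"
proof -
  have m: "max 0 s \<ge> 0" by simp
  show "0 \<le> soft_pos' \<epsilon> s" using eps m by (simp add: soft_pos'_def)
  have "(max 0 s)\<^sup>2 + 2 * \<epsilon> * max 0 s \<le> (\<epsilon> + max 0 s)\<^sup>2"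
    by (simp add: power2_sum)
  then show "soft_pos' \<epsilon> s \<le> 1" using eps m by (simp add: soft_pos'_def divide_le_eq_1)
qed

text \<open>Together with \<open>soft_pos'_bounds\<close> this is coercivity: for
  \<open>\<psi> = soft_pos \<epsilon> d\<close> the energy density
  \<open>|grad \<psi>|\<^sup>2 + \<tau>\<^sup>2 \<psi>\<^sup>2\<close> is at most
  \<open>grad d \<bullet> grad \<psi> + \<tau>\<^sup>2 d \<psi>\<close>.\<close>

lemma soft_pos_square_le: "(soft_pos \<epsilon> s)\<^sup>2 \<le> s * soft_pos \<epsilon> s"
proof (cases "s > 0")
  case True
  then have "soft_pos \<epsilon> s \<le> s" using eps by (simp add: soft_pos_def field_simps power2_eq_square)
  then show ?thesis using soft_pos_nonneg by (simp add: power2_eq_square mult_right_mono)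
qed (simp add: soft_pos_nonpos)

text \<open>The price of smoothing: a bound on \<open>soft_pos \<epsilon> s\<close> bounds
  \<open>s\<close> up to \<open>\<epsilon>\<close>. Later
  \<open>\<epsilon> = exp (- \<tau> a)\<close>, so this loss is no worse than the truncation
  error.\<close>

lemma soft_pos_ge: "s \<le> soft_pos \<epsilon> s + \<epsilon>"
proof (cases "s > 0")
  case True
  have "s * (\<epsilon> + s) \<le> s\<^sup>2 + \<epsilon> * (\<epsilon> + s)" using eps by (simp add: algebra_simps power2_eq_square)
  then have "s \<le> (s\<^sup>2 + \<epsilon> * (\<epsilon> + s)) / (\<epsilon> + s)" using True eps by (simp add: le_divide_eq)
  also have "\<dots> = s\<^sup>2 / (\<epsilon> + s) + \<epsilon>" using True eps by (simp add: add_divide_distrib)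
  finally show ?thesis using True by (simp add: soft_pos_def)
next
  case False
  then show ?thesis using eps soft_pos_nonneg[of s] by linarith
qed

lemma C1_with_soft_pos:
  assumes "C1_with d g"
  shows "C1_with (\<lambda>x. soft_pos \<epsilon> (d x)) (\<lambda>x. soft_pos' \<epsilon> (d x) *\<^sub>R g x)"
  unfolding C1_with_def
proof (intro conjI allI)
  fix x
  from DERIV_compose_FDERIV[OF DERIV_soft_pos C1_withD(1)[OF assms, of x]]
  show "((\<lambda>x. soft_pos \<epsilon> (d x)) has_derivative (\<lambda>v. soft_pos' \<epsilon> (d x) *\<^sub>R g x \<bullet> v)) (at x)"
    by (simp add: mult_ac)
next
  show "continuous_on UNIV (\<lambda>x. soft_pos' \<epsilon> (d x) *\<^sub>R g x)"
    by (intro continuous_on_scaleR continuous_on_compose2[OF continuous_soft_pos' C1_withD(3)[OF assms]] C1_withD(2)[OF assms]) auto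
qed

end

text \<open>The open sets \<open>U\<close> and \<open>-K\<close> cover the space, and the extension
  is \<open>f\<close> on the first and 0 on the second; on the overlap \<open>f\<close> vanishes,
  hence so does its gradient.\<close>

lemma C1_with_extend_zero:
  assumes f: "C1_with f g" and U: "open U" "compact K" "K \<subseteq> U" "\<And>x. x \<in> U - K \<Longrightarrow> f x = 0"
  shows "C1_with (\<lambda>x. if x \<in> U then f x else 0) (\<lambda>x. if x \<in> U then g x else 0)"
proof -
  have oK: "open (-K)" using U(2) compact_imp_closed by auto
  have "open (U - K)" using U(1) oK by (simp add: Diff_eq open_Int)
  then have g0: "g x = 0" if "x \<in> U - K" for x
    by (rule C1_with_zero_grad[OF f]) (use U(4) that in auto)
  show ?thesis
    unfolding C1_with_def
  proof (intro conjI allI)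
    fix x
    show "((\<lambda>x. if x \<in> U then f x else 0) has_derivative (\<lambda>v. (if x \<in> U then g x else 0) \<bullet> v)) (at x)"
    proof (cases "x \<in> U")
      case True
      then have "(f has_derivative (\<lambda>v. (if x \<in> U then g x else 0) \<bullet> v)) (at x)"
        using C1_withD(1)[OF f] by simp
      then show ?thesis
        by (rule has_derivative_transform_within_open[of _ _ _ _ U]) (use True U in auto)
    next
      case False
      then have "((\<lambda>_. 0) has_derivative (\<lambda>v. (if x \<in> U then g x else 0) \<bullet> v)) (at x)"
        by simp
      then show ?thesis
        by (rule has_derivative_transform_within_open[of _ _ _ _ "-K"]) (use False U oK in auto)
    qed
  next
    have "continuous_on U (\<lambda>x. if x \<in> U then g x else 0)"
      by (rule continuous_on_eq[OF continuous_on_subset[OF C1_withD(2)[OF f]]]) auto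
    moreover have "continuous_on (-K) (\<lambda>x. if x \<in> U then g x else 0)"
      by (rule continuous_on_eq[of _ "\<lambda>_. 0"]) (use g0 in auto)
    ultimately have "continuous_on (U \<union> -K) (\<lambda>x. if x \<in> U then g x else 0)"
      using U(1) oK by (intro continuous_on_open_Un)
    moreover have "U \<union> -K = UNIV" using U(3) by auto
    ultimately show "continuous_on UNIV (\<lambda>x. if x \<in> U then g x else 0)" by (simp only:)
  qed
qed

context weak_data
begin

text \<open>There is no boundary term at \<open>t = 0\<close>: as \<open>u\<close> vanishes for negative times, so does the time derivative
  paired with test functions cut off to negative times.\<close>

lemma time_derivative:
  assumes \<psi>: "C1_with \<psi> g\<psi>" "compact K" "K \<subseteq> Om" "\<And>x. x \<notin> K \<Longrightarrow> \<psi> x = 0"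
    and \<sigma>: "\<And>t. (\<sigma> has_real_derivative \<sigma>' t) (at t)" "continuous_on UNIV \<sigma>'"
      "\<And>t. t \<notin> {l..h} \<Longrightarrow> \<sigma> t = 0" "\<And>t. t \<notin> {l..h} \<Longrightarrow> \<sigma>' t = 0" "h < T"
  defines "M \<equiv> restrict_space lborel (Om \<times> {0<..<T})"
  shows "(LINT z|M. snd (G z) * (\<psi> (fst z) * \<sigma> (snd z))) = - (LINT z|M. u z * (\<psi> (fst z) * \<sigma>' (snd z)))"
proof -
  define N where "N = restrict_space lborel (Om \<times> {..<T})"
  let ?\<zeta> = "\<lambda>z. \<psi> (fst z) * \<sigma> (snd z)" and ?\<zeta>' = "\<lambda>z. \<psi> (fst z) * \<sigma>' (snd z)"
  have full: "integrable N (\<lambda>z. snd (G z) * ?\<zeta> z)"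
    "(LINT z|N. snd (G z) * ?\<zeta> z) = - (LINT z|N. u z * ?\<zeta>' z)"
    unfolding N_def
    by (rule time_derivative_full[OF \<psi> \<sigma>(1,2), of l h]; use \<sigma>(3-5) in blast)+
  have [measurable]: "Om \<times> {0<..<T} \<in> sets borel" "Om \<times> {..<T} \<in> sets borel" "Om \<times> {..<0::real} \<in> sets borel"
    by (intro cyl_sets; simp)+
  have sp: "Om \<times> J \<inter> space lborel \<in> sets lborel" if "J \<in> sets borel" for J :: "real set"
    using cyl_sets[OF that] by simp
  have hyper: "{z :: (real^3) \<times> real. snd z = 0} \<in> null_sets lborel"
  proof -
    have "negligible {z :: (real^3) \<times> real. (0, 1) \<bullet> z = 0}" by (rule negligible_hyperplane) (simp add: zero_prod_def)
    then have "{z :: (real^3) \<times> real. (0, 1) \<bullet> z = 0} \<in> null_sets lebesgue"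
      by (simp add: negligible_iff_null_sets)
    moreover have "{z :: (real^3) \<times> real. (0, 1) \<bullet> z = 0} = {z. snd z = 0}"
      by (auto simp: inner_prod_def)
    moreover have "closed {z :: (real^3) \<times> real. snd z = 0}"
      by (intro closed_Collect_eq continuous_intros)
    ultimately show ?thesis by (simp add: null_sets_completion_iff borel_closed)
  qed
  have neg: "(LINT z|N. snd (G z) * ?\<zeta> z * indicator (Om \<times> {..<0::real}) z) = 0"
  proof -
    \<comment> \<open>\<open>\<kappa> m\<close> is 1 up to \<open>-1 / (m + 1)\<close> and 0 from
      time 0 on. So \<open>\<sigma> * \<kappa> m\<close> and its derivative live at negative times,
      where \<open>u\<close> vanishes; letting \<open>m\<close> tend to infinity recovers the
      integral over all negative times.\<close>
    define \<kappa> where "\<kappa> m t = step_down (real (Suc m) * t + 1)" for m t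
    define \<kappa>' where "\<kappa>' m t = step_down' (real (Suc m) * t + 1) * real (Suc m)" for m t
    have \<kappa>d: "(\<kappa> m has_real_derivative \<kappa>' m t) (at t)" for m t
      unfolding \<kappa>_def[abs_def] \<kappa>'_def
      by (rule DERIV_chain2[OF DERIV_step_down]) (auto intro!: derivative_eq_intros)
    have c\<sigma>: "continuous_on UNIV \<sigma>"
      using \<sigma>(1) by (meson DERIV_isCont continuous_at_imp_continuous_on)
    have c\<kappa>: "continuous_on UNIV (\<kappa> m)" "continuous_on UNIV (\<kappa>' m)" for m
      unfolding \<kappa>_def[abs_def] \<kappa>'_def[abs_def]
      by (intro continuous_intros continuous_on_compose2[OF continuous_step_down(1)]
         continuous_on_compose2[OF continuous_step_down(2)]; auto)+
    have zero: "(LINT z|N. snd (G z) * (\<psi> (fst z) * (\<sigma> (snd z) * \<kappa> m (snd z)))) = 0"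
      and int: "integrable N (\<lambda>z. snd (G z) * (\<psi> (fst z) * (\<sigma> (snd z) * \<kappa> m (snd z))))" for m
    proof -
      have d: "((\<lambda>t. \<sigma> t * \<kappa> m t) has_real_derivative \<sigma>' t * \<kappa> m t + \<sigma> t * \<kappa>' m t) (at t)" for t
        using DERIV_mult[OF \<sigma>(1) \<kappa>d] by (simp add: mult.commute)
      have c: "continuous_on UNIV (\<lambda>t. \<sigma>' t * \<kappa> m t + \<sigma> t * \<kappa>' m t)"
        using \<sigma>(2) c\<sigma> c\<kappa> by (intro continuous_on_add continuous_on_mult)
      note * = time_derivative_full[OF \<psi> d c, of l h, folded N_def]
      show "integrable N (\<lambda>z. snd (G z) * (\<psi> (fst z) * (\<sigma> (snd z) * \<kappa> m (snd z))))"
        by (rule *(1)) (use \<sigma>(3-5) in auto)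
      have z0: "u z * (\<psi> (fst z) * (\<sigma>' (snd z) * \<kappa> m (snd z) + \<sigma> (snd z) * \<kappa>' m (snd z))) = 0" for z
      proof (cases "snd z < 0")
        case True then show ?thesis using u_neg by (cases z) auto
      next
        case False
        then have "real (Suc m) * snd z + 1 \<ge> 1" by simp
        then show ?thesis using step_down_right by (simp add: \<kappa>_def \<kappa>'_def)
      qed
      have "(LINT z|N. snd (G z) * (\<psi> (fst z) * (\<sigma> (snd z) * \<kappa> m (snd z)))) =
          - (LINT z|N. u z * (\<psi> (fst z) * (\<sigma>' (snd z) * \<kappa> m (snd z) + \<sigma> (snd z) * \<kappa>' m (snd z))))"
        by (rule *(3)) (use \<sigma>(3-5) in auto)
      then show "(LINT z|N. snd (G z) * (\<psi> (fst z) * (\<sigma> (snd z) * \<kappa> m (snd z)))) = 0"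
        unfolding z0 by simp
    qed
    have "(\<lambda>m. LINT z|N. snd (G z) * (\<psi> (fst z) * (\<sigma> (snd z) * \<kappa> m (snd z))))
       \<longlonglongrightarrow> (LINT z|N. snd (G z) * ?\<zeta> z * indicator (Om \<times> {..<0::real}) z)"
    proof (rule integral_dominated_convergence[where w = "\<lambda>z. norm (snd (G z) * ?\<zeta> z)"])
      show "(\<lambda>z. snd (G z) * ?\<zeta> z * indicator (Om \<times> {..<0::real}) z) \<in> borel_measurable N"
        using borel_measurable_integrable[OF full(1)] unfolding N_def
        by (rule borel_measurable_times) (intro restrict_meas borel_measurable_indicator, simp)
      show "(\<lambda>z. snd (G z) * (\<psi> (fst z) * (\<sigma> (snd z) * \<kappa> m (snd z)))) \<in> borel_measurable N" for m
        using int by (rule borel_measurable_integrable)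
      show "integrable N (\<lambda>z. norm (snd (G z) * ?\<zeta> z))" using full(1) by (rule integrable_norm)
      show "AE z in N. norm (snd (G z) * (\<psi> (fst z) * (\<sigma> (snd z) * \<kappa> m (snd z)))) \<le> norm (snd (G z) * ?\<zeta> z)" for m
      proof (rule AE_I2)
        fix z
        have "\<bar>snd (G z) * ?\<zeta> z\<bar> * \<bar>\<kappa> m (snd z)\<bar> \<le> \<bar>snd (G z) * ?\<zeta> z\<bar> * 1"
          using step_down_bounds by (intro mult_left_mono) (auto simp: \<kappa>_def)
        then show "norm (snd (G z) * (\<psi> (fst z) * (\<sigma> (snd z) * \<kappa> m (snd z)))) \<le> norm (snd (G z) * ?\<zeta> z)"
          by (simp add: abs_mult mult_ac)
      qed
      show "AE z in N. (\<lambda>m. snd (G z) * (\<psi> (fst z) * (\<sigma> (snd z) * \<kappa> m (snd z)))) \<longlonglongrightarrow>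
          snd (G z) * ?\<zeta> z * indicator (Om \<times> {..<0::real}) z"
      proof (rule AE_I2)
        fix z assume "z \<in> space N"
        then have zO: "fst z \<in> Om" by (auto simp: N_def space_restrict_space)
        have "(\<lambda>m. \<kappa> m (snd z)) \<longlonglongrightarrow> indicator (Om \<times> {..<0::real}) z"
        proof (cases "snd z < 0")
          case True
          obtain m0 :: nat where m0: "1 / (- snd z) < real m0" using reals_Archimedean2 by blast
          have "\<kappa> m (snd z) = 1" if "m \<ge> m0" for m
          proof -
            have "1 < real m0 * (- snd z)" 
              by (rule pos_divide_less_eq[THEN iffD1, OF _ m0]) (use True in simp)
            also have "\<dots> \<le> real (Suc m) * (- snd z)" using that True by (intro mult_right_mono) auto
            finally have "real (Suc m) * snd z + 1 \<le> 0" by simp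
            then show ?thesis by (simp add: \<kappa>_def step_down_left)
          qed
          then have "\<forall>\<^sub>F m in sequentially. \<kappa> m (snd z) = 1"
            using eventually_sequentially by auto
          then have "(\<lambda>m. \<kappa> m (snd z)) \<longlonglongrightarrow> 1" by (rule tendsto_eventually)
          then show ?thesis using True zO by (simp add: indicator_def mem_Times_iff)
        next
          case False
          then have "\<kappa> m (snd z) = 0" for m by (simp add: \<kappa>_def step_down_right)
          then show ?thesis using False by (simp add: indicator_def mem_Times_iff)
        qed
        then have "(\<lambda>m. snd (G z) * ?\<zeta> z * \<kappa> m (snd z)) \<longlonglongrightarrow> snd (G z) * ?\<zeta> z * indicator (Om \<times> {..<0::real}) z"
          by (intro tendsto_intros)
        then show "(\<lambda>m. snd (G z) * (\<psi> (fst z) * (\<sigma> (snd z) * \<kappa> m (snd z)))) \<longlonglongrightarrow>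
          snd (G z) * ?\<zeta> z * indicator (Om \<times> {..<0::real}) z" by (simp add: mult_ac)
      qed
    qed
    then show ?thesis using zero by (simp add: LIMSEQ_const_iff)
  qed
  \<comment> \<open>Passing from \<open>{..<T}\<close> to \<open>{0<..<T}\<close> discards the
    negative times and the null set \<open>t = 0\<close>.\<close>
  have split: "(LINT z|M. f z) = (LINT z|N. f z - f z * indicator (Om \<times> {..<0::real}) z)"
    if f: "f \<in> borel_measurable borel" for f :: "(real^3) \<times> real \<Rightarrow> real"
  proof -
    have "(LINT z|M. f z) = (LINT z|lborel. indicator (Om \<times> {0<..<T}) z *\<^sub>R f z)"
      unfolding M_def by (subst integral_restrict_space) (auto simp: sp)
    also have "\<dots> = (LINT z|lborel. indicator (Om \<times> {..<T}) z *\<^sub>R (f z - f z * indicator (Om \<times> {..<0::real}) z))"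
    proof (rule integral_cong_AE)
      show "AE z in lborel. indicator (Om \<times> {0<..<T}) z *\<^sub>R f z =
          indicator (Om \<times> {..<T}) z *\<^sub>R (f z - f z * indicator (Om \<times> {..<0::real}) z)"
        by (rule AE_I'[OF hyper]) (use T in \<open>auto simp: indicator_def\<close>)
    qed (use f in measurable)
    also have "\<dots> = (LINT z|N. f z - f z * indicator (Om \<times> {..<0::real}) z)"
      unfolding N_def by (subst integral_restrict_space) (auto simp: sp)
    finally show ?thesis .
  qed
  have m1: "(\<lambda>z. snd (G z) * ?\<zeta> z) \<in> borel_measurable borel" and m2: "(\<lambda>z. u z * ?\<zeta>' z) \<in> borel_measurable borel"
  proof -
    note \<zeta> = C1_with_prod[OF \<psi>(1) \<sigma>(1,2)]
    have [measurable]: "?\<zeta> \<in> borel_measurable borel" "?\<zeta>' \<in> borel_measurable borel"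
      using C1_withD(3)[OF \<zeta>] continuous_on_snd[OF C1_withD(2)[OF \<zeta>]] by (auto intro: borel_measurable_continuous_onI)
    have [measurable]: "snd \<in> borel_measurable (borel :: ((real^3) \<times> real) measure)"
      by (auto intro!: borel_measurable_continuous_onI continuous_intros)
    show "(\<lambda>z. snd (G z) * ?\<zeta> z) \<in> borel_measurable borel" "(\<lambda>z. u z * ?\<zeta>' z) \<in> borel_measurable borel"
      by measurable
  qed
  have "(LINT z|M. snd (G z) * ?\<zeta> z) = (LINT z|N. snd (G z) * ?\<zeta> z)"
  proof -
    have "integrable N (\<lambda>z. snd (G z) * ?\<zeta> z * indicator (Om \<times> {..<0::real}) z)"
      by (rule Bochner_Integration.integrable_bound[OF full(1)])
        (use m1 in \<open>auto simp: N_def indicator_def intro!: restrict_meas borel_measurable_times\<close>)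
    then show ?thesis unfolding split[OF m1] using full(1) neg by simp
  qed
  also have "\<dots> = - (LINT z|N. u z * ?\<zeta>' z)" by (rule full(2))
  also have "(LINT z|N. u z * ?\<zeta>' z) = (LINT z|M. u z * ?\<zeta>' z)"
  proof -
    have z0: "u z * ?\<zeta>' z * indicator (Om \<times> {..<0::real}) z = 0" for z
      using u_neg by (cases z) (auto simp: indicator_def)
    show ?thesis unfolding split[OF m2] z0 by simp
  qed
  finally show ?thesis .
qed

end



text \<open>The support may start at \<open>-1\<close>: test functions need compact support in time,
  but only positive times are integrated over. The plateau contains 0, so the initial velocity
  enters with weight 1; it ends at \<open>a\<close>, so the cutoff acts only where the exponential
  is at most \<open>exp (- \<tau> a)\<close>.\<close>

definition is_cutoff :: "real \<Rightarrow> real \<Rightarrow> (real \<Rightarrow> real) \<Rightarrow> (real \<Rightarrow> real) \<Rightarrow> (real \<Rightarrow> real) \<Rightarrow> real \<Rightarrow> bool" where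
  "is_cutoff a h \<theta> \<theta>' \<theta>'' B \<longleftrightarrow>
     (\<forall>t. (\<theta> has_real_derivative \<theta>' t) (at t)) \<and> (\<forall>t. (\<theta>' has_real_derivative \<theta>'' t) (at t)) \<and>
     continuous_on UNIV \<theta>'' \<and>
     (\<forall>t. t \<notin> {-1..h} \<longrightarrow> \<theta> t = 0 \<and> \<theta>' t = 0 \<and> \<theta>'' t = 0) \<and>
     (\<forall>t. 0 \<le> t \<and> t \<le> a \<longrightarrow> \<theta> t = 1 \<and> \<theta>' t = 0 \<and> \<theta>'' t = 0) \<and>
     (\<forall>t. \<bar>\<theta> t\<bar> \<le> B \<and> \<bar>\<theta>' t\<bar> \<le> B \<and> \<bar>\<theta>'' t\<bar> \<le> B)"

lemma cutoff_exists:
  assumes "0 \<le> a" "a < T"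
  obtains \<theta> \<theta>' \<theta>'' h B where "is_cutoff a h \<theta> \<theta>' \<theta>'' B" "h < T" "B \<ge> 0"
proof -
  define d where "d = (T - a) / 2"
  have d: "d > 0" "a + d < T" using assms by (auto simp: d_def field_simps)
  define \<theta> where "\<theta> t = step_down ((t - a) / d) * step_down (- t)" for t
  define \<theta>' where "\<theta>' t = step_down' ((t - a) / d) / d * step_down (- t) - step_down ((t - a) / d) * step_down' (- t)" for t
  define \<theta>'' where "\<theta>'' t = step_down'' ((t - a) / d) / d\<^sup>2 * step_down (- t)
      - 2 * (step_down' ((t - a) / d) / d) * step_down' (- t) + step_down ((t - a) / d) * step_down'' (- t)" for t
  have r: "step_down'' s = 0" if "s \<ge> 1" for s
  proof -
    have "1 \<le> max 0 s ^ 3" using that by (intro one_le_power) simp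
    then have "max 0 (1 - max 0 s ^ 3) = 0" by linarith
    then show ?thesis by (simp add: step_down''_def)
  qed
  have lin: "((\<lambda>t. (t - a) / d) has_real_derivative 1 / d) (at t)" "((\<lambda>t. - t) has_real_derivative -1) (at t)" for t
    using d by (auto intro!: derivative_eq_intros)
  have d1: "((\<lambda>t. step_down ((t - a) / d)) has_real_derivative step_down' ((t - a) / d) / d) (at t)" for t
    using DERIV_chain2[of step_down, OF DERIV_step_down lin(1)] by simp
  have d2: "((\<lambda>t. step_down' ((t - a) / d)) has_real_derivative step_down'' ((t - a) / d) / d) (at t)" for t
    using DERIV_chain2[of step_down', OF DERIV_step_down' lin(1)] by simp
  have d3: "((\<lambda>t. step_down (- t)) has_real_derivative - step_down' (- t)) (at t)" for t
    using DERIV_chain2[of step_down, OF DERIV_step_down lin(2)] by simp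
  have d4: "((\<lambda>t. step_down' (- t)) has_real_derivative - step_down'' (- t)) (at t)" for t
    using DERIV_chain2[of step_down', OF DERIV_step_down' lin(2)] by simp
  have 1: "(\<theta> has_real_derivative \<theta>' t) (at t)" for t
    unfolding \<theta>_def[abs_def] \<theta>'_def by (rule derivative_eq_intros d1 d3 refl)+ simp
  have 2: "(\<theta>' has_real_derivative \<theta>'' t) (at t)" for t
    unfolding \<theta>'_def[abs_def] \<theta>''_def
    by (rule DERIV_cong[OF DERIV_diff[OF DERIV_mult[OF DERIV_cdivide[OF d2, of d] d3] DERIV_mult[OF d1 d4]]])
      (use d in \<open>simp add: field_simps power2_eq_square\<close>)
  have 3: "continuous_on UNIV \<theta>''"
    unfolding \<theta>''_def[abs_def]
    by (intro continuous_intros continuous_on_compose2[OF continuous_step_down(1)]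
       continuous_on_compose2[OF continuous_step_down(2)] continuous_on_compose2[OF continuous_step_down(3)]) (use d in auto)
  have 4: "\<theta> t = 0 \<and> \<theta>' t = 0 \<and> \<theta>'' t = 0" if "t \<notin> {-1..a + d}" for t
  proof (cases "t < -1")
    case True
    then show ?thesis by (simp add: \<theta>_def \<theta>'_def \<theta>''_def step_down_right r)
  next
    case False
    then have "(t - a) / d \<ge> 1" using that d by (simp add: field_simps)
    then show ?thesis by (simp add: \<theta>_def \<theta>'_def \<theta>''_def step_down_right r)
  qed
  have 5: "\<theta> t = 1 \<and> \<theta>' t = 0 \<and> \<theta>'' t = 0" if "0 \<le> t" "t \<le> a" for t
  proof -
    have "(t - a) / d \<le> 0" "- t \<le> 0" using that d by (auto simp: divide_le_0_iff)
    then show ?thesis by (simp add: \<theta>_def \<theta>'_def \<theta>''_def step_down_left)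
  qed
  have bd: "\<exists>B. \<forall>t. \<bar>f t\<bar> \<le> B" if f: "continuous_on UNIV f" "\<And>t. t \<notin> {-1..a + d} \<Longrightarrow> f t = 0" for f :: "real \<Rightarrow> real"
  proof -
    have "bounded (f ` {-1..a + d})"
      by (intro compact_imp_bounded compact_continuous_image) (auto intro: continuous_on_subset[OF f(1)])
    then obtain B where B: "\<And>t. t \<in> {-1..a + d} \<Longrightarrow> \<bar>f t\<bar> \<le> B" unfolding bounded_iff real_norm_def by (metis imageI)
    have "\<bar>f t\<bar> \<le> max B 0" for t using B[of t] f(2)[of t] by (cases "t \<in> {-1..a + d}") (auto simp: le_max_iff_disj)
    then show ?thesis by blast
  qed
  have c: "continuous_on UNIV \<theta>" "continuous_on UNIV \<theta>'"
    using 1 2 by (meson DERIV_isCont continuous_at_imp_continuous_on)+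
  obtain B1 where B1: "\<And>t. \<bar>\<theta> t\<bar> \<le> B1" using bd[OF c(1)] 4 by blast
  obtain B2 where B2: "\<And>t. \<bar>\<theta>' t\<bar> \<le> B2" using bd[OF c(2)] 4 by blast
  obtain B3 where B3: "\<And>t. \<bar>\<theta>'' t\<bar> \<le> B3" using bd[OF 3] 4 by blast
  define B where "B = max B1 (max B2 B3)"
  have 6: "\<bar>\<theta> t\<bar> \<le> B \<and> \<bar>\<theta>' t\<bar> \<le> B \<and> \<bar>\<theta>'' t\<bar> \<le> B" for t
    using B1[of t] B2[of t] B3[of t] by (auto simp: B_def)
  have "B \<ge> 0" using 6[of 0] by (meson abs_ge_zero order_trans)
  then show ?thesis
    using that[of "a + d" \<theta> \<theta>' \<theta>'' B] 1 2 3 4 5 6 d(2) unfolding is_cutoff_def by blast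
qed

section \<open>The truncated transform and comparison with barriers for one obstacle\<close>

definition laplace :: "(real \<Rightarrow> real) \<Rightarrow> real \<Rightarrow> real \<Rightarrow> ((real^3) \<times> real \<Rightarrow> real) \<Rightarrow> real^3 \<Rightarrow> real" where
  "laplace \<theta> T \<tau> \<phi> x = integral {0..T} (\<lambda>t. \<theta> t * exp (- (\<tau> * t)) * \<phi> (x, t))"

definition weak_wave_eq :: "(real^3) set \<Rightarrow> (real^3 \<Rightarrow> real) \<Rightarrow> real \<Rightarrow> ((real^3) \<times> real \<Rightarrow> (real^3) \<times> real) \<Rightarrow> bool" where
  "weak_wave_eq D f T G \<longleftrightarrow> (\<forall>\<eta>. C1_fun \<eta> \<and> compact (tsupp \<eta>) \<and> tsupp \<eta> \<subseteq> (- closure D) \<times> {..<T} \<longrightarrow>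
     (LINT z : (- closure D) \<times> {0<..<T} | lborel.
        snd (G z) * snd (st_grad \<eta> z) - fst (G z) \<bullet> fst (st_grad \<eta> z))
     + (LINT x : (- closure D) | lborel. f x * \<eta> (x, 0)) = 0)"

text \<open>Nonnegativity matters because barriers are only sub- or supersolutions: their
  inequalities hold against nonnegative functions.\<close>

definition test_fun :: "(real^3) set \<Rightarrow> (real^3 \<Rightarrow> real) \<Rightarrow> (real^3 \<Rightarrow> real^3) \<Rightarrow> bool" where
  "test_fun U \<psi> g \<longleftrightarrow> C1_with \<psi> g \<and> (\<forall>x. \<psi> x \<ge> 0) \<and> (\<exists>K. compact K \<and> K \<subseteq> U \<and> (\<forall>x. x \<notin> K \<longrightarrow> \<psi> x = 0))"

context weak_data
begin

lemma u_square_integrable: "integrable (restrict_space lborel (Om \<times> {0<..<T})) (\<lambda>z. (u z)\<^sup>2)"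
  and \<phi>_time_supp: "\<exists>K. compact K \<and> K \<subseteq> Om \<and> (\<forall>x t. x \<notin> K \<longrightarrow> \<phi> n (x, t) = 0)"
proof -
  let ?M = "restrict_space lborel (Om \<times> {0<..<T})"
  have K: "compact (fst ` tsupp (\<phi> n))" "fst ` tsupp (\<phi> n) \<subseteq> Om" "x \<notin> fst ` tsupp (\<phi> n) \<Longrightarrow> \<phi> n (x, t) = 0" for n x t
  proof -
    show "compact (fst ` tsupp (\<phi> n))" by (rule compact_continuous_image[OF _ \<phi>_cpt]) (intro continuous_intros)
    show "fst ` tsupp (\<phi> n) \<subseteq> Om" using \<phi>_supp[of n] by (auto simp: Om_def)
    assume "x \<notin> fst ` tsupp (\<phi> n)"
    then have "(x, t) \<notin> {z. \<phi> n z \<noteq> 0}" using closure_subset[of "{z. \<phi> n z \<noteq> 0}"] unfolding tsupp_def by force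
    then show "\<phi> n (x, t) = 0" by simp
  qed
  then show "\<exists>K. compact K \<and> K \<subseteq> Om \<and> (\<forall>x t. x \<notin> K \<longrightarrow> \<phi> n (x, t) = 0)"
    by (intro exI[of _ "fst ` tsupp (\<phi> n)"] conjI allI impI)
  have i: "integrable ?M (\<lambda>z. (\<phi> n z)\<^sup>2)" for n
  proof (rule integrable_restrict_cylinder[OF _ K(1)[of n], where l = 0 and h = T])
    show "continuous_on UNIV (\<lambda>z. (\<phi> n z)\<^sup>2)"
      by (intro continuous_on_power C1_withD(3)[OF \<phi>_C1_with])
  qed (use K(3)[of _ n] Om_open in auto)
  have "integrable ?M (\<lambda>z. 2 * (\<phi> 0 z)\<^sup>2 + 2 * err 0 z)"
    by (intro Bochner_Integration.integrable_add integrable_mult_right i err_int(1)) auto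
  then show "integrable ?M (\<lambda>z. (u z)\<^sup>2)"
  proof (rule Bochner_Integration.integrable_bound)
    show "(\<lambda>z. (u z)\<^sup>2) \<in> borel_measurable ?M" by (intro restrict_meas) measurable
    have "(u z)\<^sup>2 \<le> 2 * (\<phi> 0 z)\<^sup>2 + 2 * err 0 z" for z
    proof -
      have "(u z)\<^sup>2 \<le> 2 * (\<phi> 0 z)\<^sup>2 + 2 * (\<phi> 0 z - u z)\<^sup>2"
        using zero_le_power2[of "2 * \<phi> 0 z - u z"] by (simp add: power2_eq_square algebra_simps)
      also have "\<dots> \<le> 2 * (\<phi> 0 z)\<^sup>2 + 2 * err 0 z" by (simp add: err_def)
      finally show ?thesis .
    qed
    then show "AE z in ?M. norm ((u z)\<^sup>2) \<le> norm (2 * (\<phi> 0 z)\<^sup>2 + 2 * err 0 z)"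
      by (intro AE_I2) (simp add: order_trans[OF _ abs_ge_self])
  qed
qed

text \<open>The weak maximum principle, quantitatively: testing with \<open>\<psi> x * \<theta> t * exp (- \<tau> t)\<close>, the cutoff at time \<open>a\<close> costs
  \<open>exp (- \<tau> a)\<close>, and all remaining errors are absorbed by the energy of \<open>\<psi>\<close> or vanish with \<open>e n\<close>. The sign \<open>sg\<close> treats
  supersolutions and subsolutions at once.\<close>

lemma comparison_single:
  fixes f :: "real^3 \<Rightarrow> real" and n :: nat
  assumes weak: "weak_wave_eq D f T G"
    and cut: "is_cutoff a h \<theta> \<theta>' \<theta>'' B" "h < T" "B \<ge> 0" and a: "0 \<le> a"
    and \<tau>: "\<tau> \<ge> 1" and sg: "sg = 1 \<or> sg = -1" and eps: "\<epsilon> > 0"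
    and k: "C1_with k gk" "compact K0" "K0 \<subseteq> Om" "\<And>x. x \<in> Om - K0 \<Longrightarrow> sg * k x \<ge> 0"
    and super: "\<And>\<psi> g\<psi>. test_fun Om \<psi> g\<psi> \<Longrightarrow> integrable lborel (\<lambda>x. gk x \<bullet> g\<psi> x + \<tau>\<^sup>2 * k x * \<psi> x) \<and>
        sg * (LINT x|lborel. f x * \<psi> x) \<le> sg * (LINT x|lborel. gk x \<bullet> g\<psi> x + \<tau>\<^sup>2 * k x * \<psi> x)"
  defines "\<psi> \<equiv> \<lambda>x. if x \<in> Om then soft_pos \<epsilon> (sg * (laplace \<theta> T \<tau> (\<phi> n) x - k x)) else 0"
  defines "b \<equiv> B * (1 + 2 * \<tau>) * exp (- (\<tau> * a))"
  shows "integrable lborel (\<lambda>x. (\<psi> x)\<^sup>2)"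
    and "(LINT x|lborel. (\<psi> x)\<^sup>2) \<le> 2 * T * (B\<^sup>2 + (B * (1 + 2 * \<tau> + \<tau>\<^sup>2))\<^sup>2 + 2 * b\<^sup>2) * e n
       + 4 * T * b\<^sup>2 * (LINT z|restrict_space lborel (Om \<times> {0<..<T}). (u z)\<^sup>2)"
proof -
  define M where "M = restrict_space lborel (Om \<times> {0<..<T})"
  have J: "{0<..<T} \<subseteq> {..<T}" "{0<..<T} \<in> sets borel" by auto
  define \<rho> where "\<rho> t = \<theta> t * exp (- (\<tau> * t))" for t
  define \<rho>' where "\<rho>' t = (\<theta>' t - \<tau> * \<theta> t) * exp (- (\<tau> * t))" for t
  define \<rho>'' where "\<rho>'' t = (\<theta>'' t - 2 * \<tau> * \<theta>' t + \<tau>\<^sup>2 * \<theta> t) * exp (- (\<tau> * t))" for t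
  have \<theta>: "\<And>t. (\<theta> has_real_derivative \<theta>' t) (at t)" "\<And>t. (\<theta>' has_real_derivative \<theta>'' t) (at t)" "continuous_on UNIV \<theta>''"
    "\<And>t. t \<notin> {-1..h} \<Longrightarrow> \<theta> t = 0" "\<And>t. t \<notin> {-1..h} \<Longrightarrow> \<theta>' t = 0" "\<And>t. t \<notin> {-1..h} \<Longrightarrow> \<theta>'' t = 0"
    "\<And>t. 0 \<le> t \<Longrightarrow> t \<le> a \<Longrightarrow> \<theta> t = 1" "\<And>t. 0 \<le> t \<Longrightarrow> t \<le> a \<Longrightarrow> \<theta>' t = 0" "\<And>t. 0 \<le> t \<Longrightarrow> t \<le> a \<Longrightarrow> \<theta>'' t = 0"
    "\<And>t. \<bar>\<theta> t\<bar> \<le> B" "\<And>t. \<bar>\<theta>' t\<bar> \<le> B" "\<And>t. \<bar>\<theta>'' t\<bar> \<le> B"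
    using cut(1) unfolding is_cutoff_def by blast+
  have d\<rho>: "(\<rho> has_real_derivative \<rho>' t) (at t)" for t
    unfolding \<rho>_def[abs_def] \<rho>'_def by (rule derivative_eq_intros \<theta>(1) refl)+ (simp add: algebra_simps)
  have d\<rho>': "(\<rho>' has_real_derivative \<rho>'' t) (at t)" for t
    unfolding \<rho>'_def[abs_def] \<rho>''_def
    by (rule derivative_eq_intros \<theta>(1,2) refl)+ (simp add: algebra_simps power2_eq_square)
  have c\<theta>: "continuous_on UNIV \<theta>" "continuous_on UNIV \<theta>'"
    using \<theta>(1,2) by (meson DERIV_isCont continuous_at_imp_continuous_on)+
  have c\<rho>: "continuous_on UNIV \<rho>" "continuous_on UNIV \<rho>'" "continuous_on UNIV \<rho>''"
    unfolding \<rho>_def[abs_def] \<rho>'_def[abs_def] \<rho>''_def[abs_def] by (intro continuous_intros c\<theta> \<theta>(3))+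
  have s\<rho>: "\<rho> t = 0" "\<rho>' t = 0" "\<rho>'' t = 0" if "t \<notin> {-1..h}" for t
    using \<theta>(4-6)[OF that] by (auto simp: \<rho>_def \<rho>'_def \<rho>''_def)
  have bd1: "\<bar>\<rho> t\<bar> \<le> B" if "t > 0" for t
  proof -
    have "\<bar>\<theta> t\<bar> * exp (- (\<tau> * t)) \<le> B * 1" using \<theta>(10) that \<tau> cut(3) by (intro mult_mono) auto
    then show ?thesis by (simp add: \<rho>_def abs_mult)
  qed
  have bd2: "\<bar>\<rho>'' t\<bar> \<le> B * (1 + 2 * \<tau> + \<tau>\<^sup>2)" if "t > 0" for t
  proof -
    have "\<bar>\<theta>'' t - 2 * \<tau> * \<theta>' t + \<tau>\<^sup>2 * \<theta> t\<bar> \<le> \<bar>\<theta>'' t\<bar> + 2 * \<tau> * \<bar>\<theta>' t\<bar> + \<tau>\<^sup>2 * \<bar>\<theta> t\<bar>"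
      using \<tau> abs_triangle_ineq[of "\<theta>'' t - 2 * \<tau> * \<theta>' t" "\<tau>\<^sup>2 * \<theta> t"] abs_triangle_ineq4[of "\<theta>'' t" "2 * \<tau> * \<theta>' t"]
      by (simp add: abs_mult)
    also have "\<dots> \<le> B + 2 * \<tau> * B + \<tau>\<^sup>2 * B"
      using \<theta>(10-12)[of t] \<tau> by (intro add_mono mult_left_mono) auto
    finally have "\<bar>\<theta>'' t - 2 * \<tau> * \<theta>' t + \<tau>\<^sup>2 * \<theta> t\<bar> * exp (- (\<tau> * t)) \<le> (B + 2 * \<tau> * B + \<tau>\<^sup>2 * B) * 1"
      using that \<tau> cut(3) by (intro mult_mono) auto
    moreover have "\<bar>\<rho>'' t\<bar> = \<bar>\<theta>'' t - 2 * \<tau> * \<theta>' t + \<tau>\<^sup>2 * \<theta> t\<bar> * exp (- (\<tau> * t))"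
      by (simp add: \<rho>''_def abs_mult)
    moreover have "B * (1 + 2 * \<tau> + \<tau>\<^sup>2) = (B + 2 * \<tau> * B + \<tau>\<^sup>2 * B) * 1" by (simp add: algebra_simps)
    ultimately show ?thesis by (simp only:)
  qed
  \<comment> \<open>\<open>\<tau>\<^sup>2 * \<rho> - \<rho>''\<close> measures how far the truncated
    exponential is from solving \<open>\<rho>'' = \<tau>\<^sup>2 \<rho>\<close>. It is 0 on the
    plateau, and beyond it every term carries a factor of at most
    \<open>exp (- (\<tau> * a))\<close>.\<close>
  have bd3: "\<bar>\<tau>\<^sup>2 * \<rho> t - \<rho>'' t\<bar> \<le> b" if "t > 0" for t
  proof (cases "t \<le> a")
    case True
    then have "\<tau>\<^sup>2 * \<rho> t - \<rho>'' t = 0" using \<theta>(7-9)[of t] that by (simp add: \<rho>_def \<rho>''_def)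
    then show ?thesis using \<tau> cut(3) by (simp add: b_def)
  next
    case False
    have e1: "\<tau>\<^sup>2 * \<rho> t - \<rho>'' t = (2 * \<tau> * \<theta>' t - \<theta>'' t) * exp (- (\<tau> * t))"
      by (simp add: \<rho>_def \<rho>''_def algebra_simps)
    have "\<bar>2 * \<tau> * \<theta>' t - \<theta>'' t\<bar> \<le> 2 * \<tau> * \<bar>\<theta>' t\<bar> + \<bar>\<theta>'' t\<bar>"
      using \<tau> abs_triangle_ineq4[of "2 * \<tau> * \<theta>' t" "\<theta>'' t"] by (simp add: abs_mult)
    also have "\<dots> \<le> 2 * \<tau> * B + B" using \<theta>(11,12)[of t] \<tau> by (intro add_mono mult_left_mono) auto
    finally have "\<bar>2 * \<tau> * \<theta>' t - \<theta>'' t\<bar> * exp (- (\<tau> * t)) \<le> (2 * \<tau> * B + B) * exp (- (\<tau> * a))"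
      using False \<tau> cut(3) by (intro mult_mono) auto
    moreover have "b = (2 * \<tau> * B + B) * exp (- (\<tau> * a))" by (simp add: b_def algebra_simps)
    ultimately show ?thesis unfolding e1 by (simp add: abs_mult)
  qed

  define W where "W = laplace \<theta> T \<tau> (\<phi> n)"
  define gW where "gW x = integral {0..T} (\<lambda>t. \<rho> t *\<^sub>R fst (st_grad (\<phi> n) (x, t)))" for x
  have WC: "C1_with W gW"
    using C1_with_time_average[OF \<phi>_C1_with c\<rho>(1), of T n]
    unfolding W_def gW_def[abs_def] laplace_def[abs_def] \<rho>_def .
  obtain K1 where K1: "compact K1" "K1 \<subseteq> Om" "\<And>x t. x \<notin> K1 \<Longrightarrow> \<phi> n (x, t) = 0"
    using \<phi>_time_supp by blast
  have W0: "W x = 0" if "x \<notin> K1" for x using K1(3)[OF that] by (simp add: W_def laplace_def)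
  define d where "d x = sg * (W x - k x)" for x
  define gd where "gd x = sg *\<^sub>R (gW x - gk x)" for x
  have dC: "C1_with d gd"
    unfolding C1_with_def d_def gd_def
    using C1_withD[OF WC] C1_withD[OF k(1)]
    by (auto intro!: derivative_eq_intros continuous_intros simp: inner_simps)
  define K where "K = K0 \<union> K1"
  have K: "compact K" "K \<subseteq> Om" using K1 k by (auto simp: K_def)
  \<comment> \<open>This gives \<open>\<psi>\<close> compact support in the exterior: off
    \<open>K1\<close> the transform vanishes and off \<open>K0\<close> the barrier has the right
    sign, so \<open>d \<le> 0\<close> off both.\<close>
  have d0: "soft_pos \<epsilon> (d x) = 0" if "x \<in> Om - K" for x
    using that W0[of x] k(4)[of x] by (intro soft_pos_nonpos) (auto simp: K_def d_def eps)
  define g\<psi> where "g\<psi> x = (if x \<in> Om then soft_pos' \<epsilon> (d x) *\<^sub>R gd x else 0)" for x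
  have \<psi>_eq: "\<psi> = (\<lambda>x. if x \<in> Om then soft_pos \<epsilon> (d x) else 0)"
    unfolding \<psi>_def d_def W_def ..
  have \<psi>C: "C1_with \<psi> g\<psi>"
    unfolding \<psi>_eq g\<psi>_def[abs_def]
    by (rule C1_with_extend_zero[OF C1_with_soft_pos[OF eps dC] Om_open K d0])
  have \<psi>0: "\<psi> x = 0" if "x \<notin> K" for x using d0[of x] that by (auto simp: \<psi>_eq)
  have g\<psi>0: "g\<psi> x = 0" if "x \<notin> K" for x
    by (rule C1_with_zero_grad[OF \<psi>C open_Compl[OF compact_imp_closed[OF K(1)]]]) (use \<psi>0 that in auto)
  have tf: "test_fun Om \<psi> g\<psi>"
  proof -
    have "\<psi> x \<ge> 0" for x using soft_pos_nonneg[OF eps] by (simp add: \<psi>_eq)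
    then show ?thesis unfolding test_fun_def using \<psi>C \<psi>0 K by blast
  qed
  have c\<psi>: "continuous_on UNIV (\<lambda>z::(real^3) \<times> real. \<psi> (fst z))" "continuous_on UNIV (\<lambda>z::(real^3) \<times> real. g\<psi> (fst z))"
    by (rule continuous_on_compose2[OF C1_withD(3)[OF \<psi>C]] continuous_on_compose2[OF C1_withD(2)[OF \<psi>C]];
        auto intro!: continuous_intros)+
  have c\<rho>z: "continuous_on UNIV (\<lambda>z::(real^3) \<times> real. \<rho> (snd z))" "continuous_on UNIV (\<lambda>z::(real^3) \<times> real. \<rho>' (snd z))"
     "continuous_on UNIV (\<lambda>z::(real^3) \<times> real. \<rho>'' (snd z))"
    by (rule continuous_on_compose2[OF c\<rho>(1)] continuous_on_compose2[OF c\<rho>(2)] continuous_on_compose2[OF c\<rho>(3)];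
        auto intro!: continuous_intros)+
  have c\<phi>: "continuous_on UNIV (\<phi> n)" "continuous_on UNIV (\<lambda>z. fst (st_grad (\<phi> n) z))" "continuous_on UNIV (\<lambda>z. snd (st_grad (\<phi> n) z))"
    using C1_withD(2,3)[OF \<phi>_C1_with] by (auto intro!: continuous_intros)
  have cyl: "integrable M g" if "continuous_on UNIV g" "\<And>x t. x \<notin> K \<Longrightarrow> g (x, t) = 0" for g :: "(real^3) \<times> real \<Rightarrow> real"
    unfolding M_def by (rule integrable_restrict_cylinder[OF that(1) K(1) that(2), where l = 0 and h = T]) (use Om_open in auto)
  have bm: "g \<in> borel_measurable borel" if "continuous_on UNIV g" for g :: "(real^3) \<times> real \<Rightarrow> 'b::second_countable_topology"
    using that by (rule borel_measurable_continuous_onI)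
  \<comment> \<open>The wave equation tested with \<open>\<psi> x * \<rho> t\<close>; the initial
    term keeps its full weight because \<open>\<rho> 0 = 1\<close>.\<close>
  have E1: "(LINT z|M. snd (G z) * (\<psi> (fst z) * \<rho>' (snd z)) - fst (G z) \<bullet> (\<rho> (snd z) *\<^sub>R g\<psi> (fst z)))
     + (LINT x|lborel. f x * \<psi> x) = 0"
  proof -
    let ?\<eta> = "\<lambda>z. \<psi> (fst z) * \<rho> (snd z)"
    note P = C1_with_prod[OF \<psi>C d\<rho> c\<rho>(2)]
    have "tsupp ?\<eta> \<subseteq> K \<times> {-1..h}" "compact (tsupp ?\<eta>)"
      by (rule tsupp_prod[OF K(1)]; use \<psi>0 s\<rho> in blast)+
    moreover have "K \<times> {-1..h} \<subseteq> Om \<times> {..<T}" using cut(2) K(2) by auto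
    ultimately have "(LINT z : Om \<times> {0<..<T} | lborel. snd (G z) * snd (st_grad ?\<eta> z) - fst (G z) \<bullet> fst (st_grad ?\<eta> z))
       + (LINT x : Om | lborel. f x * ?\<eta> (x, 0)) = 0"
      unfolding Om_def using weak C1_with_imp_C1_fun[OF P] unfolding weak_wave_eq_def by blast
    moreover have "\<rho> 0 = 1" using \<theta>(7)[of 0] a by (simp add: \<rho>_def)
    moreover have "(LINT x : Om | lborel. f x * \<psi> x) = (LINT x|lborel. f x * \<psi> x)"
      unfolding set_lebesgue_integral_def
      by (rule Bochner_Integration.integral_cong) (auto simp: \<psi>_eq)
    moreover have "(LINT z|M. g z) = (LINT z : Om \<times> {0<..<T} | lborel. g z)" for g :: "(real^3) \<times> real \<Rightarrow> real"
      unfolding M_def set_lebesgue_integral_def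
      by (subst integral_restrict_space) (use cyl_sets[of "{0<..<T}"] in auto)
    ultimately show ?thesis by (simp add: C1_with_imp_st_grad[OF P])
  qed
  \<comment> \<open>A second integration by parts moves the other time derivative onto the test
    function, so \<open>u\<close> satisfies a Helmholtz equation with \<open>\<rho>''\<close> in
    place of \<open>\<tau>\<^sup>2 * \<rho>\<close>.\<close>
  have E2: "(LINT z|M. snd (G z) * (\<psi> (fst z) * \<rho>' (snd z))) = - (LINT z|M. u z * (\<psi> (fst z) * \<rho>'' (snd z)))"
    unfolding M_def
    by (rule time_derivative[OF \<psi>C K _ d\<rho>' c\<rho>(3), of "-1" h]) (use \<psi>0 s\<rho> cut(2) in blast)+
  define b1 where "b1 z = \<rho> (snd z) *\<^sub>R g\<psi> (fst z)" for z :: "(real^3) \<times> real"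
  define b2 where "b2 z = \<psi> (fst z) * \<rho>' (snd z)" for z :: "(real^3) \<times> real"
  define b3 where "b3 z = \<psi> (fst z) * \<rho>'' (snd z)" for z :: "(real^3) \<times> real"
  have cb: "continuous_on UNIV b1" "continuous_on UNIV b2" "continuous_on UNIV b3"
    unfolding b1_def[abs_def] b2_def[abs_def] b3_def[abs_def]
    by (intro continuous_on_scaleR continuous_on_mult c\<rho>z c\<psi>)+
  have b0: "b1 (x, t) = 0" "b2 (x, t) = 0" "b3 (x, t) = 0" if "x \<notin> K" for x t
    using \<psi>0[OF that] g\<psi>0[OF that] by (auto simp: b1_def b2_def b3_def)
  have sqb: "integrable M (\<lambda>z. (norm (b1 z))\<^sup>2)" "integrable M (\<lambda>z. (b2 z)\<^sup>2)" "integrable M (\<lambda>z. (b3 z)\<^sup>2)"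
    by (rule cyl; use cb b0 in \<open>auto intro!: continuous_on_power continuous_on_norm\<close>)+
  have Q: "integrable M (\<lambda>z. (\<phi> n z - u z) * b3 z)"
     "integrable M (\<lambda>z. snd (st_grad (\<phi> n) z - G z) * b2 z)"
     "integrable M (\<lambda>z. fst (st_grad (\<phi> n) z - G z) \<bullet> b1 z)"
    using err_products[OF J bm[OF cb(1)] sqb(1)[unfolded M_def] bm[OF cb(2)] sqb(2)[unfolded M_def]]
      err_products[OF J bm[OF cb(1)] sqb(1)[unfolded M_def] bm[OF cb(3)] sqb(3)[unfolded M_def]]
    unfolding M_def by auto
  have P: "integrable M (\<lambda>z. \<phi> n z * b3 z)" "integrable M (\<lambda>z. snd (st_grad (\<phi> n) z) * b2 z)"
     "integrable M (\<lambda>z. fst (st_grad (\<phi> n) z) \<bullet> b1 z)" "integrable M (\<lambda>z. \<tau>\<^sup>2 * \<rho> (snd z) * \<phi> n z * \<psi> (fst z))"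
    by (rule cyl; use cb b0 \<psi>0 in \<open>auto intro!: continuous_on_mult continuous_on_inner c\<phi> c\<rho>z c\<psi> continuous_on_const\<close>)+
  have I: "integrable M (\<lambda>z. u z * b3 z)" "integrable M (\<lambda>z. snd (G z) * b2 z)" "integrable M (\<lambda>z. fst (G z) \<bullet> b1 z)"
    using Bochner_Integration.integrable_diff[OF P(1) Q(1)] Bochner_Integration.integrable_diff[OF P(2) Q(2)]
      Bochner_Integration.integrable_diff[OF P(3) Q(3)]
    by (auto simp: algebra_simps inner_diff_left)
  have E3: "(LINT z|M. u z * b3 z + fst (G z) \<bullet> b1 z) = (LINT x|lborel. f x * \<psi> x)"
    using E1 E2 I unfolding b1_def[symmetric] b2_def[symmetric] b3_def[symmetric] by simp
  have E4: "(LINT z|M. fst (st_grad (\<phi> n) z) \<bullet> b1 z + \<tau>\<^sup>2 * \<rho> (snd z) * \<phi> n z * \<psi> (fst z))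
       = (LINT x|lborel. gW x \<bullet> g\<psi> x + \<tau>\<^sup>2 * W x * \<psi> x)"
    and iW: "integrable lborel (\<lambda>x. gW x \<bullet> g\<psi> x + \<tau>\<^sup>2 * W x * \<psi> x)"
  proof -
    let ?g = "\<lambda>z. fst (st_grad (\<phi> n) z) \<bullet> b1 z + \<tau>\<^sup>2 * \<rho> (snd z) * \<phi> n z * \<psi> (fst z)"
    have cg: "continuous_on UNIV ?g"
      by (intro continuous_on_add continuous_on_mult continuous_on_inner c\<phi> c\<rho>z c\<psi> continuous_on_const cb)
    have g0: "?g (x, t) = 0" if "x \<notin> K" for x t using b0[OF that] \<psi>0[OF that] by simp
    have inner: "integral {0..T} (\<lambda>t. ?g (x, t)) = gW x \<bullet> g\<psi> x + \<tau>\<^sup>2 * W x * \<psi> x" for x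
    proof -
      have cx: "continuous_on {0..T} (\<lambda>t. (x, t))" by (intro continuous_intros)
      have ca: "continuous_on {0..T} (\<lambda>t. \<rho> t *\<^sub>R fst (st_grad (\<phi> n) (x, t)))"
        using continuous_on_subset[OF c\<rho>(1), of "{0..T}"] continuous_on_compose2[OF c\<phi>(2) cx]
        by (intro continuous_on_scaleR) auto
      have cb: "continuous_on {0..T} (\<lambda>t. \<rho> t * \<phi> n (x, t))"
        using continuous_on_subset[OF c\<rho>(1), of "{0..T}"] continuous_on_compose2[OF c\<phi>(1) cx]
        by (intro continuous_on_mult) auto
      have 1: "((\<lambda>t. (\<rho> t *\<^sub>R fst (st_grad (\<phi> n) (x, t))) \<bullet> g\<psi> x) has_integral gW x \<bullet> g\<psi> x) {0..T}"
        using has_integral_linear[OF integrable_integral[OF integrable_continuous_real[OF ca]] bounded_linear_inner_left[of "g\<psi> x"]]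
        by (simp add: o_def gW_def)
      have 2: "((\<lambda>t. (\<tau>\<^sup>2 * \<psi> x) * (\<rho> t * \<phi> n (x, t))) has_integral (\<tau>\<^sup>2 * \<psi> x) * W x) {0..T}"
        using has_integral_mult_right[OF integrable_integral[OF integrable_continuous_real[OF cb]], of "\<tau>\<^sup>2 * \<psi> x"]
        by (simp add: W_def laplace_def \<rho>_def)
      have "((\<lambda>t. ?g (x, t)) has_integral gW x \<bullet> g\<psi> x + \<tau>\<^sup>2 * W x * \<psi> x) {0..T}"
        using has_integral_add[OF 1 2] by (simp add: b1_def mult_ac inner_commute)
      then show ?thesis by (rule integral_unique)
    qed
    show "(LINT z|M. ?g z) = (LINT x|lborel. gW x \<bullet> g\<psi> x + \<tau>\<^sup>2 * W x * \<psi> x)"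
      "integrable lborel (\<lambda>x. gW x \<bullet> g\<psi> x + \<tau>\<^sup>2 * W x * \<psi> x)"
      using integral_restrict_cylinder[OF cg K(1) g0 K(2) Om_open, of T] unfolding M_def inner by auto
  qed
  note S = super[OF tf]
  \<comment> \<open>The defect in the Helmholtz equation for \<open>W\<close>: two terms for
    replacing \<open>u\<close> by the approximant, one for the truncation in time.\<close>
  define Z where "Z z = fst (st_grad (\<phi> n) z - G z) \<bullet> b1 z + (\<phi> n z - u z) * b3 z
      + (\<tau>\<^sup>2 * \<rho> (snd z) - \<rho>'' (snd z)) * \<phi> n z * \<psi> (fst z)" for z
  have Zeq: "Z z = (fst (st_grad (\<phi> n) z) \<bullet> b1 z + \<tau>\<^sup>2 * \<rho> (snd z) * \<phi> n z * \<psi> (fst z)) - (u z * b3 z + fst (G z) \<bullet> b1 z)" for z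
    by (simp add: Z_def b3_def algebra_simps inner_diff_left)
  have iZ: "integrable M Z"
    unfolding Zeq[abs_def] using P I by (intro Bochner_Integration.integrable_diff Bochner_Integration.integrable_add)
  have Zint: "(LINT z|M. Z z) = (LINT x|lborel. gW x \<bullet> g\<psi> x + \<tau>\<^sup>2 * W x * \<psi> x) - (LINT x|lborel. f x * \<psi> x)"
    unfolding Zeq E3[symmetric] E4[symmetric]
    using P I by (intro Bochner_Integration.integral_diff Bochner_Integration.integrable_add)
  have id: "integrable lborel (\<lambda>x. gd x \<bullet> g\<psi> x + \<tau>\<^sup>2 * d x * \<psi> x)"
    and dle: "(LINT x|lborel. gd x \<bullet> g\<psi> x + \<tau>\<^sup>2 * d x * \<psi> x) \<le> sg * (LINT z|M. Z z)"
  proof -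
    have eq: "gd x \<bullet> g\<psi> x + \<tau>\<^sup>2 * d x * \<psi> x = sg * ((gW x \<bullet> g\<psi> x + \<tau>\<^sup>2 * W x * \<psi> x) - (gk x \<bullet> g\<psi> x + \<tau>\<^sup>2 * k x * \<psi> x))" for x
      by (simp add: gd_def d_def algebra_simps inner_diff_left)
    show "integrable lborel (\<lambda>x. gd x \<bullet> g\<psi> x + \<tau>\<^sup>2 * d x * \<psi> x)"
      unfolding eq using S iW by (intro integrable_mult_right Bochner_Integration.integrable_diff) auto
    have "(LINT x|lborel. gd x \<bullet> g\<psi> x + \<tau>\<^sup>2 * d x * \<psi> x)
       = sg * ((LINT x|lborel. gW x \<bullet> g\<psi> x + \<tau>\<^sup>2 * W x * \<psi> x) - (LINT x|lborel. gk x \<bullet> g\<psi> x + \<tau>\<^sup>2 * k x * \<psi> x))"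
      unfolding eq integral_mult_right_zero using S iW by (subst Bochner_Integration.integral_diff) auto
    then show "(LINT x|lborel. gd x \<bullet> g\<psi> x + \<tau>\<^sup>2 * d x * \<psi> x) \<le> sg * (LINT z|M. Z z)"
      unfolding Zint using S by (simp add: algebra_simps)
  qed
  have sqx: "integrable lborel (\<lambda>x. (norm (g\<psi> x))\<^sup>2)" "integrable lborel (\<lambda>x. (\<psi> x)\<^sup>2)"
    and sqM: "(LINT z|M. (norm (g\<psi> (fst z)))\<^sup>2) = T * (LINT x|lborel. (norm (g\<psi> x))\<^sup>2)"
      "(LINT z|M. (\<psi> (fst z))\<^sup>2) = T * (LINT x|lborel. (\<psi> x)\<^sup>2)"
      "integrable M (\<lambda>z. (norm (g\<psi> (fst z)))\<^sup>2)" "integrable M (\<lambda>z. (\<psi> (fst z))\<^sup>2)"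
  proof -
    have c1: "continuous_on UNIV (\<lambda>z::(real^3) \<times> real. (norm (g\<psi> (fst z)))\<^sup>2)" "continuous_on UNIV (\<lambda>z::(real^3) \<times> real. (\<psi> (fst z))\<^sup>2)"
      by (intro continuous_on_power continuous_on_norm c\<psi>)+
    have z1: "(norm (g\<psi> (fst (x, t))))\<^sup>2 = 0" "(\<psi> (fst (x, t)))\<^sup>2 = 0" if "x \<notin> K" for x :: "real^3" and t :: real
      using \<psi>0[OF that] g\<psi>0[OF that] by auto
    show "integrable M (\<lambda>z. (norm (g\<psi> (fst z)))\<^sup>2)" "integrable M (\<lambda>z. (\<psi> (fst z))\<^sup>2)"
      using cyl[OF c1(1) z1(1)] cyl[OF c1(2) z1(2)] by auto
    note 1 = integral_restrict_cylinder[OF c1(1) K(1) z1(1) K(2) Om_open, of T]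
    note 2 = integral_restrict_cylinder[OF c1(2) K(1) z1(2) K(2) Om_open, of T]
    show "integrable lborel (\<lambda>x. (norm (g\<psi> x))\<^sup>2)" "integrable lborel (\<lambda>x. (\<psi> x)\<^sup>2)"
      "(LINT z|M. (norm (g\<psi> (fst z)))\<^sup>2) = T * (LINT x|lborel. (norm (g\<psi> x))\<^sup>2)"
      "(LINT z|M. (\<psi> (fst z))\<^sup>2) = T * (LINT x|lborel. (\<psi> x)\<^sup>2)"
      using 1 2 T unfolding M_def by auto
  qed
  show "integrable lborel (\<lambda>x. (\<psi> x)\<^sup>2)" by (rule sqx(2))
  define X1 where "X1 = (LINT x|lborel. (norm (g\<psi> x))\<^sup>2)"
  define X2 where "X2 = (LINT x|lborel. (\<psi> x)\<^sup>2)"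
  have lower: "X1 + \<tau>\<^sup>2 * X2 \<le> (LINT x|lborel. gd x \<bullet> g\<psi> x + \<tau>\<^sup>2 * d x * \<psi> x)"
  proof -
    have "X1 + \<tau>\<^sup>2 * X2 = (LINT x|lborel. (norm (g\<psi> x))\<^sup>2 + \<tau>\<^sup>2 * (\<psi> x)\<^sup>2)"
      unfolding X1_def X2_def using sqx by simp
    also have "\<dots> \<le> (LINT x|lborel. gd x \<bullet> g\<psi> x + \<tau>\<^sup>2 * d x * \<psi> x)"
    proof (rule Bochner_Integration.integral_mono[OF _ id])
      show "integrable lborel (\<lambda>x. (norm (g\<psi> x))\<^sup>2 + \<tau>\<^sup>2 * (\<psi> x)\<^sup>2)" using sqx by auto
      fix x
      show "(norm (g\<psi> x))\<^sup>2 + \<tau>\<^sup>2 * (\<psi> x)\<^sup>2 \<le> gd x \<bullet> g\<psi> x + \<tau>\<^sup>2 * d x * \<psi> x"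
      proof (cases "x \<in> Om")
        case True
        define \<beta> where "\<beta> = soft_pos' \<epsilon> (d x)"
        have \<beta>: "0 \<le> \<beta>" "\<beta> \<le> 1" using soft_pos'_bounds[OF eps] by (auto simp: \<beta>_def)
        have "(norm (g\<psi> x))\<^sup>2 = \<beta> * (\<beta> * (norm (gd x))\<^sup>2)"
          using True by (simp add: g\<psi>_def \<beta>_def power_mult_distrib power2_eq_square mult_ac)
        also have "\<dots> \<le> 1 * (\<beta> * (norm (gd x))\<^sup>2)" using \<beta> by (intro mult_right_mono) auto
        also have "\<dots> = gd x \<bullet> g\<psi> x" using True by (simp add: g\<psi>_def \<beta>_def power2_norm_eq_inner)
        finally have "(norm (g\<psi> x))\<^sup>2 \<le> gd x \<bullet> g\<psi> x" .
        moreover have "\<tau>\<^sup>2 * (\<psi> x)\<^sup>2 \<le> \<tau>\<^sup>2 * (d x * \<psi> x)"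
          using True soft_pos_square_le[OF eps, of "d x"] by (intro mult_left_mono) (auto simp: \<psi>_eq)
        ultimately show ?thesis by (simp add: mult.assoc)
      qed (simp add: g\<psi>_def \<psi>_eq)
    qed
    finally show ?thesis .
  qed
  define B2 where "B2 = B * (1 + 2 * \<tau> + \<tau>\<^sup>2)"
  \<comment> \<open>The Young weights are \<open>1 / T\<close>: integration over a time interval of
    length \<open>T\<close> then leaves a quarter of the gradient energy \<open>X1\<close> and half
    of \<open>X2\<close>, which the left-hand side absorbs.\<close>
  define Y where "Y z = T * (B\<^sup>2 + B2\<^sup>2 + 2 * b\<^sup>2) * err n z + 2 * T * b\<^sup>2 * (u z)\<^sup>2
      + (norm (g\<psi> (fst z)))\<^sup>2 / (4 * T) + (\<psi> (fst z))\<^sup>2 / (2 * T)" for z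
  have iY: "integrable M Y"
    unfolding Y_def using err_int(1)[OF J] u_square_integrable sqM(3,4) unfolding M_def by auto
  have ZY: "sg * Z z \<le> Y z" if "z \<in> space M" for z
  proof -
    have t: "snd z > 0" using that by (auto simp: M_def space_restrict_space)
    define P1 where "P1 = fst (st_grad (\<phi> n) z - G z)"
    have iT: "1 / T > 0" using T by simp
    have 1: "\<bar>P1 \<bullet> b1 z\<bar> \<le> T * B\<^sup>2 * (norm P1)\<^sup>2 + (norm (g\<psi> (fst z)))\<^sup>2 / (4 * T)"
    proof -
      have "\<bar>P1 \<bullet> b1 z\<bar> \<le> norm P1 * norm (b1 z)" by (rule Cauchy_Schwarz_ineq2)
      also have "\<dots> = norm P1 * (\<bar>\<rho> (snd z)\<bar> * norm (g\<psi> (fst z)))" by (simp add: b1_def)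
      also have "\<dots> \<le> norm P1 * (B * norm (g\<psi> (fst z)))"
        using bd1[OF t] by (intro mult_left_mono mult_right_mono) auto
      also have "\<dots> \<le> \<bar>(B * norm P1) * norm (g\<psi> (fst z))\<bar>" using abs_ge_self by (simp add: mult_ac)
      also have "\<dots> \<le> (B * norm P1)\<^sup>2 / (1 / T) + 1 / T * (norm (g\<psi> (fst z)))\<^sup>2 / 4"
        by (rule weighted_am_gm[OF iT])
      finally show ?thesis by (simp add: power_mult_distrib mult_ac)
    qed
    have 2: "\<bar>(\<phi> n z - u z) * b3 z\<bar> \<le> T * B2\<^sup>2 * (\<phi> n z - u z)\<^sup>2 + (\<psi> (fst z))\<^sup>2 / (4 * T)"
    proof -
      have "\<bar>(\<phi> n z - u z) * b3 z\<bar> = \<bar>\<phi> n z - u z\<bar> * (\<bar>\<rho>'' (snd z)\<bar> * \<bar>\<psi> (fst z)\<bar>)" by (simp add: b3_def abs_mult mult_ac)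
      also have "\<dots> \<le> \<bar>\<phi> n z - u z\<bar> * (B2 * \<bar>\<psi> (fst z)\<bar>)"
        using bd2[OF t] by (intro mult_left_mono mult_right_mono) (auto simp: B2_def)
      also have "\<dots> \<le> \<bar>(B2 * \<bar>\<phi> n z - u z\<bar>) * \<bar>\<psi> (fst z)\<bar>\<bar>" using abs_ge_self by (simp add: mult_ac)
      also have "\<dots> \<le> (B2 * \<bar>\<phi> n z - u z\<bar>)\<^sup>2 / (1 / T) + 1 / T * (\<bar>\<psi> (fst z)\<bar>)\<^sup>2 / 4"
        by (rule weighted_am_gm[OF iT])
      finally show ?thesis by (simp add: power_mult_distrib mult_ac)
    qed
    have 3: "\<bar>(\<tau>\<^sup>2 * \<rho> (snd z) - \<rho>'' (snd z)) * \<phi> n z * \<psi> (fst z)\<bar> \<le> T * b\<^sup>2 * (\<phi> n z)\<^sup>2 + (\<psi> (fst z))\<^sup>2 / (4 * T)"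
    proof -
      have "\<bar>(\<tau>\<^sup>2 * \<rho> (snd z) - \<rho>'' (snd z)) * \<phi> n z * \<psi> (fst z)\<bar> = \<bar>\<tau>\<^sup>2 * \<rho> (snd z) - \<rho>'' (snd z)\<bar> * (\<bar>\<phi> n z\<bar> * \<bar>\<psi> (fst z)\<bar>)"
        by (simp add: abs_mult)
      also have "\<dots> \<le> b * (\<bar>\<phi> n z\<bar> * \<bar>\<psi> (fst z)\<bar>)"
        using bd3[OF t] by (intro mult_right_mono) auto
      also have "\<dots> \<le> \<bar>(b * \<bar>\<phi> n z\<bar>) * \<bar>\<psi> (fst z)\<bar>\<bar>" using abs_ge_self by (simp add: mult_ac)
      also have "\<dots> \<le> (b * \<bar>\<phi> n z\<bar>)\<^sup>2 / (1 / T) + 1 / T * (\<bar>\<psi> (fst z)\<bar>)\<^sup>2 / 4"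
        by (rule weighted_am_gm[OF iT])
      finally show ?thesis by (simp add: power_mult_distrib mult_ac)
    qed
    have 4: "(norm P1)\<^sup>2 \<le> err n z" "(\<phi> n z - u z)\<^sup>2 \<le> err n z"
      unfolding P1_def err_def by (auto simp: norm_prod_def add_increasing)
    have 5: "(\<phi> n z)\<^sup>2 \<le> 2 * err n z + 2 * (u z)\<^sup>2"
    proof -
      have "(\<phi> n z)\<^sup>2 \<le> 2 * (\<phi> n z - u z)\<^sup>2 + 2 * (u z)\<^sup>2"
        using zero_le_power2[of "\<phi> n z - 2 * u z"] by (simp add: power2_eq_square algebra_simps)
      then show ?thesis using 4(2) by linarith
    qed
    have 6: "T * B\<^sup>2 * (norm P1)\<^sup>2 \<le> T * B\<^sup>2 * err n z" using 4(1) T by (intro mult_left_mono) auto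
    have 7: "T * B2\<^sup>2 * (\<phi> n z - u z)\<^sup>2 \<le> T * B2\<^sup>2 * err n z" using 4(2) T by (intro mult_left_mono) auto
    have 8: "T * b\<^sup>2 * (\<phi> n z)\<^sup>2 \<le> T * b\<^sup>2 * (2 * err n z + 2 * (u z)\<^sup>2)" using 5 T by (intro mult_left_mono) auto
    have "sg * Z z \<le> \<bar>Z z\<bar>" using sg by auto
    also have "\<dots> \<le> \<bar>P1 \<bullet> b1 z\<bar> + \<bar>(\<phi> n z - u z) * b3 z\<bar> + \<bar>(\<tau>\<^sup>2 * \<rho> (snd z) - \<rho>'' (snd z)) * \<phi> n z * \<psi> (fst z)\<bar>"
      unfolding Z_def P1_def by linarith
    also have "\<dots> \<le> T * B\<^sup>2 * err n z + T * B2\<^sup>2 * err n z + T * b\<^sup>2 * (2 * err n z + 2 * (u z)\<^sup>2)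
        + (norm (g\<psi> (fst z)))\<^sup>2 / (4 * T) + 2 * ((\<psi> (fst z))\<^sup>2 / (4 * T))"
      using 1 2 3 6 7 8 by linarith
    also have "\<dots> = Y z" using T by (simp add: Y_def algebra_simps)
    finally show ?thesis .
  qed
  define U where "U = (LINT z|M. (u z)\<^sup>2)"
  have "sg * (LINT z|M. Z z) = (LINT z|M. sg * Z z)" by simp
  also have "\<dots> \<le> (LINT z|M. Y z)"
    by (rule Bochner_Integration.integral_mono) (use iZ iY ZY in auto)
  also have "\<dots> = T * (B\<^sup>2 + B2\<^sup>2 + 2 * b\<^sup>2) * (LINT z|M. err n z) + 2 * T * b\<^sup>2 * U + X1 / 4 + X2 / 2"
  proof -
    have i: "integrable M (err n)" "integrable M (\<lambda>z. (u z)\<^sup>2)" using err_int(1)[OF J] u_square_integrable unfolding M_def by auto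
    have "(LINT z|M. Y z) = T * (B\<^sup>2 + B2\<^sup>2 + 2 * b\<^sup>2) * (LINT z|M. err n z) + 2 * T * b\<^sup>2 * (LINT z|M. (u z)\<^sup>2)
       + (LINT z|M. (norm (g\<psi> (fst z)))\<^sup>2) / (4 * T) + (LINT z|M. (\<psi> (fst z))\<^sup>2) / (2 * T)"
      unfolding Y_def using i sqM(3,4) by simp
    then show ?thesis using T by (simp add: sqM X1_def X2_def U_def)
  qed
  also have "\<dots> \<le> T * (B\<^sup>2 + B2\<^sup>2 + 2 * b\<^sup>2) * e n + 2 * T * b\<^sup>2 * U + X1 / 4 + X2 / 2"
    using err_int(2)[OF J, of n] T unfolding M_def by (intro add_right_mono mult_left_mono) auto
  finally have "X1 + \<tau>\<^sup>2 * X2 \<le> T * (B\<^sup>2 + B2\<^sup>2 + 2 * b\<^sup>2) * e n + 2 * T * b\<^sup>2 * U + X1 / 4 + X2 / 2"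
    using lower dle by linarith
  moreover have "X1 \<ge> 0" "X2 \<ge> 0" by (auto simp: X1_def X2_def)
  \<comment> \<open>Here \<open>\<tau> \<ge> 1\<close> enters: the left-hand side contains at least
    one full \<open>X2\<close>, the right-hand side only half of it.\<close>
  moreover have "X2 \<le> \<tau>\<^sup>2 * X2" using \<tau> \<open>X2 \<ge> 0\<close> by (intro mult_le_cancel_right1[THEN iffD2]) (auto simp: one_le_power)
  moreover have "X1 + Q \<le> R + X1 / 4 + X2 / 2 \<Longrightarrow> X1 \<ge> 0 \<Longrightarrow> X2 \<le> Q \<Longrightarrow> X2 \<le> 2 * R" for Q R by linarith
  ultimately have "X2 \<le> 2 * (T * (B\<^sup>2 + B2\<^sup>2 + 2 * b\<^sup>2) * e n + 2 * T * b\<^sup>2 * U)" by blast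
  then show "(LINT x|lborel. (\<psi> x)\<^sup>2) \<le> 2 * T * (B\<^sup>2 + (B * (1 + 2 * \<tau> + \<tau>\<^sup>2))\<^sup>2 + 2 * b\<^sup>2) * e n
       + 4 * T * b\<^sup>2 * (LINT z|restrict_space lborel (Om \<times> {0<..<T}). (u z)\<^sup>2)"
    unfolding X2_def B2_def U_def M_def by (simp add: algebra_simps)
qed

end



lemma weak_solution_data:
  assumes "weak_solution D f T u" "T > 0"
  obtains G \<phi> e where "weak_data D T u G \<phi> e" "weak_wave_eq D f T G"
proof -
  obtain G \<phi> where m: "u \<in> borel_measurable lborel" "G \<in> borel_measurable lborel"
    and u0: "\<And>x t. t < 0 \<Longrightarrow> u (x, t) = 0"
    and \<phi>: "\<And>n. C1_fun (\<phi> n)" "\<And>n. compact (tsupp (\<phi> n))" "\<And>n. tsupp (\<phi> n) \<subseteq> (- closure D) \<times> UNIV"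
    and lim: "(\<lambda>n. \<integral>\<^sup>+ z \<in> (- closure D) \<times> {..<T}.
                  ennreal ((\<phi> n z - u z)\<^sup>2 + (norm (st_grad (\<phi> n) z - G z))\<^sup>2) \<partial>lborel) \<longlonglongrightarrow> 0"
    and weak: "weak_wave_eq D f T G"
    using assms(1) unfolding weak_solution_def weak_wave_eq_def by blast
  define E where "E n = (\<integral>\<^sup>+ z \<in> (- closure D) \<times> {..<T}.
                  ennreal ((\<phi> n z - u z)\<^sup>2 + (norm (st_grad (\<phi> n) z - G z))\<^sup>2) \<partial>lborel)" for n
  have lim': "E \<longlonglongrightarrow> 0" using lim unfolding E_def .
  have "eventually (\<lambda>n. E n < 1) sequentially"
    using order_tendstoD(2)[OF lim', of 1] by simp
  then obtain N where N: "\<And>n. n \<ge> N \<Longrightarrow> E n < 1" unfolding eventually_sequentially by blast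
  \<comment> \<open>The first terms may have infinite error, which \<open>enn2real\<close> would
    send to 0; the sequence therefore starts at \<open>N\<close>.\<close>
  have fin: "E (n + N) < top" for n using N[of "n + N"] by (simp add: less_trans)
  have "weak_data D T u G (\<lambda>n. \<phi> (n + N)) (\<lambda>n. enn2real (E (n + N)))"
  proof
    show "(\<integral>\<^sup>+ z \<in> (- closure D) \<times> {..<T}.
                  ennreal ((\<phi> (n + N) z - u z)\<^sup>2 + (norm (st_grad (\<phi> (n + N)) z - G z))\<^sup>2) \<partial>lborel) \<le> ennreal (enn2real (E (n + N)))" for n
      using fin[of n] by (simp add: E_def)
    have "(\<lambda>n. E (n + N)) \<longlonglongrightarrow> ennreal 0" using LIMSEQ_ignore_initial_segment[OF lim', of N] by simp
    then show "(\<lambda>n. enn2real (E (n + N))) \<longlonglongrightarrow> 0" by (rule tendsto_enn2real) simp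
  qed (use m u0 \<phi> assms(2) in auto)
  then show ?thesis using that weak by blast
qed

section \<open>Comparing two obstacles\<close>

lemma ball_potential_pos:
  assumes "\<tau> > 0" "\<rho> > 0"
  shows "ball_potential \<tau> \<rho> z x > 0"
proof (cases "dist x z \<ge> \<rho>")
  case True
  then have "dist x z > 0" using assms(2) by linarith
  then show ?thesis using ball_potential_outside[OF assms True] by simp
next
  case False
  then have "exp (- (\<tau> * \<rho>)) / \<rho> \<le> ball_potential \<tau> \<rho> z x" using ball_potential_inside[OF assms] by simp
  moreover have "exp (- (\<tau> * \<rho>)) / \<rho> > 0" using assms by simp
  ultimately show ?thesis by linarith
qed

text \<open>The incident field is the ball potential multiplied by this constant, and the growth
  \<open>exp (\<tau> * \<rho>)\<close> shifts travel times by the radius of the source. From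
  \<open>\<tau> * \<rho> \<ge> 2\<close> follows \<open>s cosh s - sinh s \<ge> cosh s\<close> for
  \<open>s = \<tau> * \<rho>\<close>.\<close>

lemma bp_mass_lower:
  assumes "\<tau> > 0" "\<tau> * \<rho> \<ge> 2"
  shows "bp_mass \<tau> \<rho> \<ge> exp (\<tau> * \<rho>) / (2 * \<tau> ^ 3)"
proof -
  define s where "s = \<tau> * \<rho>"
  have "sinh s \<le> cosh s" by (simp add: cosh_def sinh_def)
  moreover have "2 * cosh s \<le> s * cosh s" using assms(2) by (intro mult_right_mono) (auto simp: s_def)
  moreover have "exp s \<le> 2 * cosh s" by (simp add: cosh_def)
  ultimately have "exp s / 2 \<le> s * cosh s - sinh s" by linarith
  then have "exp s / 2 / \<tau> ^ 3 \<le> (s * cosh s - sinh s) / \<tau> ^ 3" using assms by (intro divide_right_mono) auto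
  then show ?thesis by (simp add: bp_mass_def s_def)
qed

text \<open>The right-hand side is a functional \<open>F\<close> of the test function, so that exact
  equations can be combined linearly first and turned into sub- or supersolution inequalities at the
  end.\<close>

definition helmholtz_weak :: "real \<Rightarrow> (real^3) set \<Rightarrow> (real^3 \<Rightarrow> real) \<Rightarrow> (real^3 \<Rightarrow> real^3) \<Rightarrow> ((real^3 \<Rightarrow> real) \<Rightarrow> real) \<Rightarrow> bool" where
  "helmholtz_weak \<tau> U k g F \<longleftrightarrow> C1_with k g \<and> (\<forall>\<psi> g\<psi>. test_fun U \<psi> g\<psi> \<longrightarrow>
     integrable lborel (\<lambda>x. g x \<bullet> g\<psi> x + \<tau>\<^sup>2 * k x * \<psi> x) \<and>
     (LINT x|lborel. g x \<bullet> g\<psi> x + \<tau>\<^sup>2 * k x * \<psi> x) = F \<psi>)"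

lemma C1_with_lin:
  assumes "C1_with f F" "C1_with g G"
  shows "C1_with (\<lambda>x. a * f x + b * g x) (\<lambda>x. a *\<^sub>R F x + b *\<^sub>R G x)"
  unfolding C1_with_def
  using C1_withD[OF assms(1)] C1_withD[OF assms(2)]
  by (auto intro!: derivative_eq_intros continuous_intros simp: inner_simps)

lemma helmholtz_weak_lin:
  assumes "helmholtz_weak \<tau> U k g F" "helmholtz_weak \<tau> U k' g' F'"
  shows "helmholtz_weak \<tau> U (\<lambda>x. a * k x + b * k' x) (\<lambda>x. a *\<^sub>R g x + b *\<^sub>R g' x) (\<lambda>\<psi>. a * F \<psi> + b * F' \<psi>)"
  unfolding helmholtz_weak_def
proof (intro conjI allI impI)
  show "C1_with (\<lambda>x. a * k x + b * k' x) (\<lambda>x. a *\<^sub>R g x + b *\<^sub>R g' x)"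
    using assms unfolding helmholtz_weak_def by (intro C1_with_lin) auto
  fix \<psi> g\<psi> assume t: "test_fun U \<psi> g\<psi>"
  have eq: "(a *\<^sub>R g x + b *\<^sub>R g' x) \<bullet> g\<psi> x + \<tau>\<^sup>2 * (a * k x + b * k' x) * \<psi> x
      = a * (g x \<bullet> g\<psi> x + \<tau>\<^sup>2 * k x * \<psi> x) + b * (g' x \<bullet> g\<psi> x + \<tau>\<^sup>2 * k' x * \<psi> x)" for x
    by (simp add: inner_simps algebra_simps)
  have i: "integrable lborel (\<lambda>x. g x \<bullet> g\<psi> x + \<tau>\<^sup>2 * k x * \<psi> x)" "integrable lborel (\<lambda>x. g' x \<bullet> g\<psi> x + \<tau>\<^sup>2 * k' x * \<psi> x)"
    "(LINT x|lborel. g x \<bullet> g\<psi> x + \<tau>\<^sup>2 * k x * \<psi> x) = F \<psi>" "(LINT x|lborel. g' x \<bullet> g\<psi> x + \<tau>\<^sup>2 * k' x * \<psi> x) = F' \<psi>"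
    using assms t unfolding helmholtz_weak_def by auto
  show "integrable lborel (\<lambda>x. (a *\<^sub>R g x + b *\<^sub>R g' x) \<bullet> g\<psi> x + \<tau>\<^sup>2 * (a * k x + b * k' x) * \<psi> x)"
    unfolding eq by (intro Bochner_Integration.integrable_add integrable_mult_right i)
  have "(LINT x|lborel. a * (g x \<bullet> g\<psi> x + \<tau>\<^sup>2 * k x * \<psi> x) + b * (g' x \<bullet> g\<psi> x + \<tau>\<^sup>2 * k' x * \<psi> x))
     = (LINT x|lborel. a * (g x \<bullet> g\<psi> x + \<tau>\<^sup>2 * k x * \<psi> x)) + (LINT x|lborel. b * (g' x \<bullet> g\<psi> x + \<tau>\<^sup>2 * k' x * \<psi> x))"
    by (intro Bochner_Integration.integral_add integrable_mult_right i)
  then show "(LINT x|lborel. (a *\<^sub>R g x + b *\<^sub>R g' x) \<bullet> g\<psi> x + \<tau>\<^sup>2 * (a * k x + b * k' x) * \<psi> x) = a * F \<psi> + b * F' \<psi>"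
    unfolding eq using i(3,4) by simp
qed

lemma test_fun_integrable:
  assumes "test_fun U \<psi> g"
  shows "integrable lborel \<psi>" "(LINT x|lborel. \<psi> x) \<ge> 0" "\<exists>R. \<forall>x. x \<notin> cball 0 R \<longrightarrow> \<psi> x = 0"
proof -
  obtain K where K: "compact K" "\<And>x. x \<notin> K \<Longrightarrow> \<psi> x = 0" and C: "C1_with \<psi> g" and nn: "\<And>x. \<psi> x \<ge> 0"
    using assms unfolding test_fun_def by blast
  have "integrable lborel (\<lambda>x. indicator K x *\<^sub>R \<psi> x)"
    by (rule borel_integrable_compact[OF K(1) continuous_on_subset[OF C1_withD(3)[OF C]]]) auto
  moreover have "(\<lambda>x. indicator K x *\<^sub>R \<psi> x) = \<psi>" using K(2) by (intro ext) (auto simp: indicator_def)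
  ultimately show "integrable lborel \<psi>" by simp
  show "(LINT x|lborel. \<psi> x) \<ge> 0" using nn by simp
  obtain R where "\<forall>x\<in>K. norm x \<le> R" using compact_imp_bounded[OF K(1)] unfolding bounded_iff by blast
  then show "\<exists>R. \<forall>x. x \<notin> cball 0 R \<longrightarrow> \<psi> x = 0" using K(2) by (intro exI[of _ R]) auto
qed

lemma helmholtz_weak_const: "helmholtz_weak \<tau> U (\<lambda>_. c) (\<lambda>_. 0) (\<lambda>\<psi>. \<tau>\<^sup>2 * c * (LINT x|lborel. \<psi> x))"
proof -
  have "C1_with (\<lambda>_. c) (\<lambda>_. 0 :: real^3)"
    unfolding C1_with_def by (auto intro!: has_derivative_eq_rhs[OF has_derivative_const])
  then show ?thesis unfolding helmholtz_weak_def using test_fun_integrable(1) by auto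
qed

lemma helmholtz_weak_ball_potential:
  assumes "\<tau> > 0" "\<rho> > 0"
  shows "helmholtz_weak \<tau> U (ball_potential \<tau> \<rho> z) (ball_potential_grad \<tau> \<rho> z)
     (\<lambda>\<psi>. (LINT x|lborel. indicator (cball z \<rho>) x * \<psi> x) / bp_mass \<tau> \<rho>)"
  unfolding helmholtz_weak_def
proof (intro conjI allI impI)
  show "C1_with (ball_potential \<tau> \<rho> z) (ball_potential_grad \<tau> \<rho> z)" by (rule ball_potential_C1[OF assms])
  fix \<psi> g\<psi> assume t: "test_fun U \<psi> g\<psi>"
  then obtain R where R: "\<And>x. x \<notin> cball 0 R \<Longrightarrow> \<psi> x = 0" using test_fun_integrable(3) by blast
  have C: "C1_with \<psi> g\<psi>" using t by (simp add: test_fun_def)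
  show "integrable lborel (\<lambda>x. ball_potential_grad \<tau> \<rho> z x \<bullet> g\<psi> x + \<tau>\<^sup>2 * ball_potential \<tau> \<rho> z x * \<psi> x)"
    "(LINT x|lborel. ball_potential_grad \<tau> \<rho> z x \<bullet> g\<psi> x + \<tau>\<^sup>2 * ball_potential \<tau> \<rho> z x * \<psi> x) =
         (LINT x|lborel. indicator (cball z \<rho>) x * \<psi> x) / bp_mass \<tau> \<rho>"
    by (rule ball_potential_weak_eq[OF assms C R]; assumption)+
qed

text \<open>Test functions in \<open>U\<close> vanish on the source. Applied with a ball inside the
  closed obstacle and \<open>U\<close> its exterior, this makes the potential a homogeneous solution
  there, hence usable in a barrier.\<close>

lemma helmholtz_weak_ball_potential_away:
  assumes "\<tau> > 0" "\<rho> > 0" "cball z \<rho> \<inter> U = {}"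
  shows "helmholtz_weak \<tau> U (ball_potential \<tau> \<rho> z) (ball_potential_grad \<tau> \<rho> z) (\<lambda>_. 0)"
proof -
  have "(LINT x|lborel. indicator (cball z \<rho>) x * \<psi> x) = 0" if "test_fun U \<psi> g" for \<psi> g
  proof -
    have "\<psi> x = 0" if "x \<in> cball z \<rho>" for x
      using that assms(3) \<open>test_fun U \<psi> g\<close> unfolding test_fun_def by blast
    then have "(\<lambda>x. indicator (cball z \<rho>) x * \<psi> x) = (\<lambda>_. 0)" by (intro ext) (auto simp: indicator_def)
    then show ?thesis by simp
  qed
  then show ?thesis
    using helmholtz_weak_ball_potential[OF assms(1,2), of U z] unfolding helmholtz_weak_def by auto
qed

lemma helmholtz_weak_sum:
  assumes "finite Z" "\<And>z. z \<in> Z \<Longrightarrow> helmholtz_weak \<tau> U (k z) (g z) (\<lambda>_. 0)"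
  shows "helmholtz_weak \<tau> U (\<lambda>x. \<Sum>z\<in>Z. c z * k z x) (\<lambda>x. \<Sum>z\<in>Z. c z *\<^sub>R g z x) (\<lambda>_. 0)"
  using assms
proof (induction Z)
  case empty
  then show ?case using helmholtz_weak_const[of \<tau> U 0] by simp
next
  case (insert z Z)
  have "helmholtz_weak \<tau> U (\<lambda>x. c z * k z x + 1 * (\<Sum>z\<in>Z. c z * k z x)) (\<lambda>x. c z *\<^sub>R g z x + 1 *\<^sub>R (\<Sum>z\<in>Z. c z *\<^sub>R g z x)) (\<lambda>\<psi>. c z * 0 + 1 * 0)"
    using insert by (intro helmholtz_weak_lin) auto
  then show ?case using insert by simp
qed

text \<open>Where two solutions agree, their approximants are close in the square mean. The estimate
  \<open>|d| \<le> s + d\<^sup>2 / (4 s)\<close> turns this into closeness in the mean, on a set of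
  finite measure; \<open>s\<close> is left free to be chosen in terms of
  \<open>\<tau>\<close>.\<close>

lemma (in weak_data) laplace_difference:
  fixes n :: nat
  assumes wd': "weak_data D' T u' G' \<phi>' e'"
    and \<theta>: "continuous_on UNIV \<theta>" "\<And>t. \<bar>\<theta> t\<bar> \<le> B" and \<tau>: "\<tau> > 0"
    and b: "ball y \<gamma> \<subseteq> - closure D" "ball y \<gamma> \<subseteq> - closure D'"
    and eq: "AE z in lborel. z \<in> ball y \<gamma> \<times> {0<..<T} \<longrightarrow> u z = u' z" and s: "s > 0"
  defines "w \<equiv> \<lambda>x. indicat_real (ball y \<gamma>) x * \<bar>laplace \<theta> T \<tau> (\<phi>' n) x - laplace \<theta> T \<tau> (\<phi> n) x\<bar>"
  shows "integrable lborel w"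
    "(LINT x|lborel. w x) \<le> B * (s * T * measure lborel (ball y \<gamma>) + 2 * (e n + e' n) / s)"
proof -
  interpret W: weak_data D' T u' G' \<phi>' e' by (rule wd')
  let ?S = "ball y \<gamma> \<times> {0<..<T}"
  let ?M = "restrict_space lborel ?S"
  have B0: "B \<ge> 0" using \<theta>(2)[of 0] by (meson abs_ge_zero order_trans)
  have S: "?S \<in> sets borel" by (simp add: borel_prod[symmetric] open_Times)
  have SO: "?S \<subseteq> Om \<times> {..<T}" "?S \<subseteq> W.Om \<times> {..<T}" using b by (auto simp: Om_def W.Om_def)
  have fm: "finite_measure ?M"
  proof
    have "emeasure lborel ?S < \<infinity>" by (rule emeasure_bounded_finite) (auto intro!: bounded_Times)
    then show "emeasure ?M (space ?M) \<noteq> \<infinity>"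
      using S by (simp add: emeasure_restrict_space space_restrict_space)
  qed
  define g where "g z = \<bar>\<phi>' n z - \<phi> n z\<bar>" for z
  have cg: "continuous_on UNIV g"
    unfolding g_def using C1_withD(3)[OF \<phi>_C1_with] C1_withD(3)[OF W.\<phi>_C1_with] by (intro continuous_intros)
  obtain K1 K2 where K: "compact K1" "\<And>x t. x \<notin> K1 \<Longrightarrow> \<phi> n (x, t) = 0" "compact K2" "\<And>x t. x \<notin> K2 \<Longrightarrow> \<phi>' n (x, t) = 0"
    using \<phi>_time_supp[of n] W.\<phi>_time_supp[of n] by blast
  have gK: "compact (K1 \<union> K2)" "\<And>x t. x \<notin> K1 \<union> K2 \<Longrightarrow> g (x, t) = 0" using K by (auto simp: g_def)
  have cyl: "integrable lborel (\<lambda>x. indicator (ball y \<gamma>) x * integral {0..T} (\<lambda>t. g (x, t)))"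
    "(LINT z|?M. g z) = (LINT x|lborel. indicator (ball y \<gamma>) x * integral {0..T} (\<lambda>t. g (x, t)))"
    by (rule integral_restrict_cylinder_indicator[OF cg gK(1)]; use gK(2) in auto)+
  have ig: "integrable ?M g"
    by (rule integrable_restrict_cylinder[OF cg gK(1), where l = 0 and h = T]) (use gK(2) in auto)
  have pw: "w x \<le> B * (indicator (ball y \<gamma>) x * integral {0..T} (\<lambda>t. g (x, t)))" for x
  proof -
    let ?f = "\<lambda>t. \<theta> t * exp (- (\<tau> * t)) * \<phi>' n (x, t)" and ?f' = "\<lambda>t. \<theta> t * exp (- (\<tau> * t)) * \<phi> n (x, t)"
    have cx: "continuous_on {0..T} (\<lambda>t. (x, t))" by (intro continuous_intros)
    have c: "continuous_on {0..T} ?f" "continuous_on {0..T} ?f'" "continuous_on {0..T} (\<lambda>t. g (x, t))"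
      using continuous_on_subset[OF \<theta>(1), of "{0..T}"] continuous_on_compose2[OF C1_withD(3)[OF \<phi>_C1_with[of n]] cx]
        continuous_on_compose2[OF C1_withD(3)[OF W.\<phi>_C1_with[of n]] cx] continuous_on_compose2[OF cg cx]
      by (auto intro!: continuous_intros)
    have "laplace \<theta> T \<tau> (\<phi>' n) x - laplace \<theta> T \<tau> (\<phi> n) x = integral {0..T} (\<lambda>t. ?f t - ?f' t)"
      unfolding laplace_def using integrable_continuous_real[OF c(1)] integrable_continuous_real[OF c(2)]
      by (simp add: Henstock_Kurzweil_Integration.integral_diff)
    moreover have "norm (integral {0..T} (\<lambda>t. ?f t - ?f' t)) \<le> integral {0..T} (\<lambda>t. B * g (x, t))"
    proof (rule integral_norm_bound_integral)
      show "(\<lambda>t. ?f t - ?f' t) integrable_on {0..T}" "(\<lambda>t. B * g (x, t)) integrable_on {0..T}"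
        using c by (auto intro!: integrable_continuous_real continuous_intros)
      fix t assume t: "t \<in> {0..T}"
      have "norm (?f t - ?f' t) = (\<bar>\<theta> t\<bar> * exp (- (\<tau> * t))) * g (x, t)"
        by (simp add: g_def abs_mult flip: right_diff_distrib)
      also have "\<dots> \<le> (B * 1) * g (x, t)"
        using \<theta>(2)[of t] t \<tau> B0 by (intro mult_right_mono mult_mono) (auto simp: g_def)
      finally show "norm (?f t - ?f' t) \<le> B * g (x, t)" by simp
    qed
    ultimately have "\<bar>laplace \<theta> T \<tau> (\<phi>' n) x - laplace \<theta> T \<tau> (\<phi> n) x\<bar> \<le> B * integral {0..T} (\<lambda>t. g (x, t))" by simp
    then show ?thesis by (auto simp: w_def indicator_def)
  qed
  have c\<rho>: "continuous_on UNIV (\<lambda>t. \<theta> t * exp (- (\<tau> * t)))" by (intro continuous_intros \<theta>(1))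
  have cW: "continuous_on UNIV (laplace \<theta> T \<tau> (\<phi>' n))" "continuous_on UNIV (laplace \<theta> T \<tau> (\<phi> n))"
    using C1_withD(3)[OF C1_with_time_average[OF W.\<phi>_C1_with[of n] c\<rho>, of T]]
      C1_withD(3)[OF C1_with_time_average[OF \<phi>_C1_with[of n] c\<rho>, of T]]
    unfolding laplace_def[abs_def] by auto
  have wm: "w \<in> borel_measurable lborel"
  proof -
    note [measurable] = borel_measurable_continuous_onI[OF cW(1)] borel_measurable_continuous_onI[OF cW(2)]
    have [measurable]: "ball y \<gamma> \<in> sets borel" by simp
    show ?thesis unfolding w_def by measurable
  qed
  have iB: "integrable lborel (\<lambda>x. B * (indicator (ball y \<gamma>) x * integral {0..T} (\<lambda>t. g (x, t))))"
    using cyl(1) by (rule integrable_mult_right)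
  show iw: "integrable lborel w"
  proof (rule Bochner_Integration.integrable_bound[OF iB wm AE_I2])
    fix x
    have "0 \<le> w x" by (simp add: w_def)
    then show "norm (w x) \<le> norm (B * (indicator (ball y \<gamma>) x * integral {0..T} (\<lambda>t. g (x, t))))" using pw[of x] by simp
  qed
  have "(LINT x|lborel. w x) \<le> (LINT x|lborel. B * (indicator (ball y \<gamma>) x * integral {0..T} (\<lambda>t. g (x, t))))"
    by (rule Bochner_Integration.integral_mono[OF iw iB pw])
  also have "\<dots> = B * (LINT z|?M. g z)" using cyl(2) by simp
  also have "(LINT z|?M. g z) \<le> (LINT z|?M. s + 2 * (err n z + W.err n z) / s)"
  proof (rule integral_mono_AE[OF ig])
    have "integrable ?M (\<lambda>z. s)" by (rule finite_measure.integrable_const[OF fm])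
    then show "integrable ?M (\<lambda>z. s + 2 * (err n z + W.err n z) / s)"
      using err_int_subset(1)[OF SO(1) S] W.err_int_subset(1)[OF SO(2) S]
      by (intro Bochner_Integration.integrable_add integrable_divide integrable_mult_right)
    have "AE z in lborel. z \<in> ?S \<longrightarrow> g z \<le> s + 2 * (err n z + W.err n z) / s"
      using eq
    proof (rule AE_mp, intro AE_I2 impI)
      fix z assume *: "z \<in> ?S \<longrightarrow> u z = u' z" "z \<in> ?S"
      then have uu: "u z = u' z" by simp
      have "\<bar>1 * (\<phi>' n z - \<phi> n z)\<bar> \<le> 1\<^sup>2 / (1 / s) + 1 / s * (\<phi>' n z - \<phi> n z)\<^sup>2 / 4"
        by (rule weighted_am_gm) (use s in simp)
      then have "g z \<le> s + (\<phi>' n z - \<phi> n z)\<^sup>2 / (4 * s)" by (simp add: g_def mult.commute)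
      moreover have "(\<phi>' n z - \<phi> n z)\<^sup>2 \<le> 2 * ((\<phi> n z - u z)\<^sup>2 + (\<phi>' n z - u' z)\<^sup>2)"
        using zero_le_power2[of "(\<phi> n z - u z) + (\<phi>' n z - u z)"] unfolding uu
        by (simp add: power2_eq_square algebra_simps)
      moreover have "2 * ((\<phi> n z - u z)\<^sup>2 + (\<phi>' n z - u' z)\<^sup>2) \<le> 2 * (err n z + W.err n z)"
        by (simp add: err_def W.err_def)
      ultimately have 1: "g z \<le> s + 2 * (err n z + W.err n z) / (4 * s)"
        using s by (smt (verit) divide_right_mono mult_pos_pos)
      have nn: "0 \<le> 2 * (err n z + W.err n z) / s" using s by (simp add: err_def W.err_def)
      have "2 * (err n z + W.err n z) / (4 * s) = 2 * (err n z + W.err n z) / s / 4" by simp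
      also have "\<dots> \<le> 2 * (err n z + W.err n z) / s"
      proof -
        have "0 \<le> q \<Longrightarrow> q / 4 \<le> q" for q :: real by simp
        then show ?thesis using nn by blast
      qed
      finally show "g z \<le> s + 2 * (err n z + W.err n z) / s" using 1 by linarith
    qed
    then show "AE z in ?M. g z \<le> s + 2 * (err n z + W.err n z) / s"
      using S by (simp add: AE_restrict_space_iff)
  qed
  also have "\<dots> = s * measure ?M (space ?M) + 2 * ((LINT z|?M. err n z) + (LINT z|?M. W.err n z)) / s"
  proof -
    have "integrable ?M (\<lambda>z. s)" by (rule finite_measure.integrable_const[OF fm])
    then show ?thesis
      using err_int_subset(1)[OF SO(1) S] W.err_int_subset(1)[OF SO(2) S] by simp
  qed
  also have "measure ?M (space ?M) = T * measure lborel (ball y \<gamma>)"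
  proof -
    have "measure ?M (space ?M) = measure lborel ?S"
      using S by (simp add: measure_restrict_space space_restrict_space)
    also have "\<dots> = measure (lborel \<Otimes>\<^sub>M lborel) (ball y \<gamma> \<times> {0<..<T})" by (simp add: lborel_prod)
    also have "\<dots> = measure lborel (ball y \<gamma>) * measure lborel {0<..<T}"
      by (simp add: measure_def lborel.emeasure_pair_measure_Times enn2real_mult)
    finally show ?thesis using T by simp
  qed
  also have "s * (T * measure lborel (ball y \<gamma>)) + 2 * ((LINT z|?M. err n z) + (LINT z|?M. W.err n z)) / s
      \<le> s * (T * measure lborel (ball y \<gamma>)) + 2 * (e n + e' n) / s"
    using err_int_subset(2)[OF SO(1) S, of n] W.err_int_subset(2)[OF SO(2) S, of n] s
    by (intro add_left_mono divide_right_mono mult_left_mono add_mono) auto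
  finally show "(LINT x|lborel. w x) \<le> B * (s * T * measure lborel (ball y \<gamma>) + 2 * (e n + e' n) / s)"
    using B0 by (simp add: mult_left_mono mult.assoc)
qed



text \<open>\<open>k1\<close> is a supersolution for the first obstacle and \<open>k2\<close> a
  subsolution for the second, so up to small errors \<open>k1\<close> lies above the first transform
  and \<open>k2\<close> below the second. Where the data agree the transforms nearly coincide, so
  \<open>k2 - k1\<close>, and with it \<open>L\<close>, cannot exceed the errors on average.\<close>

lemma two_obstacle_bound:
  assumes wd1: "weak_data D1 T u1 G1 \<phi>1 e1" and wd2: "weak_data D2 T u2 G2 \<phi>2 e2"
    and weak1: "weak_wave_eq D1 f T G1" and weak2: "weak_wave_eq D2 f T G2"
    and cut: "is_cutoff a h \<theta> \<theta>' \<theta>'' B" "h < T" "B \<ge> 0" and a: "0 \<le> a" and \<tau>: "\<tau> \<ge> 1"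
    and b: "ball y \<gamma> \<subseteq> - closure D1" "ball y \<gamma> \<subseteq> - closure D2"
    and eq: "AE z in lborel. z \<in> ball y \<gamma> \<times> {0<..<T} \<longrightarrow> u1 z = u2 z"
    and k1: "helmholtz_weak \<tau> (- closure D1) k1 g1 F1"
      "\<And>\<psi> g. test_fun (- closure D1) \<psi> g \<Longrightarrow> (LINT x|lborel. f x * \<psi> x) \<le> F1 \<psi>"
      "\<And>x. x \<notin> closure D1 \<Longrightarrow> k1 x \<ge> 0"
    and k2: "helmholtz_weak \<tau> (- closure D2) k2 g2 F2"
      "\<And>\<psi> g. test_fun (- closure D2) \<psi> g \<Longrightarrow> F2 \<psi> \<le> (LINT x|lborel. f x * \<psi> x)"
      "compact K0" "K0 \<subseteq> - closure D2" "\<And>x. x \<in> - closure D2 - K0 \<Longrightarrow> k2 x \<le> 0"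
    and L: "\<And>x. x \<in> ball y \<gamma> \<Longrightarrow> L \<le> k2 x - k1 x"
  defines "V \<equiv> measure lborel (ball y \<gamma>)"
    and "U \<equiv> (LINT z|restrict_space lborel ((- closure D1) \<times> {0<..<T}). (u1 z)\<^sup>2)
      + (LINT z|restrict_space lborel ((- closure D2) \<times> {0<..<T}). (u2 z)\<^sup>2)"
  shows "L * V \<le> exp (- (\<tau> * a)) * ((4 + B * T) * V + 4 * T * B\<^sup>2 * U * (1 + 2 * \<tau>)\<^sup>2)"
proof -
  interpret W1: weak_data D1 T u1 G1 \<phi>1 e1 by (rule wd1)
  interpret W2: weak_data D2 T u2 G2 \<phi>2 e2 by (rule wd2)
  have T: "T > 0" by (rule W1.T)
  define \<epsilon> where "\<epsilon> = exp (- (\<tau> * a))"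
  have eps: "\<epsilon> > 0" by (simp add: \<epsilon>_def)
  define bb where "bb = B * (1 + 2 * \<tau>) * exp (- (\<tau> * a))"
  define C where "C = 2 * T * (B\<^sup>2 + (B * (1 + 2 * \<tau> + \<tau>\<^sup>2))\<^sup>2 + 2 * bb\<^sup>2)"
  have main: "L * V \<le> 4 * \<epsilon> * V + B * (\<epsilon> * T * V + 2 * (e1 n + e2 n) / \<epsilon>) + (C * (e1 n + e2 n) + 4 * T * bb\<^sup>2 * U) / \<epsilon>" for n
  proof -
    define w where "w x = indicat_real (ball y \<gamma>) x * \<bar>laplace \<theta> T \<tau> (\<phi>2 n) x - laplace \<theta> T \<tau> (\<phi>1 n) x\<bar>" for x
    have c\<theta>: "continuous_on UNIV \<theta>" "\<And>t. \<bar>\<theta> t\<bar> \<le> B"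
    proof -
      have "\<And>t. (\<theta> has_real_derivative \<theta>' t) (at t)" "\<And>t. \<bar>\<theta> t\<bar> \<le> B" using cut(1) unfolding is_cutoff_def by blast+
      then show "continuous_on UNIV \<theta>" "\<And>t. \<bar>\<theta> t\<bar> \<le> B"
        by (auto intro!: continuous_at_imp_continuous_on DERIV_isCont)
    qed
    have w: "integrable lborel w" "(LINT x|lborel. w x) \<le> B * (\<epsilon> * T * V + 2 * (e1 n + e2 n) / \<epsilon>)"
      unfolding w_def V_def
      by (rule W1.laplace_difference[OF wd2 c\<theta> _ b eq eps]; use \<tau> in simp)+
    define \<psi>1 where "\<psi>1 x = (if x \<in> W1.Om then soft_pos \<epsilon> (1 * (laplace \<theta> T \<tau> (\<phi>1 n) x - k1 x)) else 0)" for x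
    define \<psi>2 where "\<psi>2 x = (if x \<in> W2.Om then soft_pos \<epsilon> (-1 * (laplace \<theta> T \<tau> (\<phi>2 n) x - k2 x)) else 0)" for x
    have C1: "C1_with k1 g1" and C2: "C1_with k2 g2" using k1(1) k2(1) by (auto simp: helmholtz_weak_def)
    have super1: "integrable lborel (\<lambda>x. g1 x \<bullet> g\<psi> x + \<tau>\<^sup>2 * k1 x * \<psi> x) \<and>
        1 * (LINT x|lborel. f x * \<psi> x) \<le> 1 * (LINT x|lborel. g1 x \<bullet> g\<psi> x + \<tau>\<^sup>2 * k1 x * \<psi> x)"
      if "test_fun W1.Om \<psi> g\<psi>" for \<psi> g\<psi>
      using that k1(1) k1(2)[of \<psi> g\<psi>] by (auto simp: helmholtz_weak_def W1.Om_def)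
    have super2: "integrable lborel (\<lambda>x. g2 x \<bullet> g\<psi> x + \<tau>\<^sup>2 * k2 x * \<psi> x) \<and>
        -1 * (LINT x|lborel. f x * \<psi> x) \<le> -1 * (LINT x|lborel. g2 x \<bullet> g\<psi> x + \<tau>\<^sup>2 * k2 x * \<psi> x)"
      if "test_fun W2.Om \<psi> g\<psi>" for \<psi> g\<psi>
      using that k2(1) k2(2)[of \<psi> g\<psi>] by (auto simp: helmholtz_weak_def W2.Om_def)
    have nn1: "1 * k1 x \<ge> 0" if "x \<in> W1.Om - {}" for x using that k1(3)[of x] by (simp add: W1.Om_def)
    have nn2: "-1 * k2 x \<ge> 0" if "x \<in> W2.Om - K0" for x using that k2(5)[of x] by (simp add: W2.Om_def)
    have K0: "K0 \<subseteq> W2.Om" using k2(4) by (simp add: W2.Om_def)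
    have 1: "integrable lborel (\<lambda>x. (\<psi>1 x)\<^sup>2)" "(LINT x|lborel. (\<psi>1 x)\<^sup>2) \<le> C * e1 n
       + 4 * T * bb\<^sup>2 * (LINT z|restrict_space lborel (W1.Om \<times> {0<..<T}). (u1 z)\<^sup>2)"
      unfolding \<psi>1_def C_def bb_def
      by (rule W1.comparison_single[OF weak1 cut a \<tau> disjI1[OF refl] eps C1 compact_empty empty_subsetI nn1 super1]; assumption)+
    have 2: "integrable lborel (\<lambda>x. (\<psi>2 x)\<^sup>2)" "(LINT x|lborel. (\<psi>2 x)\<^sup>2) \<le> C * e2 n
       + 4 * T * bb\<^sup>2 * (LINT z|restrict_space lborel (W2.Om \<times> {0<..<T}). (u2 z)\<^sup>2)"
      unfolding \<psi>2_def C_def bb_def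
      by (rule W2.comparison_single[OF weak2 cut a \<tau> disjI2[OF refl] eps C2 k2(3) K0 nn2 super2]; assumption)+
    have pw: "L * indicator (ball y \<gamma>) x \<le> 4 * \<epsilon> * indicator (ball y \<gamma>) x + w x + ((\<psi>1 x)\<^sup>2 + (\<psi>2 x)\<^sup>2) / \<epsilon>" for x
    proof (cases "x \<in> ball y \<gamma>")
      case True
      \<comment> \<open>Converts the square integrals of the positive parts into plain ones. Used
        for both obstacles, together with \<open>soft_pos_ge\<close>, it accounts for the
        \<open>4 * \<epsilon>\<close>.\<close>
      have sq: "s \<le> \<epsilon> + s\<^sup>2 / \<epsilon>" for s
      proof (cases "s \<le> \<epsilon>")
        case True
        then show ?thesis using eps by (simp add: add_increasing2)
      next
        case False
        then have "s * \<epsilon> \<le> s\<^sup>2" using eps by (simp add: power2_eq_square)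
        then have "s \<le> s\<^sup>2 / \<epsilon>" using eps by (simp add: le_divide_eq)
        then show ?thesis using eps by linarith
      qed
      have O: "x \<in> W1.Om" "x \<in> W2.Om" using True b by (auto simp: W1.Om_def W2.Om_def)
      have s1: "laplace \<theta> T \<tau> (\<phi>1 n) x - k1 x \<le> \<psi>1 x + \<epsilon>"
        using soft_pos_ge[OF eps, of "laplace \<theta> T \<tau> (\<phi>1 n) x - k1 x"] O by (simp add: \<psi>1_def)
      have s2: "k2 x - laplace \<theta> T \<tau> (\<phi>2 n) x \<le> \<psi>2 x + \<epsilon>"
        using soft_pos_ge[OF eps, of "k2 x - laplace \<theta> T \<tau> (\<phi>2 n) x"] O by (simp add: \<psi>2_def)
      have s3: "laplace \<theta> T \<tau> (\<phi>2 n) x - laplace \<theta> T \<tau> (\<phi>1 n) x \<le> w x"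
        using True by (simp add: w_def)
      have "L \<le> 4 * \<epsilon> + w x + ((\<psi>1 x)\<^sup>2 / \<epsilon> + (\<psi>2 x)\<^sup>2 / \<epsilon>)"
        using L[OF True] s1 s2 s3 sq[of "\<psi>1 x"] sq[of "\<psi>2 x"] by linarith
      then show ?thesis using True by (simp add: add_divide_distrib)
    next
      case False
      then show ?thesis using eps by (simp add: w_def)
    qed
    have ind: "integrable lborel (indicat_real (ball y \<gamma>))" "(LINT x|lborel. indicat_real (ball y \<gamma>) x) = V"
      by (auto simp: V_def intro!: integrable_real_indicator emeasure_bounded_finite)
    have "L * V = (LINT x|lborel. L * indicator (ball y \<gamma>) x)" using ind by simp
    also have "\<dots> \<le> (LINT x|lborel. 4 * \<epsilon> * indicator (ball y \<gamma>) x + w x + ((\<psi>1 x)\<^sup>2 + (\<psi>2 x)\<^sup>2) / \<epsilon>)"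
      using ind(1) w(1) 1(1) 2(1) pw by (intro Bochner_Integration.integral_mono) auto
    also have "\<dots> = 4 * \<epsilon> * V + (LINT x|lborel. w x) + ((LINT x|lborel. (\<psi>1 x)\<^sup>2) + (LINT x|lborel. (\<psi>2 x)\<^sup>2)) / \<epsilon>"
      using ind w(1) 1(1) 2(1) by simp
    also have "\<dots> \<le> 4 * \<epsilon> * V + B * (\<epsilon> * T * V + 2 * (e1 n + e2 n) / \<epsilon>) + (C * (e1 n + e2 n) + 4 * T * bb\<^sup>2 * U) / \<epsilon>"
    proof -
      have *: "(LINT x|lborel. (\<psi>1 x)\<^sup>2) + (LINT x|lborel. (\<psi>2 x)\<^sup>2) \<le> C * (e1 n + e2 n) + 4 * T * bb\<^sup>2 * U"
        using 1(2) 2(2) unfolding U_def W1.Om_def W2.Om_def by (simp add: algebra_simps)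
      show ?thesis
        by (rule add_mono[OF add_left_mono[OF w(2)] divide_right_mono[OF *]]) (use eps in simp)
    qed
    finally show ?thesis .
  qed
  \<comment> \<open>\<open>\<tau>\<close> and \<open>\<epsilon>\<close> stay fixed while
    \<open>n\<close> tends to infinity, so dividing \<open>e1\<close> and \<open>e2\<close> by the
    small \<open>\<epsilon>\<close> is harmless. The surviving quotient
    \<open>bb\<^sup>2 / \<epsilon>\<close> is again \<open>\<epsilon>\<close> times a polynomial in
    \<open>\<tau>\<close>.\<close>
  have "L * V \<le> 4 * \<epsilon> * V + B * (\<epsilon> * T * V + 2 * (0 + 0) / \<epsilon>) + (C * (0 + 0) + 4 * T * bb\<^sup>2 * U) / \<epsilon>"
  proof (rule LIMSEQ_le_const)
    show "(\<lambda>n. 4 * \<epsilon> * V + B * (\<epsilon> * T * V + 2 * (e1 n + e2 n) / \<epsilon>) + (C * (e1 n + e2 n) + 4 * T * bb\<^sup>2 * U) / \<epsilon>)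
        \<longlonglongrightarrow> 4 * \<epsilon> * V + B * (\<epsilon> * T * V + 2 * (0 + 0) / \<epsilon>) + (C * (0 + 0) + 4 * T * bb\<^sup>2 * U) / \<epsilon>"
      using W1.e_lim W2.e_lim eps by (intro tendsto_intros) auto
  qed (use main in blast)
  also have "\<dots> = 4 * \<epsilon> * V + B * (\<epsilon> * T * V) + 4 * T * bb\<^sup>2 * U / \<epsilon>" by simp
  also have "bb\<^sup>2 = B\<^sup>2 * (1 + 2 * \<tau>)\<^sup>2 * \<epsilon>\<^sup>2" by (simp add: bb_def \<epsilon>_def power_mult_distrib)
  also have "4 * \<epsilon> * V + B * (\<epsilon> * T * V) + 4 * T * (B\<^sup>2 * (1 + 2 * \<tau>)\<^sup>2 * \<epsilon>\<^sup>2) * U / \<epsilon>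
      = \<epsilon> * ((4 + B * T) * V + 4 * T * B\<^sup>2 * U * (1 + 2 * \<tau>)\<^sup>2)"
    using eps by (simp add: field_simps power2_eq_square)
  finally show ?thesis unfolding \<epsilon>_def .
qed



text \<open>Up to constants this is the triangle inequality in the exponent: a point source at \<open>z\<close> inside the
  obstacle, damped by the travel time from \<open>p\<close> to \<open>z\<close>, stays below the incident field.\<close>

lemma lower_barrier_le:
  fixes p z c x :: "real^3"
  assumes pos: "\<tau> > 0" "\<eta> > 0" and z: "z \<in> ball c r" and far: "\<eta> \<le> dist z p" and x: "x \<notin> ball c r"
  defines "\<rho> \<equiv> r - dist c z"
  shows "\<rho> / (\<rho> + dist z p) * exp (- (\<tau> * dist z p)) * ball_potential \<tau> \<rho> z x \<le> ball_potential \<tau> \<eta> p x"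
proof -
  have \<rho>: "\<rho> > 0" using z by (simp add: \<rho>_def)
  have dx: "dist x z \<ge> \<rho>" using x dist_triangle[of c x z] by (simp add: \<rho>_def dist_commute)
  \<comment> \<open>\<open>\<kappa>\<close> serves two regions: outside the source ball
    \<open>\<kappa> / dist x z \<le> 1 / dist x p\<close>, by the triangle inequality and
    \<open>dist x z \<ge> \<rho>\<close>; inside it
    \<open>\<kappa> / \<rho> \<le> 1 / \<eta>\<close>, by
    \<open>\<eta> \<le> dist z p\<close>.\<close>
  define \<kappa> where "\<kappa> = \<rho> / (\<rho> + dist z p)"
  have \<kappa>: "\<kappa> \<ge> 0" using \<rho> by (simp add: \<kappa>_def)
  have tri: "dist x p \<le> dist x z + dist z p" by (rule dist_triangle)
  have lhs: "\<kappa> * exp (- (\<tau> * dist z p)) * ball_potential \<tau> \<rho> z x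
      = exp (- (\<tau> * (dist z p + dist x z))) * (\<kappa> / dist x z)"
    unfolding ball_potential_outside[OF pos(1) \<rho> dx] by (simp add: distrib_left exp_add exp_diff field_simps exp_minus)
  show ?thesis
  proof (cases "dist x p \<ge> \<eta>")
    case True
    have "\<kappa> / dist x z \<le> 1 / dist x p"
    proof -
      have "\<rho> * dist x p \<le> \<rho> * (dist x z + dist z p)" using tri \<rho> by (intro mult_left_mono) auto
      also have "\<dots> \<le> dist x z * (\<rho> + dist z p)"
        using mult_right_mono[OF dx, of "dist z p"] by (simp add: algebra_simps)
      finally have "\<rho> / (\<rho> + dist z p) \<le> dist x z / dist x p"
      proof -
        assume *: "\<rho> * dist x p \<le> dist x z * (\<rho> + dist z p)"
        have "dist x p > 0" "\<rho> + dist z p > 0" using \<rho> True pos zero_le_dist[of z p] by linarith+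
        then show ?thesis using * by (simp add: pos_divide_le_eq le_divide_eq)
      qed
      then have "\<kappa> / dist x z \<le> dist x z / dist x p / dist x z"
        unfolding \<kappa>_def using dx \<rho> by (intro divide_right_mono) auto
      moreover have "x \<noteq> z" using dx \<rho> by auto
      ultimately show ?thesis by simp
    qed
    then have "exp (- (\<tau> * (dist z p + dist x z))) * (\<kappa> / dist x z) \<le> exp (- (\<tau> * dist x p)) * (1 / dist x p)"
      using tri pos \<kappa> by (intro mult_mono) auto
    then show ?thesis unfolding \<kappa>_def[symmetric] lhs ball_potential_outside[OF pos True] by simp
  next
    case False
    have "dist x z > 0" using dx \<rho> by linarith
    then have "\<kappa> / dist x z \<le> \<kappa> / \<rho>" using dx \<rho> \<kappa> by (intro divide_left_mono mult_pos_pos)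
    also have "\<dots> = 1 / (\<rho> + dist z p)" using \<rho> by (simp add: \<kappa>_def)
    also have "\<dots> \<le> 1 / \<eta>" using far \<rho> pos by (intro divide_left_mono) auto
    finally have "exp (- (\<tau> * (dist z p + dist x z))) * (\<kappa> / dist x z) \<le> exp (- (\<tau> * \<eta>)) * (1 / \<eta>)"
      using far pos \<kappa> by (intro mult_mono) (auto intro: add_increasing2)
    also have "\<dots> \<le> ball_potential \<tau> \<eta> p x"
      using ball_potential_inside[OF pos, of x p] False by simp
    finally show ?thesis unfolding \<kappa>_def[symmetric] lhs .
  qed
qed

text \<open>The ball potential has its source on the closed ball, the wave problem on the open one;
  the sphere between them is a null set.\<close>

lemma integral_ball_cball:
  fixes \<psi> :: "'a::euclidean_space \<Rightarrow> real"
  assumes "\<psi> \<in> borel_measurable borel"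
  shows "(LINT x|lborel. indicator (cball p \<eta>) x * \<psi> x) = (LINT x|lborel. indicator (ball p \<eta>) x * \<psi> x)"
proof (rule integral_cong_AE)
  have "sphere p \<eta> \<in> null_sets lborel"
    using negligible_sphere[of p \<eta>] by (simp add: negligible_iff_null_sets null_sets_completion_iff)
  then show "AE x in lborel. indicator (cball p \<eta>) x * \<psi> x = indicator (ball p \<eta>) x * \<psi> x"
    by (rule AE_I') (auto simp: indicator_def)
  note [measurable] = assms
  show "(\<lambda>x. indicator (cball p \<eta>) x * \<psi> x) \<in> borel_measurable lborel"
    "(\<lambda>x. indicator (ball p \<eta>) x * \<psi> x) \<in> borel_measurable lborel"
    by (intro borel_measurable_times borel_measurable_indicator; simp)+
qed

text \<open>The reflection from the first obstacle is at least of order \<open>exp (- \<tau> (phi z p y - \<eta>))\<close> near \<open>y\<close>, by the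
  barrier \<open>h1\<close>; the one from the second is at most of order \<open>exp (- \<tau> (m2 - \<eta>))\<close>, by a sum \<open>H2\<close> of point sources
  at a \<open>\<gamma>\<close>-net \<open>Z\<close> of its boundary, and truncation in time costs only \<open>exp (- \<tau> a)\<close>.\<close>

lemma arrival_time_contradiction:
  fixes c1 c2 p p' y z :: "real^3"
  assumes pos: "r1 > 0" "r2 > 0" "\<eta> > 0" "T > 0"
    and ws1: "weak_solution (ball c1 r1) (indicator (ball p \<eta>)) T u1"
    and ws2: "weak_solution (ball c2 r2) (indicator (ball p \<eta>)) T u2"
    and eq: "AE z in lborel. z \<in> ball p' \<eta>' \<times> {0<..<T} \<longrightarrow> u1 z = u2 z"
    and far1: "\<And>x. x \<in> cball c1 r1 \<Longrightarrow> \<eta> \<le> dist x p" and far2: "\<And>x. x \<in> cball c2 r2 \<Longrightarrow> \<eta> \<le> dist x p"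
    and away: "ball p' \<eta>' \<inter> cball c1 r1 = {}" "ball p' \<eta>' \<inter> cball c2 r2 = {}"
    and y: "y \<in> ball p' \<eta>'" and z: "z \<in> ball c1 r1"
    and m2: "\<And>x. x \<in> cball c2 r2 \<Longrightarrow> m2 \<le> phi x p y" and lt: "phi z p y < m2" "phi z p y < T + \<eta>"
  shows False
proof -
  define m1 where "m1 = phi z p y"
  \<comment> \<open>One margin for all losses: \<open>m2 - m1\<close> must outlast several shifts of
    the exponents by \<open>\<gamma>\<close>, the cutoff time
    \<open>m1 + 2 * \<gamma> - \<eta>\<close> must stay below \<open>T\<close>, and
    \<open>ball y \<gamma>\<close> must stay where the data are known.\<close>
  define \<gamma> where "\<gamma> = min (min ((m2 - m1) / 9) ((T + \<eta> - m1) / 3)) (\<eta>' - dist p' y)"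
  have \<gamma>0: "\<gamma> > 0" using lt y by (auto simp: \<gamma>_def m1_def)
  have "\<gamma> \<le> (m2 - m1) / 9" "\<gamma> \<le> (T + \<eta> - m1) / 3" "\<gamma> \<le> \<eta>' - dist p' y"
    unfolding \<gamma>_def by linarith+
  then have \<gamma>: "m1 + 8 * \<gamma> < m2" "m1 + 2 * \<gamma> < T + \<eta>" "ball y \<gamma> \<subseteq> ball p' \<eta>'"
    using \<gamma>0 by (auto simp: ball_subset_ball_iff dist_commute)
  \<comment> \<open>The signal from \<open>z\<close> has order at least
    \<open>exp (- \<tau> (m1 + \<gamma> - \<eta>))\<close> near \<open>y\<close>, up to powers of
    \<open>\<tau>\<close>; truncation at this time costs \<open>exp (- \<tau> a)\<close>, smaller by
    the factor \<open>exp (- \<tau> \<gamma>)\<close>.\<close>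
  define a where "a = m1 + 2 * \<gamma> - \<eta>"
  have a: "0 \<le> a" "a < T"
    using \<gamma> \<gamma>0 far1[of z] z unfolding a_def m1_def phi_def by (auto simp: dist_commute add_increasing2)
  obtain \<theta> \<theta>' \<theta>'' h B where cut: "is_cutoff a h \<theta> \<theta>' \<theta>'' B" "h < T" "B \<ge> 0"
    using cutoff_exists[OF a] by metis
  obtain G1 \<phi>1 e1 where wd1: "weak_data (ball c1 r1) T u1 G1 \<phi>1 e1"
    and weak1: "weak_wave_eq (ball c1 r1) (indicator (ball p \<eta>)) T G1"
    by (rule weak_solution_data[OF ws1 pos(4)])
  obtain G2 \<phi>2 e2 where wd2: "weak_data (ball c2 r2) T u2 G2 \<phi>2 e2"
    and weak2: "weak_wave_eq (ball c2 r2) (indicator (ball p \<eta>)) T G2"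
    by (rule weak_solution_data[OF ws2 pos(4)])
  have cl: "closure (ball c1 r1) = cball c1 r1" "closure (ball c2 r2) = cball c2 r2"
    using pos by auto
  have bys: "ball y \<gamma> \<subseteq> - closure (ball c1 r1)" "ball y \<gamma> \<subseteq> - closure (ball c2 r2)"
    using \<gamma>(3) away unfolding cl by auto
  have eq': "AE z in lborel. z \<in> ball y \<gamma> \<times> {0<..<T} \<longrightarrow> u1 z = u2 z"
    using eq by (rule AE_mp) (use \<gamma>(3) in \<open>auto intro!: AE_I2\<close>)

  \<comment> \<open>The net lies in the open ball although it covers the sphere: each of its points
    is then the centre of a ball of positive radius inside the obstacle, as the potentials
    require.\<close>
  obtain Z where Z: "Z \<subseteq> ball c2 r2" "finite Z" "sphere c2 r2 \<subseteq> (\<Union>z\<in>Z. ball z \<gamma>)"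
  proof (rule compactE_image[of "sphere c2 r2" "ball c2 r2" "\<lambda>z. ball z \<gamma>"])
    show "sphere c2 r2 \<subseteq> (\<Union>z\<in>ball c2 r2. ball z \<gamma>)"
    proof
      fix x assume "x \<in> sphere c2 r2"
      then have "x \<in> closure (ball c2 r2)" unfolding cl by auto
      then obtain z where "z \<in> ball c2 r2" "dist z x < \<gamma>" using \<gamma>0 unfolding closure_approachable by blast
      then show "x \<in> (\<Union>z\<in>ball c2 r2. ball z \<gamma>)" by auto
    qed
  qed auto
  define \<rho> where "\<rho> z = r2 - dist c2 z" for z
  have \<rho>: "\<rho> w > 0" "cball w (\<rho> w) \<subseteq> cball c2 r2" if "w \<in> Z" for w
    using Z(1) that by (auto simp: \<rho>_def cball_subset_cball_iff dist_commute)
  define \<rho>1 where "\<rho>1 = r1 - dist c1 z"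
  have \<rho>1: "\<rho>1 > 0" "cball z \<rho>1 \<subseteq> cball c1 r1"
    using z by (auto simp: \<rho>1_def cball_subset_cball_iff dist_commute)
  define \<kappa> where "\<kappa> = \<rho>1 / (\<rho>1 + dist z p)"
  have \<kappa>: "\<kappa> > 0" using \<rho>1 by (simp add: \<kappa>_def add_pos_nonneg)
  define \<kappa>1 where "\<kappa>1 = \<kappa> / (dist z y + \<gamma>)"
  have \<kappa>1: "\<kappa>1 > 0" using \<kappa> \<gamma>0 by (simp add: \<kappa>1_def add_nonneg_pos)
  define CZ where "CZ = (\<Sum>w\<in>Z. \<gamma> / \<eta> / \<rho> w)"
  have CZ: "CZ \<ge> 0" unfolding CZ_def using \<gamma>0 pos less_imp_le[OF \<rho>(1)] by (intro sum_nonneg) auto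
  define V where "V = measure lborel (ball y \<gamma>)"
  have V: "V > 0" unfolding V_def using \<gamma>0 by (rule content_ball_pos)
  define U where "U = (LINT z|restrict_space lborel ((- closure (ball c1 r1)) \<times> {0<..<T}). (u1 z)\<^sup>2)
      + (LINT z|restrict_space lborel ((- closure (ball c2 r2)) \<times> {0<..<T}). (u2 z)\<^sup>2)"
  have U: "U \<ge> 0" unfolding U_def by simp

  have key: "(bp_mass \<tau> \<eta> * exp (- (\<tau> * (m1 + \<gamma>))) * (\<kappa>1 - CZ * exp (- (\<tau> * (m2 - m1 - 4 * \<gamma>)))) - exp (- (\<tau> * a))) * V
       \<le> exp (- (\<tau> * a)) * ((4 + B * T) * V + 4 * T * B\<^sup>2 * U * (1 + 2 * \<tau>)\<^sup>2)" if \<tau>: "\<tau> \<ge> 1" for \<tau>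
  proof -
    have \<tau>0: "\<tau> > 0" using \<tau> by simp
    define K where "K = bp_mass \<tau> \<eta>"
    have K: "K > 0" using bp_mass_pos[OF \<tau>0 pos(3)] by (simp add: K_def)
    define \<epsilon> where "\<epsilon> = exp (- (\<tau> * a))"
    have eps: "\<epsilon> > 0" by (simp add: \<epsilon>_def)
    define v where "v = ball_potential \<tau> \<eta> p"
    define h1 where "h1 x = \<kappa> * exp (- (\<tau> * dist z p)) * ball_potential \<tau> \<rho>1 z x" for x
    \<comment> \<open>If \<open>x\<close> on the sphere is within \<open>\<gamma>\<close> of
      \<open>w\<close>, the path from \<open>p\<close> over \<open>w\<close> to \<open>x\<close>
      exceeds \<open>dist x p\<close> by at most \<open>2 * \<gamma>\<close>. The reduced damping
      and the prefactor \<open>\<gamma> / \<eta>\<close> make up for this, so a single summand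
      dominates \<open>v\<close> there.\<close>
    define H2 where "H2 x = (\<Sum>w\<in>Z. \<gamma> / \<eta> * exp (- (\<tau> * (dist w p - 2 * \<gamma>))) * ball_potential \<tau> (\<rho> w) w x)" for x
    define k1 where "k1 x = K * v x + (- (K * \<kappa> * exp (- (\<tau> * dist z p)))) * ball_potential \<tau> \<rho>1 z x" for x
    \<comment> \<open>A negative constant keeps a subsolution a subsolution. It makes
      \<open>k2\<close> negative on the sphere and far away, so that the exterior region where
      \<open>k2\<close> is nonnegative is compact and off the obstacle.\<close>
    define k2 where "k2 x = 1 * (K * v x + (- K) * H2 x) + (-1) * \<epsilon>" for x
    have hv: "helmholtz_weak \<tau> U v (ball_potential_grad \<tau> \<eta> p) (\<lambda>\<psi>. (LINT x|lborel. indicator (cball p \<eta>) x * \<psi> x) / K)" for U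
      unfolding v_def K_def by (rule helmholtz_weak_ball_potential[OF \<tau>0 pos(3)])
    have hz: "helmholtz_weak \<tau> (- closure (ball c1 r1)) (ball_potential \<tau> \<rho>1 z) (ball_potential_grad \<tau> \<rho>1 z) (\<lambda>_. 0)"
      by (rule helmholtz_weak_ball_potential_away[OF \<tau>0 \<rho>1(1)]) (use \<rho>1(2) in \<open>auto simp: cl\<close>)
    have hH: "helmholtz_weak \<tau> (- closure (ball c2 r2)) H2
        (\<lambda>x. \<Sum>w\<in>Z. (\<gamma> / \<eta> * exp (- (\<tau> * (dist w p - 2 * \<gamma>)))) *\<^sub>R ball_potential_grad \<tau> (\<rho> w) w x) (\<lambda>_. 0)"
      unfolding H2_def[abs_def]
      by (rule helmholtz_weak_sum[OF Z(2)], rule helmholtz_weak_ball_potential_away[OF \<tau>0])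
        (use \<rho> in \<open>auto simp: cl\<close>)
    note hk1 = helmholtz_weak_lin[OF hv hz, of K "- (K * \<kappa> * exp (- (\<tau> * dist z p)))", folded k1_def]
    note hk2 = helmholtz_weak_lin[OF helmholtz_weak_lin[OF hv hH, of K "- K"] helmholtz_weak_const[of \<tau> _ \<epsilon>], of 1 "-1", folded k2_def]
    have src: "(LINT x|lborel. indicator (ball p \<eta>) x * \<psi> x) = (LINT x|lborel. indicator (cball p \<eta>) x * \<psi> x)"
      if "test_fun X \<psi> g" for X \<psi> g
    proof -
      have "\<psi> \<in> borel_measurable borel"
        using that C1_withD(3) unfolding test_fun_def by (blast intro: borel_measurable_continuous_onI)
      then show ?thesis using integral_ball_cball by metis
    qed
    have vsphere: "v x \<le> H2 x" if x: "x \<in> sphere c2 r2" for x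
    proof -
      obtain w where w: "w \<in> Z" "dist w x < \<gamma>" using Z(3) x by auto
      have dw: "dist x w \<ge> \<rho> w" using x dist_triangle[of c2 x w] by (simp add: \<rho>_def dist_commute)
      have dp: "dist x p \<ge> \<eta>" using far2 x by auto
      have dpos: "dist x w > 0" using dw \<rho>(1)[OF w(1)] by linarith
      have "v x = exp (- (\<tau> * dist x p)) * (1 / dist x p)"
        unfolding v_def using ball_potential_outside[OF \<tau>0 pos(3) dp] by simp
      also have "\<dots> \<le> exp (- (\<tau> * (dist w p - \<gamma>))) * (1 / \<eta>)"
      proof (intro mult_mono)
        have "dist w p - \<gamma> \<le> dist x p" using dist_triangle[of w p x] w(2) by linarith
        then show "exp (- (\<tau> * dist x p)) \<le> exp (- (\<tau> * (dist w p - \<gamma>)))" using \<tau>0 by simp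
        have "dist x p > 0" using dp pos by linarith
        then show "1 / dist x p \<le> 1 / \<eta>" using dp pos by (intro divide_left_mono mult_pos_pos) auto
      qed auto
      also have "\<dots> = \<gamma> / \<eta> * exp (- (\<tau> * (dist w p - 2 * \<gamma>))) * (exp (- (\<tau> * \<gamma>)) * (1 / \<gamma>))"
        using \<gamma>0 by (simp add: algebra_simps flip: exp_add)
      also have "\<dots> \<le> \<gamma> / \<eta> * exp (- (\<tau> * (dist w p - 2 * \<gamma>))) * (exp (- (\<tau> * dist x w)) * (1 / dist x w))"
      proof (intro mult_left_mono mult_mono)
        show "exp (- (\<tau> * \<gamma>)) \<le> exp (- (\<tau> * dist x w))" using w(2) \<tau>0 by (simp add: dist_commute)
        show "1 / \<gamma> \<le> 1 / dist x w" using w(2) dpos \<gamma>0 by (intro divide_left_mono) (auto simp: dist_commute)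
      qed (use \<gamma>0 pos in auto)
      also have "\<dots> = \<gamma> / \<eta> * exp (- (\<tau> * (dist w p - 2 * \<gamma>))) * ball_potential \<tau> (\<rho> w) w x"
        using ball_potential_outside[OF \<tau>0 \<rho>(1)[OF w(1)] dw] by simp
      also have "\<dots> \<le> H2 x"
        unfolding H2_def using \<gamma>0 pos ball_potential_pos[OF \<tau>0 \<rho>(1)] w(1) Z(2)
        by (intro member_le_sum) (auto intro!: mult_nonneg_nonneg less_imp_le)
      finally show ?thesis .
    qed
    have H2nn: "H2 x \<ge> 0" for x
      unfolding H2_def using \<gamma>0 pos ball_potential_pos[OF \<tau>0 \<rho>(1)]
      by (intro sum_nonneg) (auto intro!: mult_nonneg_nonneg less_imp_le)
    have ck2: "continuous_on UNIV k2" using hk2 C1_withD(3) unfolding helmholtz_weak_def by blast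
    define K0 where "K0 = {x. x \<in> - ball c2 r2 \<and> k2 x \<ge> 0}"
    have K0c: "compact K0"
    proof -
      have "closed (- ball c2 r2)" by (intro closed_Compl open_ball)
      moreover have "closed {x. k2 x \<ge> 0}" using ck2 by (intro closed_Collect_le continuous_intros) auto
      moreover have "K0 = - ball c2 r2 \<inter> {x. k2 x \<ge> 0}" by (auto simp: K0_def)
      ultimately have "closed K0" by (simp only: closed_Int)
      moreover have "K0 \<subseteq> cball p (max \<eta> (K / \<epsilon>))"
      proof
        fix x assume "x \<in> K0"
        then have "K * v x - K * H2 x - \<epsilon> \<ge> 0" by (simp add: K0_def k2_def)
        moreover have "K * H2 x \<ge> 0" using K H2nn by simp
        ultimately have kv: "\<epsilon> \<le> K * v x" by linarith
        show "x \<in> cball p (max \<eta> (K / \<epsilon>))"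
        proof (cases "dist x p \<ge> \<eta>")
          case True
          then have d0: "dist x p > 0" using pos by linarith
          have "v x \<le> 1 / dist x p"
            unfolding v_def ball_potential_outside[OF \<tau>0 pos(3) True] using d0 \<tau>0
            by (intro divide_right_mono) auto
          then have "\<epsilon> \<le> K * (1 / dist x p)" using kv K by (meson mult_left_mono less_imp_le order_trans)
          then have "dist x p \<le> K / \<epsilon>" using d0 eps by (simp add: field_simps)
          then show ?thesis by (simp add: dist_commute)
        qed (simp add: dist_commute)
      qed
      ultimately show ?thesis
        using bounded_subset[OF bounded_cball] compact_eq_bounded_closed by blast
    qed
    have K0s: "K0 \<subseteq> - closure (ball c2 r2)"
    proof
      fix x assume x: "x \<in> K0"
      have "x \<notin> sphere c2 r2"
      proof
        assume "x \<in> sphere c2 r2"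
        then have "K * v x \<le> K * H2 x" using vsphere K by (intro mult_left_mono) auto
        then show False using x eps by (simp add: K0_def k2_def)
      qed
      then show "x \<in> - closure (ball c2 r2)" using x unfolding cl K0_def by auto
    qed
    have k1nn: "k1 x \<ge> 0" if "x \<notin> closure (ball c1 r1)" for x
    proof -
      have "h1 x \<le> v x"
        unfolding h1_def v_def \<kappa>_def \<rho>1_def
        by (rule lower_barrier_le[OF \<tau>0 pos(3) z]) (use that far1[of z] z closure_subset[of "ball c1 r1"] in auto)
      then have "K * h1 x \<le> K * v x" using K by (intro mult_left_mono) auto
      then show ?thesis by (simp add: k1_def h1_def mult_ac)
    qed
    \<comment> \<open>\<open>h1\<close> loses \<open>\<gamma>\<close> in the exponent because
      \<open>x\<close> replaces \<open>y\<close>; \<open>H2\<close> loses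
      \<open>2 * \<gamma>\<close> by its damping and a further \<open>\<gamma>\<close> here. What
      remains is the advantage \<open>m2 - m1 - 4 * \<gamma> > 0\<close>.\<close>
    have L: "K * exp (- (\<tau> * (m1 + \<gamma>))) * (\<kappa>1 - CZ * exp (- (\<tau> * (m2 - m1 - 4 * \<gamma>)))) - \<epsilon> \<le> k2 x - k1 x"
      if x: "x \<in> ball y \<gamma>" for x
    proof -
      have xn: "x \<notin> cball c1 r1" "x \<notin> cball c2 r2" using bys x unfolding cl by auto
      have dz: "dist x z \<ge> \<rho>1" using xn(1) dist_triangle[of c1 x z] by (simp add: \<rho>1_def dist_commute)
      then have dz0: "dist x z > 0" using \<rho>1(1) by linarith
      have xz: "dist x z \<le> dist z y + \<gamma>" using dist_triangle[of x z y] x by (simp add: dist_commute)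
      have 1: "exp (- (\<tau> * (m1 + \<gamma>))) * \<kappa>1 \<le> h1 x"
      proof -
        have "h1 x = exp (- (\<tau> * (dist z p + dist x z))) * (\<kappa> / dist x z)"
          unfolding h1_def ball_potential_outside[OF \<tau>0 \<rho>1(1) dz]
          by (simp add: distrib_left exp_add exp_diff field_simps exp_minus)
        moreover have "exp (- (\<tau> * (m1 + \<gamma>))) * \<kappa>1 \<le> exp (- (\<tau> * (dist z p + dist x z))) * (\<kappa> / dist x z)"
        proof (intro mult_mono)
          have "dist z p + dist x z \<le> m1 + \<gamma>" using xz by (simp add: m1_def phi_def dist_commute)
          then show "exp (- (\<tau> * (m1 + \<gamma>))) \<le> exp (- (\<tau> * (dist z p + dist x z)))" using \<tau>0 by simp
          show "\<kappa>1 \<le> \<kappa> / dist x z" unfolding \<kappa>1_def using xz dz0 \<kappa> \<gamma>0 by (intro divide_left_mono) (auto intro!: mult_pos_pos add_nonneg_pos)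
        qed (use \<kappa>1 in auto)
        ultimately show ?thesis by simp
      qed
      have 2: "H2 x \<le> exp (- (\<tau> * (m2 - 3 * \<gamma>))) * CZ"
      proof -
        have "H2 x \<le> (\<Sum>w\<in>Z. exp (- (\<tau> * (m2 - 3 * \<gamma>))) * (\<gamma> / \<eta> / \<rho> w))"
          unfolding H2_def
        proof (rule sum_mono)
          fix w assume w: "w \<in> Z"
          have dw: "dist x w \<ge> \<rho> w" using xn(2) dist_triangle[of c2 x w] by (simp add: \<rho>_def dist_commute)
          have "m2 \<le> dist w p + dist w y" using m2[of w] w Z(1) by (auto simp: phi_def dist_commute)
          moreover have "dist w y \<le> dist x w + \<gamma>" using dist_triangle[of w y x] x by (simp add: dist_commute)
          ultimately have d: "m2 - 3 * \<gamma> \<le> (dist w p - 2 * \<gamma>) + dist x w" by linarith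
          have "\<gamma> / \<eta> * exp (- (\<tau> * (dist w p - 2 * \<gamma>))) * ball_potential \<tau> (\<rho> w) w x
             = exp (- (\<tau> * ((dist w p - 2 * \<gamma>) + dist x w))) * (\<gamma> / \<eta> / dist x w)"
            unfolding ball_potential_outside[OF \<tau>0 \<rho>(1)[OF w] dw] by (simp add: algebra_simps flip: exp_add)
          also have "\<dots> \<le> exp (- (\<tau> * (m2 - 3 * \<gamma>))) * (\<gamma> / \<eta> / \<rho> w)"
          proof (intro mult_mono)
            show "exp (- (\<tau> * ((dist w p - 2 * \<gamma>) + dist x w))) \<le> exp (- (\<tau> * (m2 - 3 * \<gamma>)))" using d \<tau>0 by simp
            have "dist x w > 0" using dw \<rho>(1)[OF w] by linarith
            then show "\<gamma> / \<eta> / dist x w \<le> \<gamma> / \<eta> / \<rho> w"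
              using dw \<rho>(1)[OF w] \<gamma>0 pos by (intro divide_left_mono mult_pos_pos) auto
          qed (use \<gamma>0 pos in auto)
          finally show "\<gamma> / \<eta> * exp (- (\<tau> * (dist w p - 2 * \<gamma>))) * ball_potential \<tau> (\<rho> w) w x
             \<le> exp (- (\<tau> * (m2 - 3 * \<gamma>))) * (\<gamma> / \<eta> / \<rho> w)" .
        qed
        then show ?thesis by (simp add: CZ_def sum_distrib_left)
      qed
      have e3: "exp (- (\<tau> * (m2 - 3 * \<gamma>))) = exp (- (\<tau> * (m1 + \<gamma>))) * exp (- (\<tau> * (m2 - m1 - 4 * \<gamma>)))"
        by (simp add: algebra_simps flip: exp_add)
      have "exp (- (\<tau> * (m1 + \<gamma>))) * (\<kappa>1 - CZ * exp (- (\<tau> * (m2 - m1 - 4 * \<gamma>))))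
          = exp (- (\<tau> * (m1 + \<gamma>))) * \<kappa>1 - exp (- (\<tau> * (m2 - 3 * \<gamma>))) * CZ"
        unfolding e3 by (simp add: algebra_simps)
      also have "\<dots> \<le> h1 x - H2 x" using 1 2 by linarith
      finally have "K * (exp (- (\<tau> * (m1 + \<gamma>))) * (\<kappa>1 - CZ * exp (- (\<tau> * (m2 - m1 - 4 * \<gamma>))))) \<le> K * (h1 x - H2 x)"
        using K by (intro mult_left_mono) auto
      moreover have "k2 x - k1 x = K * (h1 x - H2 x) - \<epsilon>"
        by (simp add: k1_def k2_def h1_def algebra_simps)
      ultimately show ?thesis by (simp add: mult.assoc)
    qed
    show ?thesis
      unfolding K_def[symmetric] V_def U_def \<epsilon>_def[symmetric]
    proof (rule two_obstacle_bound[OF wd1 wd2 weak1 weak2 cut a(1) \<tau> bys eq' hk1 _ k1nn hk2 _ K0c K0s _ L, folded \<epsilon>_def])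
      fix \<psi> g assume t: "test_fun (- closure (ball c1 r1)) \<psi> g"
      show "(LINT x|lborel. indicator (ball p \<eta>) x * \<psi> x)
         \<le> K * ((LINT x|lborel. indicator (cball p \<eta>) x * \<psi> x) / K) + - (K * \<kappa> * exp (- (\<tau> * dist z p))) * 0"
        using src[OF t] K by simp
    next
      fix \<psi> g assume t: "test_fun (- closure (ball c2 r2)) \<psi> g"
      show "1 * (K * ((LINT x|lborel. indicator (cball p \<eta>) x * \<psi> x) / K) + - K * 0) + -1 * (\<tau>\<^sup>2 * \<epsilon> * integral\<^sup>L lborel \<psi>)
         \<le> (LINT x|lborel. indicator (ball p \<eta>) x * \<psi> x)"
        using src[OF t] K eps test_fun_integrable(2)[OF t] by simp
    next
      fix x assume "x \<in> - closure (ball c2 r2) - K0"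
      then show "k2 x \<le> 0" unfolding cl K0_def by auto
    qed
  qed

  \<comment> \<open>\<open>Q\<close> collects the constants: once the bracket in \<open>key\<close>
    is bounded below by \<open>\<kappa>1 / 2\<close> and \<open>bp_mass\<close> by
    \<open>bp_mass_lower\<close>, the inequality would force
    \<open>exp (\<tau> * \<gamma>) / \<tau> ^ 3\<close> to be at most
    \<open>Q * (1 + 2 * \<tau>)\<^sup>2\<close> for all large \<open>\<tau>\<close>.\<close>
  define Q where "Q = ((5 + B * T) * V + 4 * T * B\<^sup>2 * U + 1) * 4 / (\<kappa>1 * V)"
  have Q: "Q > 0" unfolding Q_def using V \<kappa>1 U cut(3) pos by (intro divide_pos_pos mult_pos_pos add_nonneg_pos add_nonneg_nonneg mult_nonneg_nonneg) auto
  have "eventually (\<lambda>\<tau>. CZ * exp (- (\<tau> * (m2 - m1 - 4 * \<gamma>))) \<le> \<kappa>1 / 2) at_top"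
  proof -
    have "m2 - m1 - 4 * \<gamma> > 0" using \<gamma>(1) \<gamma>0 by linarith
    then have "((\<lambda>\<tau>. CZ * exp (- (\<tau> * (m2 - m1 - 4 * \<gamma>)))) \<longlongrightarrow> 0) at_top"
      by real_asymp
    then have "eventually (\<lambda>\<tau>. CZ * exp (- (\<tau> * (m2 - m1 - 4 * \<gamma>))) < \<kappa>1 / 2) at_top"
      by (rule order_tendstoD(2)) (use \<kappa>1 in simp)
    then show ?thesis by eventually_elim simp
  qed
  moreover have "eventually (\<lambda>\<tau>::real. \<tau> \<ge> max 1 (2 / \<eta>)) at_top" by (rule eventually_ge_at_top)
  moreover have "eventually (\<lambda>\<tau>. Q * (1 + 2 * \<tau>)\<^sup>2 < exp (\<tau> * \<gamma>) / \<tau> ^ 3) at_top"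
    using Q \<gamma>0 by real_asymp
  ultimately have "eventually (\<lambda>\<tau>::real. False) at_top"
  proof eventually_elim
    fix \<tau> :: real
    assume t1: "CZ * exp (- (\<tau> * (m2 - m1 - 4 * \<gamma>))) \<le> \<kappa>1 / 2" and t2: "max 1 (2 / \<eta>) \<le> \<tau>"
      and t3: "Q * (1 + 2 * \<tau>)\<^sup>2 < exp (\<tau> * \<gamma>) / \<tau> ^ 3"
    have \<tau>: "\<tau> \<ge> 1" "\<tau> * \<eta> \<ge> 2" using t2 pos by (auto simp: field_simps)
    define P where "P = (1 + 2 * \<tau>)\<^sup>2"
    have P: "P \<ge> 1" unfolding P_def using \<tau> by (intro one_le_power) auto
    have K: "bp_mass \<tau> \<eta> \<ge> exp (\<tau> * \<eta>) / (2 * \<tau> ^ 3)" using \<tau> by (intro bp_mass_lower) auto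
    define X where "X = bp_mass \<tau> \<eta> * exp (- (\<tau> * (m1 + \<gamma>)))"
    have X: "X \<ge> exp (- (\<tau> * a)) * (exp (\<tau> * \<gamma>) / (2 * \<tau> ^ 3))"
    proof -
      have "exp (\<tau> * \<eta>) / (2 * \<tau> ^ 3) * exp (- (\<tau> * (m1 + \<gamma>))) \<le> X"
        unfolding X_def using K by (intro mult_right_mono) auto
      moreover have "exp (\<tau> * \<eta>) * exp (- (\<tau> * (m1 + \<gamma>))) = exp (- (\<tau> * a)) * exp (\<tau> * \<gamma>)"
        unfolding a_def by (simp add: algebra_simps flip: exp_add)
      ultimately show ?thesis by simp
    qed
    define E where "E = exp (- (\<tau> * a))"
    have E: "E > 0" by (simp add: E_def)
    have X0: "X \<ge> 0" using X \<tau> E unfolding E_def[symmetric] by (smt (verit) divide_nonneg_nonneg exp_ge_zero mult_nonneg_nonneg zero_le_power)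
    have "(X * (\<kappa>1 / 2) - E) * V \<le> (X * (\<kappa>1 - CZ * exp (- (\<tau> * (m2 - m1 - 4 * \<gamma>)))) - E) * V"
      using t1 X0 V by (intro mult_right_mono diff_right_mono mult_left_mono) auto
    also have "\<dots> \<le> E * ((4 + B * T) * V + 4 * T * B\<^sup>2 * U * P)"
      using key[OF \<tau>(1)] unfolding X_def E_def P_def .
    finally have "X * (\<kappa>1 / 2) * V \<le> E * ((5 + B * T) * V + 4 * T * B\<^sup>2 * U * P)"
      by (simp add: algebra_simps)
    also have "\<dots> \<le> E * (((5 + B * T) * V + 4 * T * B\<^sup>2 * U + 1) * P)"
    proof (intro mult_left_mono)
      have n1: "0 \<le> (5 + B * T) * V" using V cut(3) pos by simp
      have "(5 + B * T) * V * 1 \<le> (5 + B * T) * V * P" using P n1 by (intro mult_left_mono) auto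
      then show "(5 + B * T) * V + 4 * T * B\<^sup>2 * U * P \<le> ((5 + B * T) * V + 4 * T * B\<^sup>2 * U + 1) * P"
        using P by (simp add: distrib_right)
    qed (use E in simp)
    also have "\<dots> = E * (Q * P) * (\<kappa>1 * V / 4)"
      unfolding Q_def using V \<kappa>1 by simp
    also have "\<dots> < E * (exp (\<tau> * \<gamma>) / \<tau> ^ 3) * (\<kappa>1 * V / 4)"
      using t3 E V \<kappa>1 unfolding P_def by (intro mult_strict_right_mono mult_strict_left_mono) auto
    also have "\<dots> = E * (exp (\<tau> * \<gamma>) / (2 * \<tau> ^ 3)) * (\<kappa>1 / 2 * V)" by simp
    also have "\<dots> \<le> X * (\<kappa>1 / 2 * V)"
      using X V \<kappa>1 unfolding E_def by (intro mult_right_mono) auto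
    finally show False by (simp add: mult.assoc)
  qed
  then show False by simp
qed



section \<open>Recovering the ball from first arrival times\<close>

text \<open>The minimum is over the closed ball, a convex set, so that optimality can be tested
  along segments and nested balls are easily compared. If the segment from \<open>p\<close> to
  \<open>y\<close> misses the ball, minimisers lie on the sphere, by
  \<open>phi_min_on_sphere\<close>.\<close>

definition phi_min :: "real^3 \<Rightarrow> real \<Rightarrow> real^3 \<Rightarrow> real^3 \<Rightarrow> real^3 \<Rightarrow> bool" where
  "phi_min c r p y x \<longleftrightarrow> x \<in> cball c r \<and> (\<forall>w\<in>cball c r. phi x p y \<le> phi w p y)"

lemma phi_min_exists:
  assumes "r > 0"
  shows "\<exists>x. phi_min c r p y x"
proof -
  have "continuous_on (cball c r) (\<lambda>x. phi x p y)"
    unfolding phi_def by (intro continuous_intros)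
  then show ?thesis
    using continuous_attains_inf[of "cball c r" "\<lambda>x. phi x p y"] assms
    unfolding phi_min_def by (metis cball_eq_empty compact_cball less_le_not_le order_less_imp_not_less)
qed

text \<open>From \<open>2 N X \<le> N\<^sup>2 + X\<^sup>2\<close> with \<open>N = norm v\<close> and
  \<open>X\<close> the norm on the left: a first-order expansion with quadratic remainder, so that
  no distance has to be differentiated.\<close>

lemma norm_add_scaleR_upper:
  fixes v d :: "'a::real_inner"
  assumes "v \<noteq> 0"
  shows "norm (v + t *\<^sub>R d) \<le> norm v + t * (v \<bullet> d) / norm v + t\<^sup>2 * (norm d)\<^sup>2 / (2 * norm v)"
proof -
  define N where "N = norm v"
  have N: "N > 0" using assms by (simp add: N_def)
  define X where "X = norm (v + t *\<^sub>R d)"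
  have "X\<^sup>2 = N\<^sup>2 + 2 * t * (v \<bullet> d) + t\<^sup>2 * (norm d)\<^sup>2"
    unfolding X_def N_def power2_norm_eq_inner
    by (simp add: inner_simps inner_commute power2_eq_square algebra_simps)
  moreover have "2 * N * X \<le> X\<^sup>2 + N\<^sup>2" using sum_squares_bound[of N X] by (simp add: algebra_simps)
  ultimately have "2 * N * X \<le> 2 * N * N + 2 * t * (v \<bullet> d) + t\<^sup>2 * (norm d)\<^sup>2"
    by (simp add: power2_eq_square)
  then have "X \<le> (2 * N * N + 2 * t * (v \<bullet> d) + t\<^sup>2 * (norm d)\<^sup>2) / (2 * N)"
    using N by (simp add: le_divide_eq mult_ac)
  also have "\<dots> = N + t * (v \<bullet> d) / N + t\<^sup>2 * (norm d)\<^sup>2 / (2 * N)"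
    using N by (simp add: add_divide_distrib)
  finally show ?thesis unfolding X_def N_def .
qed

lemma nonneg_of_quadratic:
  fixes g C :: real
  assumes "\<And>t. 0 < t \<Longrightarrow> t \<le> 1 \<Longrightarrow> 0 \<le> t * g + t\<^sup>2 * C"
  shows "g \<ge> 0"
proof (rule ccontr)
  assume "\<not> g \<ge> 0"
  then have g: "g < 0" by simp
  define k where "k = \<bar>C\<bar> + 1"
  have k: "k > 0" "C \<le> k" by (auto simp: k_def)
  define t where "t = min 1 (- g / (2 * k))"
  have t: "0 < t" "t \<le> 1" using g k by (auto simp: t_def intro!: divide_neg_pos)
  have "t * k \<le> - g / (2 * k) * k"
    using k by (intro mult_right_mono) (auto simp: t_def)
  also have "\<dots> = - g / 2" using k by simp
  finally have 1: "t * k \<le> - g / 2" .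
  have "0 \<le> t * (g + t * C)" using assms[OF t] by (simp add: algebra_simps power2_eq_square)
  then have "0 \<le> g + t * C" using t by (simp add: zero_le_mult_iff)
  moreover have "t * C \<le> t * k" using t k by (intro mult_left_mono) auto
  ultimately show False using 1 g by linarith
qed

definition phi_grad :: "real^3 \<Rightarrow> real^3 \<Rightarrow> real^3 \<Rightarrow> real^3" where
  "phi_grad x p y = (1 / norm (x - p)) *\<^sub>R (x - p) + (1 / norm (x - y)) *\<^sub>R (x - y)"

text \<open>The law of reflection: at a minimiser the inward normal bisects the directions of
  \<open>x - p\<close> and \<open>x - y\<close>. A vanishing gradient would put \<open>x\<close> on
  the segment; by convexity of the ball, first-order optimality reads
  \<open>g \<bullet> (w - x) \<ge> 0\<close> for all its points \<open>w\<close>.\<close>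

lemma phi_min_normal:
  assumes m: "phi_min c r p y x" and r: "r > 0" and seg: "closed_segment p y \<inter> cball c r = {}"
  shows "phi_grad x p y \<noteq> 0" "c - x = (r / norm (phi_grad x p y)) *\<^sub>R phi_grad x p y"
proof -
  have x: "x \<in> cball c r" using m by (simp add: phi_min_def)
  then have ns: "x \<notin> closed_segment p y" using seg by blast
  then have n0: "x - p \<noteq> 0" "x - y \<noteq> 0" by auto
  define g where "g = phi_grad x p y"
  have g0: "g \<noteq> 0"
  proof
    assume "g = 0"
    define A where "A = norm (x - p)"
    define B where "B = norm (x - y)"
    have AB: "A > 0" "B > 0" using n0 by (auto simp: A_def B_def)
    have "(A * B) *\<^sub>R g = B *\<^sub>R (x - p) + A *\<^sub>R (x - y)"
      unfolding g_def phi_grad_def A_def[symmetric] B_def[symmetric] using AB by (simp add: scaleR_add_right)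
    then have "(A + B) *\<^sub>R x = B *\<^sub>R p + A *\<^sub>R y" using \<open>g = 0\<close> by (simp add: algebra_simps)
    then have "(1 / (A + B)) *\<^sub>R (A + B) *\<^sub>R x = (1 / (A + B)) *\<^sub>R (B *\<^sub>R p + A *\<^sub>R y)" by simp
    then have "x = (B / (A + B)) *\<^sub>R p + (A / (A + B)) *\<^sub>R y" using AB by (simp add: scaleR_add_right)
    moreover have "B / (A + B) = 1 - A / (A + B)" using AB by (simp add: field_simps)
    ultimately have "x \<in> closed_segment p y"
      unfolding closed_segment_def using AB by (auto intro!: exI[of _ "A / (A + B)"])
    then show False using ns by blast
  qed
  then show "phi_grad x p y \<noteq> 0" by (simp add: g_def)
  have opt: "g \<bullet> (w - x) \<ge> 0" if w: "w \<in> cball c r" for w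
  proof (rule nonneg_of_quadratic)
    fix t :: real assume t: "0 < t" "t \<le> 1"
    define d where "d = w - x"
    have "x + t *\<^sub>R d = (1 - t) *\<^sub>R x + t *\<^sub>R w" by (simp add: d_def algebra_simps)
    then have "x + t *\<^sub>R d \<in> cball c r"
      using convexD_alt[OF convex_cball x w, of t] t by simp
    then have "phi x p y \<le> phi (x + t *\<^sub>R d) p y" using m by (simp add: phi_min_def)
    moreover have "phi (x + t *\<^sub>R d) p y = norm ((x - p) + t *\<^sub>R d) + norm ((x - y) + t *\<^sub>R d)"
      by (simp add: phi_def dist_norm norm_minus_commute algebra_simps)
    moreover have "phi x p y = norm (x - p) + norm (x - y)" by (simp add: phi_def dist_norm norm_minus_commute)
    moreover note norm_add_scaleR_upper[OF n0(1), of t d] norm_add_scaleR_upper[OF n0(2), of t d]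
    moreover have "t * (g \<bullet> d) = t * ((x - p) \<bullet> d) / norm (x - p) + t * ((x - y) \<bullet> d) / norm (x - y)"
      by (simp add: g_def phi_grad_def inner_add_left distrib_left)
    ultimately have "0 \<le> t * (g \<bullet> d) + (t\<^sup>2 * (norm d)\<^sup>2 / (2 * norm (x - p)) + t\<^sup>2 * (norm d)\<^sup>2 / (2 * norm (x - y)))"
      by linarith
    then show "0 \<le> t * (g \<bullet> (w - x)) + t\<^sup>2 * ((norm d)\<^sup>2 / (2 * norm (x - p)) + (norm d)\<^sup>2 / (2 * norm (x - y)))"
      unfolding d_def[symmetric] by (simp add: distrib_left)
  qed
  \<comment> \<open>The point of the ball where the linear functional \<open>g\<close> is smallest.
    Inserting it forces equality in Cauchy-Schwarz, so \<open>c - x\<close> is parallel to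
    \<open>g\<close> and has full length \<open>r\<close>.\<close>
  define w where "w = c - (r / norm g) *\<^sub>R g"
  have wc: "w \<in> cball c r" using g0 r by (simp add: w_def dist_norm)
  have "0 \<le> g \<bullet> (c - x) - r * norm g"
    using opt[OF wc] g0 by (simp add: w_def inner_diff_right power2_norm_eq_inner[symmetric] power2_eq_square algebra_simps)
  then have ge: "norm g * r \<le> g \<bullet> (c - x)" by (simp add: mult.commute)
  have le: "norm (c - x) \<le> r" using x by (simp add: dist_norm)
  have cs: "g \<bullet> (c - x) \<le> norm g * norm (c - x)" by (rule norm_cauchy_schwarz)
  have "norm g * norm (c - x) \<le> norm g * r" using le by (intro mult_left_mono) auto
  then have e: "g \<bullet> (c - x) = norm g * norm (c - x)" "norm g * norm (c - x) = norm g * r" using ge cs by linarith+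
  then have nr: "norm (c - x) = r" using g0 by simp
  have "norm g *\<^sub>R (c - x) = norm (c - x) *\<^sub>R g" using e(1) norm_cauchy_schwarz_eq by blast
  then have "(1 / norm g) *\<^sub>R norm g *\<^sub>R (c - x) = (1 / norm g) *\<^sub>R r *\<^sub>R g" using nr by simp
  then show "c - x = (r / norm (phi_grad x p y)) *\<^sub>R phi_grad x p y"
    using g0 unfolding g_def[symmetric] by simp
qed

lemma phi_min_on_sphere:
  assumes "phi_min c r p y x" "r > 0" "closed_segment p y \<inter> cball c r = {}"
  shows "dist c x = r"
  using phi_min_normal[OF assms] assms(2) by (simp add: dist_norm)

text \<open>Stepping from \<open>p'\<close> toward \<open>x\<close> shortens the path over
  \<open>x\<close> by exactly \<open>s\<close>, and the path over any other point by at most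
  \<open>s\<close>.\<close>

lemma phi_min_toward:
  assumes m: "phi_min c r p p' x" and s: "0 < s" "s < dist x p'"
  defines "y \<equiv> p' + s *\<^sub>R ((1 / norm (x - p')) *\<^sub>R (x - p'))"
  shows "phi_min c r p y x" "phi x p y = phi x p p' - s"
proof -
  define N where "N = norm (x - p')"
  have N: "N > s" using s by (simp add: N_def dist_norm)
  have "x - y = (1 - s / N) *\<^sub>R (x - p')"
    unfolding y_def N_def[symmetric] by (simp add: algebra_simps)
  moreover have "1 - s / N \<ge> 0" using N s by simp
  ultimately have "dist x y = (1 - s / N) * N" by (simp add: dist_norm N_def)
  also have "\<dots> = N - s" using N s by (simp add: left_diff_distrib)
  finally have d: "dist x y = dist x p' - s" by (simp add: N_def dist_norm)
  then show e: "phi x p y = phi x p p' - s" by (simp add: phi_def)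
  have yp: "dist p' y = s" unfolding y_def N_def[symmetric] using N s by (simp add: dist_norm N_def[symmetric])
  show "phi_min c r p y x"
    unfolding phi_min_def
  proof (intro conjI ballI)
    show "x \<in> cball c r" using m by (simp add: phi_min_def)
    fix w assume "w \<in> cball c r"
    then have "phi x p p' \<le> phi w p p'" using m by (simp add: phi_min_def)
    also have "\<dots> \<le> phi w p y + s" using dist_triangle[of w p' y] yp by (simp add: phi_def dist_commute)
    finally show "phi x p y \<le> phi w p y" using e by linarith
  qed
qed

text \<open>What the waves contribute to the geometry: equal minima on the sphere of receivers. The
  segment conditions cover the whole ball of radius \<open>s\<close>, because reflection is also
  studied at its centre \<open>p'\<close>. Several lemmas are asymmetric in the two balls and are
  applied again with the roles exchanged.\<close>

locale equal_arrival =
  fixes c1 c2 p p' :: "real^3" and r1 r2 s :: real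
  assumes r: "r1 > 0" "r2 > 0" and s: "s > 0"
    and seg1: "\<And>y. y \<in> cball p' s \<Longrightarrow> closed_segment p y \<inter> cball c1 r1 = {}"
    and seg2: "\<And>y. y \<in> cball p' s \<Longrightarrow> closed_segment p y \<inter> cball c2 r2 = {}"
    and far1: "\<And>x. x \<in> cball c1 r1 \<Longrightarrow> s < dist x p'" and far2: "\<And>x. x \<in> cball c2 r2 \<Longrightarrow> s < dist x p'"
    and eqv: "\<And>\<omega> x1 x2. norm \<omega> = 1 \<Longrightarrow> phi_min c1 r1 p (p' + s *\<^sub>R \<omega>) x1 \<Longrightarrow> phi_min c2 r2 p (p' + s *\<^sub>R \<omega>) x2 \<Longrightarrow>
       phi x1 p (p' + s *\<^sub>R \<omega>) = phi x2 p (p' + s *\<^sub>R \<omega>)"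
begin

text \<open>The receiver is the point of the sphere facing \<open>x1\<close>. There the first ball
  has the value \<open>phi x1 p p' - s\<close>, by hypothesis so has the second, and retreating to
  \<open>p'\<close> adds at most \<open>s\<close>.\<close>

lemma center_value_le:
  assumes x1: "phi_min c1 r1 p p' x1"
    and x2: "phi_min c2 r2 p (p' + s *\<^sub>R ((1 / norm (x1 - p')) *\<^sub>R (x1 - p'))) x2"
  shows "phi x2 p p' \<le> phi x1 p p'"
    "phi x2 p (p' + s *\<^sub>R ((1 / norm (x1 - p')) *\<^sub>R (x1 - p'))) = phi x1 p p' - s"
proof -
  define \<omega> where "\<omega> = (1 / norm (x1 - p')) *\<^sub>R (x1 - p')"
  have d: "s < dist x1 p'" using x1 far1 by (simp add: phi_min_def)
  then have n: "norm \<omega> = 1" using s by (auto simp: \<omega>_def dist_norm)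
  note t = phi_min_toward[OF x1 s d, folded \<omega>_def]
  have e: "phi x2 p (p' + s *\<^sub>R \<omega>) = phi x1 p p' - s"
    using eqv[OF n t(1) x2[folded \<omega>_def]] t(2) by simp
  then show "phi x2 p (p' + s *\<^sub>R ((1 / norm (x1 - p')) *\<^sub>R (x1 - p'))) = phi x1 p p' - s"
    by (simp add: \<omega>_def)
  have "dist (p' + s *\<^sub>R \<omega>) p' = s" using n s by (simp add: dist_norm)
  then have "phi x2 p p' \<le> phi x2 p (p' + s *\<^sub>R \<omega>) + s"
    using dist_triangle[of x2 p' "p' + s *\<^sub>R \<omega>"] by (simp add: phi_def)
  then show "phi x2 p p' \<le> phi x1 p p'" using e by linarith
qed

end

text \<open>Equal values mean equality in the triangle inequality for \<open>p\<close> and the two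
  points, so \<open>p\<close> lies on the ray at or beyond the farther one, and the nearer one is
  between \<open>p'\<close> and \<open>p\<close>. Off that segment a point is thus determined by its
  direction from \<open>p'\<close> and its value.\<close>

lemma ray_phi_injective:
  fixes p p' \<omega> :: "real^3"
  assumes n: "norm \<omega> = 1" and t: "0 < t1" "t1 < t2"
    and e: "phi (p' + t1 *\<^sub>R \<omega>) p p' = phi (p' + t2 *\<^sub>R \<omega>) p p'"
  shows "p' + t1 *\<^sub>R \<omega> \<in> closed_segment p p'"
proof -
  define x1 where "x1 = p' + t1 *\<^sub>R \<omega>"
  define x2 where "x2 = p' + t2 *\<^sub>R \<omega>"
  have d: "dist x1 p' = t1" "dist x2 p' = t2" using n t by (auto simp: x1_def x2_def dist_norm)
  have x21: "x2 - x1 = (t2 - t1) *\<^sub>R \<omega>" by (simp add: x1_def x2_def algebra_simps)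
  then have d12: "dist x2 x1 = t2 - t1" using n t by (simp add: dist_norm)
  have "dist p x1 = dist p x2 + dist x2 x1"
    using e d d12 unfolding x1_def[symmetric] x2_def[symmetric] phi_def by linarith
  then have "dist p x2 *\<^sub>R (x2 - x1) = dist x2 x1 *\<^sub>R (p - x2)" unfolding dist_triangle_eq unfolding dist_norm .
  then have "(t2 - t1) *\<^sub>R (dist p x2 *\<^sub>R \<omega>) = (t2 - t1) *\<^sub>R (p - x2)" unfolding x21 d12 by (simp add: mult.commute)
  then have "dist p x2 *\<^sub>R \<omega> = p - x2" by (rule scaleR_left_imp_eq[rotated]) (use t in simp)
  then have "p - x2 = dist p x2 *\<^sub>R \<omega>" ..
  then have p: "p = p' + (t2 + dist p x2) *\<^sub>R \<omega>" by (simp add: x2_def algebra_simps)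
  define l where "l = t2 + dist p x2"
  have l: "l \<ge> t2" "l > 0" using t zero_le_dist[of p x2] unfolding l_def by linarith+
  have "x1 = (1 - (1 - t1 / l)) *\<^sub>R p + (1 - t1 / l) *\<^sub>R p'"
    unfolding x1_def using p l unfolding l_def[symmetric] by (simp add: algebra_simps)
  then show ?thesis unfolding x1_def[symmetric] closed_segment_def
    using l t by (auto intro!: exI[of _ "1 - t1 / l"])
qed

text \<open>\<open>center_value_le\<close> in both directions gives both balls the same minimum at
  \<open>p'\<close>. The minimiser \<open>x2\<close> for the receiver facing \<open>x1\<close> then
  satisfies equality in the triangle inequality, hence lies on the ray from \<open>p'\<close>
  through \<open>x1\<close>, and \<open>ray_phi_injective\<close> identifies it with
  \<open>x1\<close>.\<close>

lemma (in equal_arrival) same_center_minimizer: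
  assumes sym: "equal_arrival c2 c1 p p' r2 r1 s"
  obtains x where "phi_min c1 r1 p p' x" "phi_min c2 r2 p p' x"
proof -
  interpret S: equal_arrival c2 c1 p p' r2 r1 s by (rule sym)
  obtain x1 where x1: "phi_min c1 r1 p p' x1" using phi_min_exists[OF r(1)] by blast
  obtain z2 where z2: "phi_min c2 r2 p p' z2" using phi_min_exists[OF r(2)] by blast
  define \<omega> where "\<omega> = (1 / norm (x1 - p')) *\<^sub>R (x1 - p')"
  define y where "y = p' + s *\<^sub>R \<omega>"
  obtain x2 where x2: "phi_min c2 r2 p y x2" using phi_min_exists[OF r(2)] by blast
  obtain z1 where z1: "phi_min c1 r1 p (p' + s *\<^sub>R ((1 / norm (z2 - p')) *\<^sub>R (z2 - p'))) z1"
    using phi_min_exists[OF r(1)] by blast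
  have a: "phi x2 p p' \<le> phi x1 p p'" "phi x2 p y = phi x1 p p' - s"
    using center_value_le[OF x1 x2[unfolded y_def \<omega>_def]] by (auto simp: y_def \<omega>_def)
  have b: "phi z1 p p' \<le> phi z2 p p'" by (rule S.center_value_le[OF z2 z1])
  have "phi x1 p p' \<le> phi z1 p p'" using x1 z1 by (simp add: phi_min_def)
  moreover have c: "phi z2 p p' \<le> phi x2 p p'" using x2 z2 by (simp add: phi_min_def)
  ultimately have e: "phi x2 p p' = phi x1 p p'" "phi z2 p p' = phi x2 p p'" using a(1) b by linarith+
  have x2m: "phi_min c2 r2 p p' x2" using z2 x2 e(2) by (simp add: phi_min_def)
  have d: "s < dist x1 p'" "s < dist x2 p'" using x1 x2 far1 far2 by (auto simp: phi_min_def)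
  have n: "norm \<omega> = 1" using d(1) s by (auto simp: \<omega>_def dist_norm)
  have yp: "y - p' = s *\<^sub>R \<omega>" "dist y p' = s" using n s by (auto simp: y_def dist_norm)
  have "dist x2 p' = dist x2 y + dist y p'" using a(2) e(1) yp(2) by (simp add: phi_def)
  then have "dist x2 y *\<^sub>R (y - p') = dist y p' *\<^sub>R (x2 - y)" unfolding dist_triangle_eq unfolding dist_norm .
  then have "s *\<^sub>R (dist x2 y *\<^sub>R \<omega>) = s *\<^sub>R (x2 - y)" unfolding yp by (simp add: mult.commute)
  then have "dist x2 y *\<^sub>R \<omega> = x2 - y" by (rule scaleR_left_imp_eq[rotated]) (use s in simp)
  then have "x2 - y = dist x2 y *\<^sub>R \<omega>" ..
  then have x2r: "x2 = p' + (s + dist x2 y) *\<^sub>R \<omega>" by (simp add: y_def algebra_simps)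
  have x1r: "x1 = p' + norm (x1 - p') *\<^sub>R \<omega>" using d(1) s by (auto simp: \<omega>_def dist_norm)
  define t1 t2 where "t1 = norm (x1 - p')" and "t2 = s + dist x2 y"
  have t: "t1 > 0" "t2 > 0" using d(1) s by (auto simp: t1_def t2_def dist_norm add_pos_nonneg)
  have p0: "closed_segment p p' \<inter> cball c1 r1 = {}" "closed_segment p p' \<inter> cball c2 r2 = {}"
    using seg1[of p'] seg2[of p'] s by auto
  have ne: "p' + t1 *\<^sub>R \<omega> \<notin> closed_segment p p'" "p' + t2 *\<^sub>R \<omega> \<notin> closed_segment p p'"
    using p0 x1 x2 x1r x2r unfolding t1_def t2_def phi_min_def by auto
  have pe: "phi (p' + t1 *\<^sub>R \<omega>) p p' = phi (p' + t2 *\<^sub>R \<omega>) p p'"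
    using e(1) x1r x2r unfolding t1_def t2_def by simp
  have "t1 = t2"
    using ray_phi_injective[OF n t(1) _ pe] ray_phi_injective[OF n t(2) _ pe[symmetric]] ne by (cases t1 t2 rule: linorder_cases) auto
  then have "x1 = x2" using x1r x2r by (simp add: t1_def t2_def)
  then show ?thesis using that x1 x2m by blast
qed

text \<open>With \<open>v = w - x\<close>, lying in the ball of radius \<open>r\<close> that touches
  at \<open>x\<close> with inward normal \<open>n\<close> reads
  \<open>|v|\<^sup>2 \<le> 2 r (n \<bullet> v)\<close>; as \<open>n \<bullet> v > 0\<close>,
  enlarging \<open>r\<close> makes it strict.\<close>

lemma tangent_ball_interior:
  fixes x n w :: "'a::real_inner"
  assumes n: "norm n = 1" and r: "0 < r1" "r1 < r2"
    and w: "dist (x + r1 *\<^sub>R n) w \<le> r1" "w \<noteq> x"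
  shows "dist (x + r2 *\<^sub>R n) w < r2"
proof -
  define v where "v = w - x"
  have v: "v \<noteq> 0" using w(2) by (simp add: v_def)
  have d: "(dist (x + r *\<^sub>R n) w)\<^sup>2 = (norm v)\<^sup>2 - 2 * r * (n \<bullet> v) + r\<^sup>2" for r
  proof -
    have "(x + r *\<^sub>R n) - w = r *\<^sub>R n - v" by (simp add: v_def)
    then have "(dist (x + r *\<^sub>R n) w)\<^sup>2 = (r *\<^sub>R n - v) \<bullet> (r *\<^sub>R n - v)"
      by (simp only: dist_norm power2_norm_eq_inner)
    also have "\<dots> = r\<^sup>2 * (norm n)\<^sup>2 - 2 * r * (n \<bullet> v) + (norm v)\<^sup>2"
      unfolding power2_norm_eq_inner by (simp add: inner_simps inner_commute power2_eq_square algebra_simps)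
    finally show ?thesis using n by simp
  qed
  have "(dist (x + r1 *\<^sub>R n) w)\<^sup>2 \<le> r1\<^sup>2" using w(1) r by (intro power_mono) auto
  then have 1: "(norm v)\<^sup>2 \<le> 2 * r1 * (n \<bullet> v)" unfolding d by simp
  have "0 < (norm v)\<^sup>2" using v by simp
  with 1 have "0 < 2 * r1 * (n \<bullet> v)" by linarith
  then have "0 < n \<bullet> v" using r by (simp add: zero_less_mult_iff)
  then have "2 * r1 * (n \<bullet> v) < 2 * r2 * (n \<bullet> v)" using r by simp
  then have "(dist (x + r2 *\<^sub>R n) w)\<^sup>2 < r2\<^sup>2" unfolding d using 1 by linarith
  then show ?thesis using r by (simp add: power_less_imp_less_base)
qed

text \<open>If one ball were strictly inside the other, touching it at \<open>x\<close>, then \<open>x\<close> would be the reflection point for every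
  receiver on the sphere; but the law of reflection at \<open>x\<close> admits only one reflected ray.\<close>

lemma (in equal_arrival) not_smaller:
  assumes x: "phi_min c1 r1 p p' x" "phi_min c2 r2 p p' x"
  shows "\<not> r1 < r2"
proof
  assume lt: "r1 < r2"
  have pin: "p' \<in> cball p' s" using s by simp
  define g where "g = phi_grad x p p'"
  define n where "n = (1 / norm g) *\<^sub>R g"
  have g: "g \<noteq> 0" unfolding g_def by (rule phi_min_normal(1)[OF x(1) r(1) seg1[OF pin]])
  have nn: "norm n = 1" using g by (simp add: n_def)
  have c1: "c1 = x + r1 *\<^sub>R n" and c2: "c2 = x + r2 *\<^sub>R n"
    using phi_min_normal(2)[OF x(1) r(1) seg1[OF pin]] phi_min_normal(2)[OF x(2) r(2) seg2[OF pin]]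
    unfolding g_def[symmetric] n_def by (simp_all add: algebra_simps)
  define A where "A = (1 / norm (x - p)) *\<^sub>R (x - p)"
  define E where "E y = (1 / norm (x - y)) *\<^sub>R (x - y)" for y
  have xp: "x \<noteq> p" using seg1[OF pin] x(1) by (auto simp: phi_min_def)
  have A1: "norm A = 1" using xp by (simp add: A_def)
  have Ey: "E y = (2 * (n \<bullet> A)) *\<^sub>R n - A \<and> x \<noteq> y" if y: "y = p' + s *\<^sub>R \<omega>" "norm \<omega> = 1" for y \<omega>
  proof -
    have yc: "y \<in> cball p' s" using y s by (simp add: dist_norm)
    obtain x1 where x1: "phi_min c1 r1 p y x1" using phi_min_exists[OF r(1)] by blast
    obtain x2 where x2: "phi_min c2 r2 p y x2" using phi_min_exists[OF r(2)] by blast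
    \<comment> \<open>Any other point of the smaller ball lies in the open larger one, where by
      equality of the values it would again be a minimiser; but minimisers lie on the
      sphere.\<close>
    have "x1 = x"
    proof (rule ccontr)
      assume "x1 \<noteq> x"
      moreover have "dist (x + r1 *\<^sub>R n) x1 \<le> r1" using x1 unfolding phi_min_def c1[symmetric] by simp
      ultimately have "dist c2 x1 < r2" unfolding c2 using tangent_ball_interior[OF nn r(1) lt] by blast
      moreover have "phi x1 p y = phi x2 p y" using eqv[OF y(2)] x1 x2 y(1) by simp
      ultimately have "phi_min c2 r2 p y x1" using x2 by (auto simp: phi_min_def)
      then have "dist c2 x1 = r2" by (rule phi_min_on_sphere[OF _ r(2) seg2[OF yc]])
      then show False using \<open>dist c2 x1 < r2\<close> by simp
    qed
    then have x1: "phi_min c1 r1 p y x" using x1 by simp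
    define h where "h = phi_grad x p y"
    have h: "h \<noteq> 0" "c1 - x = (r1 / norm h) *\<^sub>R h"
      unfolding h_def using phi_min_normal[OF x1 r(1) seg1[OF yc]] by auto
    have "r1 *\<^sub>R n = r1 *\<^sub>R ((1 / norm h) *\<^sub>R h)" using h(2) c1 by simp
    then have "n = (1 / norm h) *\<^sub>R h" using r(1) by (simp only: scaleR_cancel_left) simp
    then have hn: "h = norm h *\<^sub>R n" using h(1) by simp
    have xy: "x \<noteq> y" using seg1[OF yc] x1 by (auto simp: phi_min_def)
    have E1: "norm (E y) = 1" using xy by (simp add: E_def)
    have hAE: "h = A + E y" by (simp add: h_def phi_grad_def A_def E_def)
    define \<mu> where "\<mu> = norm h"
    have \<mu>: "\<mu> > 0" using h(1) by (simp add: \<mu>_def)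
    have Eeq: "E y = \<mu> *\<^sub>R n - A" using hAE hn by (simp add: \<mu>_def algebra_simps)
    \<comment> \<open>The unit length of \<open>E y\<close> leaves for \<open>\<mu>\<close> only 0,
      which is excluded, and \<open>2 * (n \<bullet> A)\<close>. So the direction of the reflected
      ray is the same for all receivers on the sphere.\<close>
    have "1 = E y \<bullet> E y" using E1 by (simp add: norm_eq_1)
    also have "\<dots> = \<mu>\<^sup>2 * (n \<bullet> n) - 2 * \<mu> * (n \<bullet> A) + A \<bullet> A"
      unfolding Eeq by (simp add: inner_simps inner_commute power2_eq_square algebra_simps)
    also have "\<dots> = \<mu>\<^sup>2 - 2 * \<mu> * (n \<bullet> A) + 1" using nn A1 by (simp add: norm_eq_1)
    finally have "\<mu>\<^sup>2 - 2 * \<mu> * (n \<bullet> A) = 0" by linarith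
    moreover have "\<mu>\<^sup>2 - 2 * \<mu> * (n \<bullet> A) = \<mu> * (\<mu> - 2 * (n \<bullet> A))"
      by (simp add: power2_eq_square algebra_simps)
    ultimately have "\<mu> - 2 * (n \<bullet> A) = 0" using \<mu> by (metis mult_eq_0_iff less_irrefl)
    then have "\<mu> = 2 * (n \<bullet> A)" by linarith
    then show ?thesis using Eeq xy by simp
  qed
  have d: "s < dist x p'" using x far1 by (simp add: phi_min_def)
  define t where "t = norm (x - p')"
  have t: "t > s" using d by (simp add: t_def dist_norm)
  define \<omega>1 where "\<omega>1 = (1 / t) *\<^sub>R (x - p')"
  have n1: "norm \<omega>1 = 1" unfolding \<omega>1_def using t s by (simp add: t_def[symmetric])
  have xr: "x = p' + t *\<^sub>R \<omega>1" using t s by (simp add: \<omega>1_def)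
  \<comment> \<open>A second receiver, seen from \<open>p'\<close> at a right angle to
    \<open>x\<close>: the inner products with \<open>\<omega>2\<close> show that its direction from
    \<open>x\<close> differs from that of the receiver facing \<open>x\<close>.\<close>
  obtain v :: "real^3" where v: "v \<noteq> 0" "orthogonal \<omega>1 v"
    using orthogonal_to_vector_exists[of \<omega>1] by auto
  define \<omega>2 where "\<omega>2 = (1 / norm v) *\<^sub>R v"
  have n2: "norm \<omega>2 = 1" and orth: "\<omega>1 \<bullet> \<omega>2 = 0" using v by (auto simp: \<omega>2_def orthogonal_def)
  define y1 y2 where "y1 = p' + s *\<^sub>R \<omega>1" and "y2 = p' + s *\<^sub>R \<omega>2"
  have ee: "E y1 = E y2" "x \<noteq> y1" "x \<noteq> y2" using Ey[OF y1_def n1] Ey[OF y2_def n2] by auto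
  have xy: "x - y1 = (t - s) *\<^sub>R \<omega>1" "x - y2 = t *\<^sub>R \<omega>1 - s *\<^sub>R \<omega>2"
    unfolding y1_def y2_def xr by (simp_all add: algebra_simps)
  have "E y1 \<bullet> \<omega>2 = 0" unfolding E_def xy using orth by simp
  moreover have "E y2 \<bullet> \<omega>2 = (1 / norm (x - y2)) * (- s)"
    unfolding E_def inner_scaleR_left by (simp add: xy inner_diff_left orth norm_eq_1[THEN iffD1, OF n2])
  ultimately have "(1 / norm (x - y2)) * (- s) = 0" using ee(1) by simp
  then show False using s ee(3) by simp
qed

lemma equal_arrival_balls:
  assumes "equal_arrival c1 c2 p p' r1 r2 s" "equal_arrival c2 c1 p p' r2 r1 s"
  shows "c1 = c2 \<and> r1 = r2"
proof -
  interpret A: equal_arrival c1 c2 p p' r1 r2 s by (rule assms(1))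
  interpret B: equal_arrival c2 c1 p p' r2 r1 s by (rule assms(2))
  obtain x where x: "phi_min c1 r1 p p' x" "phi_min c2 r2 p p' x"
    using A.same_center_minimizer[OF assms(2)] by blast
  have r: "r1 = r2" using A.not_smaller[OF x] B.not_smaller[OF x(2,1)] by simp
  have "p' \<in> cball p' s" using A.s by simp
  then have "c1 - x = c2 - x"
    using phi_min_normal(2)[OF x(1) A.r(1) A.seg1] phi_min_normal(2)[OF x(2) A.r(2) A.seg2] r by simp
  then show ?thesis using r by simp
qed

text \<open>\<open>arrival_time_contradiction\<close> needs its point source in the open ball, while
  \<open>x1\<close> may lie on the boundary. An interior point \<open>z\<close> close to
  \<open>x1\<close> still has a small enough value; the factor in \<open>2 * dist z x1\<close>
  accounts for both legs of the path.\<close>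

lemma arrival_time_le:
  fixes c1 c2 p p' y x1 x2 :: "real^3"
  assumes pos: "r1 > 0" "r2 > 0" "\<eta> > 0" "T > 0"
    and ws1: "weak_solution (ball c1 r1) (indicator (ball p \<eta>)) T u1"
    and ws2: "weak_solution (ball c2 r2) (indicator (ball p \<eta>)) T u2"
    and eq: "AE z in lborel. z \<in> ball p' \<eta>' \<times> {0<..<T} \<longrightarrow> u1 z = u2 z"
    and disj1: "cball p \<eta> \<inter> cball c1 r1 = {}" "cball p' \<eta>' \<inter> cball c1 r1 = {}"
    and disj2: "cball p \<eta> \<inter> cball c2 r2 = {}" "cball p' \<eta>' \<inter> cball c2 r2 = {}"
    and y: "y \<in> ball p' \<eta>'" and x1: "x1 \<in> cball c1 r1" "phi x1 p y < T + \<eta>" and x2: "phi_min c2 r2 p y x2"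
  shows "phi x2 p y \<le> phi x1 p y"
proof (rule ccontr)
  assume "\<not> phi x2 p y \<le> phi x1 p y"
  then have lt: "phi x1 p y < phi x2 p y" by simp
  define d where "d = min (phi x2 p y) (T + \<eta>) - phi x1 p y"
  have d: "d > 0" using lt x1(2) by (simp add: d_def)
  have "x1 \<in> closure (ball c1 r1)" using x1(1) pos by simp
  then obtain z where z: "z \<in> ball c1 r1" "dist z x1 < d / 2"
    using d unfolding closure_approachable by (meson half_gt_zero)
  have "phi z p y \<le> phi x1 p y + 2 * dist z x1"
    using dist_triangle[of p z x1] dist_triangle[of z y x1] by (simp add: phi_def dist_commute)
  then have "phi z p y < phi x1 p y + d" using z(2) by linarith
  then have l: "phi z p y < phi x2 p y" "phi z p y < T + \<eta>" by (auto simp: d_def)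
  have far: "\<eta> \<le> dist x p" if "x \<in> cball c1 r1 \<or> x \<in> cball c2 r2" for x
  proof (rule ccontr)
    assume "\<not> \<eta> \<le> dist x p"
    then have "x \<in> cball p \<eta>" by (simp add: dist_commute)
    then show False using that disj1(1) disj2(1) by blast
  qed
  show False
  proof (rule arrival_time_contradiction[OF pos ws1 ws2 eq _ _ _ _ y z(1) _ l])
    show "phi x2 p y \<le> phi x p y" if "x \<in> cball c2 r2" for x using that x2 by (simp add: phi_min_def)
  qed (use far disj1 disj2 ball_subset_cball in blast)+
qed

text \<open>The hypothesis on \<open>T\<close> leaves an excess of up to \<open>\<eta>' - s\<close>
  over \<open>T + \<eta>\<close>. Moving the receiver by \<open>l\<close> toward \<open>x1\<close>,
  still inside \<open>ball p' \<eta>'\<close>, lowers the value of \<open>x1\<close> by exactly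
  \<open>l\<close>, so that \<open>arrival_time_le\<close> applies; moving back raises the other
  value by at most \<open>l\<close>.\<close>

lemma sphere_arrival_le:
  fixes c1 c2 p p' x1 x2 \<omega> :: "real^3"
  assumes pos: "r1 > 0" "r2 > 0" "\<eta> > 0" "T > 0"
    and ws1: "weak_solution (ball c1 r1) (indicator (ball p \<eta>)) T u1"
    and ws2: "weak_solution (ball c2 r2) (indicator (ball p \<eta>)) T u2"
    and eq: "AE z in lborel. z \<in> ball p' \<eta>' \<times> {0<..<T} \<longrightarrow> u1 z = u2 z"
    and disj1: "cball p \<eta> \<inter> cball c1 r1 = {}" "cball p' \<eta>' \<inter> cball c1 r1 = {}"
    and disj2: "cball p \<eta> \<inter> cball c2 r2 = {}" "cball p' \<eta>' \<inter> cball c2 r2 = {}"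
    and s: "0 < s" "s < \<eta>'"
    and Tc: "T > (SUP \<omega> \<in> sphere 0 1. Inf ((\<lambda>x. phi x p (p' + s *\<^sub>R \<omega>)) ` frontier (ball c1 r1))) - (\<eta> + \<eta>' - s)"
    and \<omega>: "norm \<omega> = 1"
    and x1: "phi_min c1 r1 p (p' + s *\<^sub>R \<omega>) x1" and x2: "phi_min c2 r2 p (p' + s *\<^sub>R \<omega>) x2"
  shows "phi x2 p (p' + s *\<^sub>R \<omega>) \<le> phi x1 p (p' + s *\<^sub>R \<omega>)"
proof (rule ccontr)
  define y0 where "y0 = p' + s *\<^sub>R \<omega>"
  assume "\<not> phi x2 p (p' + s *\<^sub>R \<omega>) \<le> phi x1 p (p' + s *\<^sub>R \<omega>)"
  then have lt: "phi x1 p y0 < phi x2 p y0" by (simp add: y0_def)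
  have fr: "frontier (ball c1 r1) = sphere c1 r1" using pos by (simp add: frontier_ball)
  have ne: "sphere c1 r1 \<noteq> {}" using pos by simp
  have phi0: "phi x p y \<ge> 0" for x y by (simp add: phi_def)
  have "phi x1 p y0 \<le> Inf ((\<lambda>x. phi x p (p' + s *\<^sub>R \<omega>)) ` frontier (ball c1 r1))"
    unfolding fr using ne x1 by (intro cINF_greatest) (auto simp: phi_min_def y0_def)
  also have "\<dots> \<le> (SUP \<omega> \<in> sphere 0 1. Inf ((\<lambda>x. phi x p (p' + s *\<^sub>R \<omega>)) ` frontier (ball c1 r1)))"
  \<comment> \<open>A real supremum is an upper bound only for sets bounded above; a single point
    \<open>q\<close> of the sphere bounds all the infima.\<close>
  proof (rule cSUP_upper)
    show "\<omega> \<in> sphere 0 1" using \<omega> by simp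
    obtain q where q: "q \<in> sphere c1 r1" using ne by blast
    show "bdd_above ((\<lambda>\<omega>. Inf ((\<lambda>x. phi x p (p' + s *\<^sub>R \<omega>)) ` frontier (ball c1 r1))) ` sphere 0 1)"
    proof (rule bdd_aboveI2)
      fix v :: "real^3" assume v: "v \<in> sphere 0 1"
      have "Inf ((\<lambda>x. phi x p (p' + s *\<^sub>R v)) ` frontier (ball c1 r1)) \<le> phi q p (p' + s *\<^sub>R v)"
        unfolding fr using q phi0 by (intro cINF_lower bdd_belowI2[of _ 0]) auto
      also have "\<dots> \<le> phi q p p' + s"
        using dist_triangle[of q "p' + s *\<^sub>R v" p'] v s by (simp add: phi_def dist_norm)
      finally show "Inf ((\<lambda>x. phi x p (p' + s *\<^sub>R v)) ` frontier (ball c1 r1)) \<le> phi q p p' + s" .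
    qed
  qed
  finally have le: "phi x1 p y0 < T + \<eta> + (\<eta>' - s)" using Tc by linarith
  \<comment> \<open>The midpoint between the shift required,
    \<open>phi x1 p y0 - T - \<eta>\<close>, and the shift available, \<open>\<eta>' - s\<close>;
    the maximum with half of the latter keeps \<open>l\<close> positive.\<close>
  define l where "l = max ((\<eta>' - s) / 2) ((phi x1 p y0 - T - \<eta> + (\<eta>' - s)) / 2)"
  have l: "0 < l" "l < \<eta>' - s" "phi x1 p y0 - l < T + \<eta>" using le s by (auto simp: l_def max_def field_simps)
  have y0p: "dist p' y0 = s" using \<omega> s by (simp add: y0_def dist_norm)
  have "x1 \<notin> cball p' \<eta>'" using x1 disj1(2) by (auto simp: phi_min_def)
  then have "dist x1 y0 > \<eta>' - s" using dist_triangle[of p' x1 y0] y0p by (simp add: dist_commute)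
  then have dl: "l < dist x1 y0" using l by linarith
  define y where "y = y0 + l *\<^sub>R ((1 / norm (x1 - y0)) *\<^sub>R (x1 - y0))"
  note t = phi_min_toward[OF x1[folded y0_def] l(1) dl, folded y_def]
  have yy0: "dist y0 y = l" using l(1) dl by (auto simp: y_def dist_norm)
  have yb: "y \<in> ball p' \<eta>'" using dist_triangle[of p' y y0] y0p yy0 l by simp
  obtain x where x: "phi_min c2 r2 p y x" using phi_min_exists[OF pos(2)] by blast
  have "phi x p y \<le> phi x1 p y"
    by (rule arrival_time_le[OF pos ws1 ws2 eq disj1 disj2 yb _ _ x]) (use x1 t(2) l in \<open>auto simp: phi_min_def\<close>)
  moreover have "phi x p y0 \<le> phi x p y + l" using dist_triangle[of x y0 y] yy0 by (simp add: phi_def dist_commute)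
  moreover have "phi x2 p y0 \<le> phi x p y0" using x2 x by (simp add: phi_min_def y0_def)
  ultimately show False using t(2) lt by linarith
qed

theorem theorem1p5:
  fixes c1 c2 p p' :: "real^3" and r1 r2 \<eta> \<eta>' s T :: real
    and u1 u2 :: "(real^3) \<times> real \<Rightarrow> real"
  assumes "r1 > 0" "r2 > 0" "\<eta> > 0" "\<eta>' > 0" "T > 0"
    and "convex hull (closure (ball p \<eta>) \<union> closure (ball p' \<eta>')) \<inter> closure (ball c1 r1) = {}"
    and "convex hull (closure (ball p \<eta>) \<union> closure (ball p' \<eta>')) \<inter> closure (ball c2 r2) = {}"
    and "0 < s" "s < \<eta>'"
    and "T > (SUP \<omega> \<in> sphere 0 1. Inf ((\<lambda>x. phi x p (p' + s *\<^sub>R \<omega>)) ` frontier (ball c1 r1)))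
              - (\<eta> + \<eta>' - s)"
    and "T > (SUP \<omega> \<in> sphere 0 1. Inf ((\<lambda>x. phi x p (p' + s *\<^sub>R \<omega>)) ` frontier (ball c2 r2)))
              - (\<eta> + \<eta>' - s)"
    and "weak_solution (ball c1 r1) (indicator (ball p \<eta>)) T u1"
    and "weak_solution (ball c2 r2) (indicator (ball p \<eta>)) T u2"
    and "AE z in lborel. z \<in> ball p' \<eta>' \<times> {0<..<T} \<longrightarrow> u1 z = u2 z"
  shows "ball c1 r1 = ball c2 r2"
proof -
  note pos = assms(1-5)
  have cl: "closure (ball p \<eta>) = cball p \<eta>" "closure (ball p' \<eta>') = cball p' \<eta>'"
    "closure (ball c1 r1) = cball c1 r1" "closure (ball c2 r2) = cball c2 r2"
    using pos by auto
  have disj1: "convex hull (cball p \<eta> \<union> cball p' \<eta>') \<inter> cball c1 r1 = {}"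
    and disj2: "convex hull (cball p \<eta> \<union> cball p' \<eta>') \<inter> cball c2 r2 = {}"
    using assms(6,7) unfolding cl by auto
  have sub: "cball p \<eta> \<subseteq> convex hull (cball p \<eta> \<union> cball p' \<eta>')" "cball p' \<eta>' \<subseteq> convex hull (cball p \<eta> \<union> cball p' \<eta>')"
    using hull_subset[of "cball p \<eta> \<union> cball p' \<eta>'" convex] by auto
  have d: "cball p \<eta> \<inter> cball c1 r1 = {}" "cball p' \<eta>' \<inter> cball c1 r1 = {}"
    "cball p \<eta> \<inter> cball c2 r2 = {}" "cball p' \<eta>' \<inter> cball c2 r2 = {}"
    using sub disj1 disj2 by auto
  \<comment> \<open>The hypothesis on the convex hull enters here: straight paths from
    \<open>p\<close> to receivers in \<open>cball p' s\<close> miss both obstacles, so the law of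
    reflection is available for all of them.\<close>
  have seg: "closed_segment p y \<subseteq> convex hull (cball p \<eta> \<union> cball p' \<eta>')" if "y \<in> cball p' s" for y
  proof (rule closed_segment_subset)
    show "p \<in> convex hull (cball p \<eta> \<union> cball p' \<eta>')" using sub(1) pos by (auto simp: subset_iff)
    have "y \<in> cball p' \<eta>'" using that assms(9) by simp
    then show "y \<in> convex hull (cball p \<eta> \<union> cball p' \<eta>')" using sub(2) by blast
  qed (rule convex_convex_hull)
  have far: "s < dist x p'" if "x \<in> cball c1 r1 \<or> x \<in> cball c2 r2" for x
  proof (rule ccontr)
    assume "\<not> s < dist x p'"
    then have "x \<in> cball p' \<eta>'" using assms(9) by (simp add: dist_commute)
    then show False using that d by blast
  qed
  have eq': "AE z in lborel. z \<in> ball p' \<eta>' \<times> {0<..<T} \<longrightarrow> u2 z = u1 z"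
    using assms(14) by (rule AE_mp) (auto intro!: AE_I2)
  note le12 = sphere_arrival_le[OF pos(1,2,3,5) assms(12,13,14) d assms(8,9,10)]
  note le21 = sphere_arrival_le[OF pos(2,1,3,5) assms(13,12) eq' d(3,4,1,2) assms(8,9,11)]
  have "equal_arrival c1 c2 p p' r1 r2 s"
    by unfold_locales (use pos assms(8) seg disj1 disj2 far le12 le21 in \<open>(blast intro: antisym)+\<close>)
  moreover have "equal_arrival c2 c1 p p' r2 r1 s"
    by unfold_locales (use pos assms(8) seg disj1 disj2 far le12 le21 in \<open>(blast intro: antisym)+\<close>)
  ultimately have "c1 = c2 \<and> r1 = r2" by (rule equal_arrival_balls)
  then show ?thesis by simp
qed

end
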